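(* Let $T\simeq(\mathbb C^\star)^n$ be a torus with character lattice $M\simeq\mathbb Z^n$, let $A\subset M$ be a finite set not contained in a hyperplane, and let $v_1,\dots,v_k\in\mathbb C^A$ be linearly independent. 1. If $A$ is the set of monomials of a Laurent polynomial $f$, then the engineered complete intersection $v_1*f=\cdots=v_k*f=0$ in $T$ is cancellable with the following cancellations: for every non-zero $l\in M^*$, $C_l$ is a complex upper unitriangular $k\times k$ matrix such that the tuple $\tilde f:=(v_1*f,\dots,v_k*f)\cdot C_l$ satisfies $\deg_l\tilde f_i=\varphi_l(i)$ for all $i=1,\dots,k$, where $\varphi_l$ is the $l$-support sequence of $(A,v_1,\dots,v_k)$. 2. For a generic Laurent polynomial $f\in\mathbb C^A$, it is nondegenerate upon these cancellations.
   Context: $\mathbb C^A$ is the space of Laurent polynomials $\sum_{a\in A}c_ax^a$ (also regarded as functions $A\to\mathbb C$, $a\mapsto c_a$). The set of monomials of $f$ is the set of those $a$ for which $x^a$ enters $f$ with a non-zero coefficient. The product $*:\mathbb C^A\times\mathbb C^A\to\mathbb C^A$ is coefficientwise multiplication: $x^a*x^b=x^a$ if $a=b$, and $0$ otherwise. "Generic" means outside a suitable proper algebraic subset of $\mathbb C^A$. For $l\in M^*$ the $l$-degree of $x^a$ is $l(a)$; $\deg_l g$ is the maximal $l$-degree of the monomials of $g$, and the $l$-leading part $g^l$ is the sum of the terms of $g$ of maximal $l$-degree. $l$-support sequence: a sequence $\varphi:\{1,\dots,k\}\to\mathbb Z$ is $l$-linearly independent if for every $c\in\mathbb Z$ the restrictions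 of the functions $v_i$ with $\varphi(i)\geqslant c$ to $A_{\geqslant c}:=\{a\in A\mid l(a)\geqslant c\}$ are linearly independent. It is $l$-support if it is $l$-linearly independent, but for every $i\leqslant k$ increasing its value at $i$ makes its restriction to $\{1,\dots,i\}$ $l$-linearly dependent. The $l$-support sequence exists and is unique; it is denoted $\varphi_l$. If $A$ is the set of monomials of $f$, matrices $C_l$ as in the claim exist. A tuple $g=(g_1,\dots,g_k)$ is cancellable with cancellations $C_l$ (upper unitriangular matrices of Laurent polynomials, $l\neq0$) if for $\tilde g=g\cdot C_l$ (row times matrix, $\tilde g_j=g_j+\sum_{i<j}c_{ij}g_i$) the set $\{\tilde g_1^l=\dots=\tilde g_i^l=0\}\subset T$ has codimension $i$ (the empty set being allowed) for all $l\ne0$ and $i\leqslant k$. It is nondegenerate upon the cancellations $C_l$ if $\tilde g_1^l=\dots=\tilde g_i^l=0$ is a regular system (differentials linearly independent at every solution in $T$) for all $l\neq0$ and $i\leqslant k$.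
   Formalization: In Part 1 the matrices C_l are shown to exist for every f with set of monomials A, but cancellability (the codimension condition) is asserted only for generic f, since it fails for some special f with full set of monomials. *)

theory Defs
  imports
    "HOL-Analysis.Analysis"
    "HOL-Library.Poly_Mapping"
    "HOL-Library.Extended_Nat"
begin

section \<open>The torus, its character lattice, Laurent polynomials\<close>

text \<open>In coordinates $T = (\mathbb{C}^\star)^n$, where $n$ is the cardinality of the index type,
  and both $M$ and $M^*$ are $\mathbb{Z}^n$. The ring structure of Laurent polynomials is the
  convolution structure of \<open>poly_mapping\<close>; \<open>keys f\<close> is the set of monomials of \<open>f\<close>, and
  \<open>lookup f a\<close> is the coefficient of $x^a$.\<close>

type_synonym 'n laurent = "(int ^ 'n) \<Rightarrow>\<^sub>0 complex"

definition torus :: "(complex ^ 'n::finite) set" where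
  "torus = {x. \<forall>m. x $ m \<noteq> 0}"

definition laurent_eval :: "'n::finite laurent \<Rightarrow> complex ^ 'n \<Rightarrow> complex" where
  "laurent_eval g x =
     (\<Sum>a\<in>Poly_Mapping.keys g. Poly_Mapping.lookup g a * (\<Prod>m\<in>UNIV. x $ m powi (a $ m)))"

definition laurent_space :: "(int ^ 'n::finite) set \<Rightarrow> 'n laurent set" where
  "laurent_space A = {f. Poly_Mapping.keys f \<subseteq> A}"

text \<open>The coefficientwise product $v * f$, as opposed to the product of Laurent polynomials.\<close>

definition cwprod :: "'n::finite laurent \<Rightarrow> 'n laurent \<Rightarrow> 'n laurent"  (infixl "\<star>" 70) where
  "v \<star> f = (\<Sum>a\<in>Poly_Mapping.keys f.
     Poly_Mapping.single a (Poly_Mapping.lookup v a * Poly_Mapping.lookup f a))"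

definition ldeg :: "int ^ 'n::finite \<Rightarrow> int ^ 'n \<Rightarrow> int" where
  "ldeg l a = (\<Sum>m\<in>UNIV. l $ m * a $ m)"

text \<open>Hyperplanes are affine: the hypothesis on $A$ is invariant under translations of $A$,
  that is, under multiplication of $f$ by a monomial.\<close>

definition in_hyperplane :: "(int ^ 'n::finite) set \<Rightarrow> bool" where
  "in_hyperplane A \<longleftrightarrow> (\<exists>l c. l \<noteq> 0 \<and> (\<forall>a\<in>A. ldeg l a = c))"

text \<open>The degree is unspecified for the zero polynomial.\<close>

definition deg_l :: "int ^ 'n::finite \<Rightarrow> 'n laurent \<Rightarrow> int" where
  "deg_l l g = Max (ldeg l ` Poly_Mapping.keys g)"

definition lead_l :: "int ^ 'n::finite \<Rightarrow> 'n laurent \<Rightarrow> 'n laurent" where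
  "lead_l l g = (\<Sum>a\<in>{a \<in> Poly_Mapping.keys g. ldeg l a = deg_l l g}.
     Poly_Mapping.single a (Poly_Mapping.lookup g a))"


section \<open>Support sequences\<close>

definition lin_indep_restr :: "nat set \<Rightarrow> (nat \<Rightarrow> 'n::finite laurent) \<Rightarrow> (int ^ 'n) set \<Rightarrow> bool" where
  "lin_indep_restr I v B \<longleftrightarrow>
     (\<forall>c :: nat \<Rightarrow> complex.
        (\<forall>a\<in>B. (\<Sum>i\<in>I. c i * Poly_Mapping.lookup (v i) a) = 0) \<longrightarrow> (\<forall>i\<in>I. c i = 0))"

definition l_lin_indep ::
  "int ^ 'n::finite \<Rightarrow> (int ^ 'n) set \<Rightarrow> (nat \<Rightarrow> 'n laurent) \<Rightarrow> nat \<Rightarrow> (nat \<Rightarrow> int) \<Rightarrow> bool" where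
  "l_lin_indep l A v k \<phi> \<longleftrightarrow>
     (\<forall>c. lin_indep_restr {i \<in> {1..k}. \<phi> i \<ge> c} v {a \<in> A. ldeg l a \<ge> c})"

definition l_support ::
  "int ^ 'n::finite \<Rightarrow> (int ^ 'n) set \<Rightarrow> (nat \<Rightarrow> 'n laurent) \<Rightarrow> nat \<Rightarrow> (nat \<Rightarrow> int) \<Rightarrow> bool" where
  "l_support l A v k \<phi> \<longleftrightarrow>
     l_lin_indep l A v k \<phi> \<and>
     (\<forall>i\<in>{1..k}. \<forall>c > \<phi> i. \<not> l_lin_indep l A v i (\<phi>(i := c)))"

definition support_seq ::
  "int ^ 'n::finite \<Rightarrow> (int ^ 'n) set \<Rightarrow> (nat \<Rightarrow> 'n laurent) \<Rightarrow> nat \<Rightarrow> nat \<Rightarrow> int" where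
  "support_seq l A v k = (THE \<phi>. \<phi> \<in> extensional {1..k} \<and> l_support l A v k \<phi>)"


section \<open>Codimension of algebraic subsets of the torus\<close>

definition torus_closed :: "(complex ^ 'n::finite) set \<Rightarrow> bool" where
  "torus_closed Z \<longleftrightarrow> (\<exists>S. Z = {x \<in> torus. \<forall>g\<in>S. laurent_eval g x = 0})"

definition torus_irreducible :: "(complex ^ 'n::finite) set \<Rightarrow> bool" where
  "torus_irreducible Y \<longleftrightarrow>
     torus_closed Y \<and> Y \<noteq> {} \<and>
     (\<forall>Y1 Y2. torus_closed Y1 \<and> torus_closed Y2 \<and> Y = Y1 \<union> Y2 \<longrightarrow> Y = Y1 \<or> Y = Y2)"

definition krull_dim :: "(complex ^ 'n::finite) set \<Rightarrow> enat" where
  "krull_dim Z = Sup {enat d | d. \<exists>Y :: nat \<Rightarrow> (complex ^ 'n) set.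
     (\<forall>i\<le>d. torus_irreducible (Y i) \<and> Y i \<subseteq> Z) \<and> (\<forall>i<d. Y i \<subset> Y (Suc i))}"

text \<open>The empty set has every codimension.\<close>

definition has_codim :: "(complex ^ 'n::finite) set \<Rightarrow> nat \<Rightarrow> bool" where
  "has_codim Z i \<longleftrightarrow> Z = {} \<or> krull_dim Z + enat i = enat CARD('n)"


section \<open>Cancellable tuples and nondegeneracy upon cancellations\<close>

text \<open>Tuples are indexed by \<open>{1..k}\<close> and matrices by \<open>{1..k} \<times> {1..k}\<close>; values elsewhere are
  irrelevant. A system of cancellations assigns a matrix \<open>C l\<close> to every nonzero \<open>l\<close>.\<close>

definition upper_unitriangular :: "nat \<Rightarrow> (nat \<Rightarrow> nat \<Rightarrow> 'n::finite laurent) \<Rightarrow> bool" where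
  "upper_unitriangular k C \<longleftrightarrow>
     (\<forall>i\<in>{1..k}. C i i = 1) \<and> (\<forall>i\<in>{1..k}. \<forall>j\<in>{1..k}. j < i \<longrightarrow> C i j = 0)"

definition complex_matrix :: "nat \<Rightarrow> (nat \<Rightarrow> nat \<Rightarrow> 'n::finite laurent) \<Rightarrow> bool" where
  "complex_matrix k C \<longleftrightarrow>
     (\<forall>i\<in>{1..k}. \<forall>j\<in>{1..k}. \<exists>c. C i j = Poly_Mapping.single 0 c)"

definition row_times ::
  "nat \<Rightarrow> (nat \<Rightarrow> 'n::finite laurent) \<Rightarrow> (nat \<Rightarrow> nat \<Rightarrow> 'n laurent) \<Rightarrow> nat \<Rightarrow> 'n laurent" where
  "row_times k g C j = (\<Sum>i\<in>{1..k}. g i * C i j)"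

definition torus_zeros :: "nat \<Rightarrow> (nat \<Rightarrow> 'n::finite laurent) \<Rightarrow> (complex ^ 'n) set" where
  "torus_zeros i h = {x \<in> torus. \<forall>j\<in>{1..i}. laurent_eval (h j) x = 0}"

definition regular_system :: "nat \<Rightarrow> (nat \<Rightarrow> 'n::finite laurent) \<Rightarrow> bool" where
  "regular_system i h \<longleftrightarrow>
     (\<forall>x\<in>torus_zeros i h. \<forall>c :: nat \<Rightarrow> complex.
        (\<forall>u. (\<Sum>j\<in>{1..i}. c j * frechet_derivative (laurent_eval (h j)) (at x) u) = 0)
          \<longrightarrow> (\<forall>j\<in>{1..i}. c j = 0))"

definition cancellable_with ::
  "nat \<Rightarrow> (nat \<Rightarrow> 'n::finite laurent) \<Rightarrow> (int ^ 'n \<Rightarrow> nat \<Rightarrow> nat \<Rightarrow> 'n laurent) \<Rightarrow> bool" where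
  "cancellable_with k g C \<longleftrightarrow>
     (\<forall>l. l \<noteq> 0 \<longrightarrow> upper_unitriangular k (C l) \<and>
        (\<forall>i\<in>{1..k}. has_codim (torus_zeros i (\<lambda>j. lead_l l (row_times k g (C l) j))) i))"

definition nondegenerate_upon ::
  "nat \<Rightarrow> (nat \<Rightarrow> 'n::finite laurent) \<Rightarrow> (int ^ 'n \<Rightarrow> nat \<Rightarrow> nat \<Rightarrow> 'n laurent) \<Rightarrow> bool" where
  "nondegenerate_upon k g C \<longleftrightarrow>
     (\<forall>l. l \<noteq> 0 \<longrightarrow> upper_unitriangular k (C l) \<and>
        (\<forall>i\<in>{1..k}. regular_system i (\<lambda>j. lead_l l (row_times k g (C l) j))))"


section \<open>Engineered complete intersections\<close>

text \<open>Polynomial functions on $\mathbb{C}^A$, in the coefficients as coordinates.\<close>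

inductive_set coeff_polynomials ::
  "(int ^ 'n::finite) set \<Rightarrow> ('n laurent \<Rightarrow> complex) set" for A where
  const: "(\<lambda>f. c) \<in> coeff_polynomials A"
| coord: "a \<in> A \<Longrightarrow> (\<lambda>f. Poly_Mapping.lookup f a) \<in> coeff_polynomials A"
| add: "p \<in> coeff_polynomials A \<Longrightarrow> q \<in> coeff_polynomials A \<Longrightarrow>
    (\<lambda>f. p f + q f) \<in> coeff_polynomials A"
| mult: "p \<in> coeff_polynomials A \<Longrightarrow> q \<in> coeff_polynomials A \<Longrightarrow>
    (\<lambda>f. p f * q f) \<in> coeff_polynomials A"

definition generically :: "(int ^ 'n::finite) set \<Rightarrow> ('n laurent \<Rightarrow> bool) \<Rightarrow> bool" where
  "generically A P \<longleftrightarrow>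
     (\<exists>S \<subseteq> coeff_polynomials A.
        {f \<in> laurent_space A. \<forall>p\<in>S. p f = 0} \<noteq> laurent_space A \<and>
        (\<forall>f \<in> laurent_space A - {f \<in> laurent_space A. \<forall>p\<in>S. p f = 0}. P f))"

definition engineered :: "(nat \<Rightarrow> 'n::finite laurent) \<Rightarrow> 'n laurent \<Rightarrow> nat \<Rightarrow> 'n laurent" where
  "engineered v f i = v i \<star> f"

text \<open>The clause on nonvanishing makes \<open>deg_l\<close> meaningful; it is automatic if \<open>keys f = A\<close>
  and \<open>v\<close> is linearly independent.

  These matrices exist for every \<open>f\<close> whose set of monomials is \<open>A\<close>, but the codimension
  condition in \<open>cancellable_with\<close> needs \<open>f\<close> to be generic: for
  $A = \{(0,0), (1,0), (2,0), (0,1)\}$, $v_1 = 1+x$, $v_2 = 1+x^2$, $f = 1+x-x^2+y$ and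
  $l = (0,-1)$, the support sequence is $(0,0)$ and the leading parts are $1+x$ and
  $1-x^2+c(1+x)$, which vanish together on the curve $x = -1$.\<close>

definition engineered_cancellations ::
  "(int ^ 'n::finite) set \<Rightarrow> (nat \<Rightarrow> 'n laurent) \<Rightarrow> nat \<Rightarrow> 'n laurent
     \<Rightarrow> (int ^ 'n \<Rightarrow> nat \<Rightarrow> nat \<Rightarrow> 'n laurent) \<Rightarrow> bool" where
  "engineered_cancellations A v k f C \<longleftrightarrow>
     (\<forall>l. l \<noteq> 0 \<longrightarrow> upper_unitriangular k (C l) \<and> complex_matrix k (C l) \<and>
        (\<forall>i\<in>{1..k}. row_times k (engineered v f) (C l) i \<noteq> 0 \<and>
           deg_l l (row_times k (engineered v f) (C l) i) = support_seq l A v k i))"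

end

theory Submission
  imports Defs "HOL-Complex_Analysis.Conformal_Mappings"
begin

text \<open>For fixed \<open>l\<close> the matrices \<open>C\<^sub>l\<close> turn the system into \<open>u\<^sub>j * f\<close>, where \<open>u\<^sub>j\<close> is the top
  \<open>l\<close>-degree part of a vector of minimal degree in \<open>v\<^sub>j + \<langle>v\<^sub>1, \<dots>, v\<^sub>j\<^sub>-\<^sub>1\<rangle>\<close>. The \<open>u\<^sub>j\<close> are linearly
  independent, and \<open>\<langle>u\<^sub>1, \<dots>, u\<^sub>i\<rangle>\<close> depends only on \<open>i\<close> and on the preorder that \<open>l\<close> induces on \<open>A\<close>,
  so only finitely many systems occur.

  Smoothness for generic \<open>f\<close>: otherwise, in an ultrapower of \<open>\<complex>\<close>, there is a system with
  algebraically independent coefficients \<open>f\<^sub>a\<close>, a solution \<open>x\<close>, and a relation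
  \<open>\<Sum> c\<^sub>j d\<^sub>x(u\<^sub>j * f) = 0\<close>. Applying to \<open>(u\<^sub>j * f)(x) = 0\<close> a derivation that is \<open>\<partial>/\<partial>f\<^sub>b\<close> on the
  coefficients gives \<open>\<Sum> c\<^sub>j u\<^sub>j(b) = 0\<close> for all \<open>b\<close>, whence \<open>c = 0\<close>.

  A regular system of \<open>i\<close> equations has codimension \<open>i\<close>. A chain of irreducible sets of length \<open>d\<close>
  produces \<open>d\<close> algebraically independent functions on its largest member, and derivations dual to them
  at its generic point show that their differentials and those of the equations are independent.
  Conversely, the inverse function theorem parametrises the zero set locally by a ball, and the Zariski
  closures of the images of a flag of linear slices form a chain.\<close>

section \<open>Ultrapowers of fields\<close>

text \<open>Over \<complex> every coefficient is a constant, so an equation cannot be differentiated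
  with respect to one. In the ultrapower the coefficients become algebraically independent while the
  solution and the relation stay in the same field, so identities valid at all complex stages
  persist. The derivation \<partial>/\<partial>f_b extends to this field, but its values at the
  coordinates of \<open>x\<close> are uncontrolled. The argument survives because the derivative of
  x^a is x^a times a linear form in a: the unknown motion of \<open>x\<close> contributes to each
  equation a combination of its logarithmic partial derivatives, and exactly these are annihilated
  by the relation. The same mechanism bounds dimensions from above, with a generic point of an
  irreducible set in place of generic coefficients. Since the matrices are prescribed through
  degrees only, singularity is formulated so that it depends on the spans of the \<open>u_j\<close>
  alone; one representative then handles all choices.\<close>

definition ultrafilter :: "'a filter \<Rightarrow> bool" where
  "ultrafilter U \<longleftrightarrow> U \<noteq> bot \<and> (\<forall>P. eventually P U \<or> eventually (\<lambda>x. \<not> P x) U)"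

text \<open>Zorn's lemma for the reverse order on the proper filters below \<open>F\<close>. A
  minimal one decides every \<open>P\<close>: if \<open>P\<close> does not fail eventually, then
  intersecting the filter with \<open>P\<close> keeps it proper and hence changes nothing.\<close>

lemma ex_ultrafilter_le:
  assumes "F \<noteq> bot"
  shows "\<exists>U\<le>F. ultrafilter U"
proof -
  let ?r = "\<lambda>G H :: 'a filter. H \<le> G"
  have "\<exists>m\<in>{G. G \<noteq> bot \<and> G \<le> F}. \<forall>a\<in>{G. G \<noteq> bot \<and> G \<le> F}. ?r m a \<longrightarrow> a = m"
  proof (rule predicate_Zorn)
    show "partial_order_on {G. G \<noteq> bot \<and> G \<le> F} (relation_of ?r {G. G \<noteq> bot \<and> G \<le> F})"
      by (auto simp: partial_order_on_def preorder_on_def relation_of_def refl_on_def trans_def antisym_def)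
  next
    fix C assume "C \<in> Chains (relation_of ?r {G. G \<noteq> bot \<and> G \<le> F})"
    then have C: "\<And>G. G \<in> C \<Longrightarrow> G \<noteq> bot \<and> G \<le> F" "\<And>G H. G \<in> C \<Longrightarrow> H \<in> C \<Longrightarrow> G \<le> H \<or> H \<le> G"
      by (auto simp: Chains_def relation_of_def)
    show "\<exists>u\<in>{G. G \<noteq> bot \<and> G \<le> F}. \<forall>a\<in>C. u \<le> a"
    proof (cases "C = {}")
      case True
      then show ?thesis using assms by auto
    next
      case False
      \<comment> \<open>In a chain an event holds eventually for the infimum as soon as it does for
        a single member, so the infimum remains proper.\<close>
      have ev: "eventually P (Inf C) \<longleftrightarrow> (\<exists>G\<in>C. eventually P G)" for P
        by (rule eventually_Inf_base[OF False]) (metis C(2) inf.order_iff inf.commute order_refl)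
      have "Inf C \<noteq> bot"
        using C(1) by (auto simp: trivial_limit_def ev)
      moreover obtain G where "G \<in> C" using False by blast
      then have "Inf C \<le> F" using C(1) Inf_lower2[of G C F] by simp
      ultimately have "Inf C \<in> {G. G \<noteq> bot \<and> G \<le> F}" by simp
      moreover have "\<forall>a\<in>C. Inf C \<le> a" by (simp add: Inf_lower)
      ultimately show ?thesis by (rule bexI[rotated])
    qed
  qed
  then obtain U where U: "U \<noteq> bot" "U \<le> F"
    and min: "\<And>G. G \<noteq> bot \<Longrightarrow> G \<le> U \<Longrightarrow> G = U"
    by (auto intro: order_trans)
  have "eventually P U \<or> eventually (\<lambda>x. \<not> P x) U" for P
  proof (rule disjCI)
    assume n: "\<not> eventually (\<lambda>x. \<not> P x) U"
    let ?G = "inf U (principal {x. P x})"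
    have "?G \<noteq> bot"
      using n by (auto simp: trivial_limit_def eventually_inf_principal)
    then have "?G = U" by (rule min) simp
    moreover have "eventually P ?G" by (simp add: eventually_inf_principal)
    ultimately show "eventually P U" by simp
  qed
  with U show ?thesis unfolding ultrafilter_def by blast
qed

text \<open>The index set is \<open>'x set\<close> rather than \<open>'x\<close>: an ultrafilter finer than
  \<open>finite_subsets_at_top UNIV\<close> makes the ultrapower saturated for families of conditions
  indexed by \<open>'x\<close>, so that one type serves all such families.\<close>

definition fin_ultra :: "'x set filter" where
  "fin_ultra = (SOME U. U \<le> finite_subsets_at_top UNIV \<and> ultrafilter U)"

lemma
  shows fin_ultra_le: "(fin_ultra :: 'x set filter) \<le> finite_subsets_at_top UNIV"
    and ultrafilter_fin_ultra: "ultrafilter (fin_ultra :: 'x set filter)"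
proof -
  have "\<exists>U. U \<le> finite_subsets_at_top (UNIV :: 'x set) \<and> ultrafilter U"
    using ex_ultrafilter_le[OF finite_subsets_at_top_neq_bot] by blast
  from someI_ex[OF this]
  show "(fin_ultra :: 'x set filter) \<le> finite_subsets_at_top UNIV" "ultrafilter (fin_ultra :: 'x set filter)"
    unfolding fin_ultra_def by auto
qed

lemma fin_ultra_neq_bot [simp]: "fin_ultra \<noteq> bot"
  using ultrafilter_fin_ultra by (auto simp: ultrafilter_def)

lemma eventually_not_fin_ultra:
  "eventually (\<lambda>x. \<not> P x) fin_ultra \<longleftrightarrow> \<not> eventually P fin_ultra"
proof
  assume "eventually (\<lambda>x. \<not> P x) fin_ultra"
  then show "\<not> eventually P fin_ultra"
    using eventually_elim2[of P fin_ultra "\<lambda>x. \<not> P x" "\<lambda>_. False"] by auto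
qed (use ultrafilter_fin_ultra in \<open>auto simp: ultrafilter_def\<close>)

text \<open>At a finite \<open>s\<close> choose a point that meets the conditions listed in
  \<open>s\<close>. A fixed \<open>p\<close> lies in almost every \<open>s\<close>, so the chosen
  family meets every condition almost everywhere.\<close>

lemma fin_ultra_saturated:
  fixes X :: "'x set" and Q :: "'x \<Rightarrow> 'b \<Rightarrow> bool"
  assumes "\<And>F. finite F \<Longrightarrow> F \<subseteq> X \<Longrightarrow> \<exists>y\<in>Y. \<forall>p\<in>F. Q p y"
  obtains y :: "'x set \<Rightarrow> 'b"
  where "\<And>s. y s \<in> Y" "\<And>p. p \<in> X \<Longrightarrow> eventually (\<lambda>s. Q p (y s)) fin_ultra"
proof -
  have "\<exists>y. \<forall>s. y s \<in> Y \<and> (finite s \<longrightarrow> (\<forall>p\<in>s \<inter> X. Q p (y s)))"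
  proof (rule choice, rule allI)
    fix s :: "'x set"
    show "\<exists>y. y \<in> Y \<and> (finite s \<longrightarrow> (\<forall>p\<in>s \<inter> X. Q p y))"
    proof (cases "finite s")
      case True
      then have "\<exists>y\<in>Y. \<forall>p\<in>s \<inter> X. Q p y" by (intro assms) simp_all
      then show ?thesis by blast
    next
      case False
      \<comment> \<open>Infinite sets are negligible for the filter; at them the empty subfamily
        still supplies a member of \<open>Y\<close>.\<close>
      have "\<exists>y\<in>Y. \<forall>p\<in>{}. Q p y" by (rule assms) simp_all
      with False show ?thesis by blast
    qed
  qed
  then obtain y where y: "\<forall>s. y s \<in> Y \<and> (finite s \<longrightarrow> (\<forall>p\<in>s \<inter> X. Q p (y s)))" ..
  show ?thesis
  proof (rule that)
    fix s show "y s \<in> Y" using y by simp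
  next
    fix p assume "p \<in> X"
    have "eventually (\<lambda>s. finite s \<and> {p} \<subseteq> s \<and> s \<subseteq> UNIV) (finite_subsets_at_top UNIV)"
      by (auto simp: eventually_finite_subsets_at_top)
    then have "eventually (\<lambda>s. finite s \<and> {p} \<subseteq> s \<and> s \<subseteq> UNIV) fin_ultra"
      by (rule filter_leD[OF fin_ultra_le])
    then show "eventually (\<lambda>s. Q p (y s)) fin_ultra"
    proof (rule eventually_mono)
      fix s assume "finite s \<and> {p} \<subseteq> s \<and> s \<subseteq> UNIV"
      with y \<open>p \<in> X\<close> show "Q p (y s)" by blast
    qed
  qed
qed

definition ultra_rel :: "('x set \<Rightarrow> 'a) \<Rightarrow> ('x set \<Rightarrow> 'a) \<Rightarrow> bool" where
  "ultra_rel f g \<longleftrightarrow> eventually (\<lambda>s. f s = g s) fin_ultra"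

quotient_type ('x, 'a) ultra = "'x set \<Rightarrow> 'a" / ultra_rel
proof (rule equivpI)
  show "reflp (ultra_rel :: ('x set \<Rightarrow> 'a) \<Rightarrow> _)" by (auto simp: reflp_def ultra_rel_def)
  show "symp (ultra_rel :: ('x set \<Rightarrow> 'a) \<Rightarrow> _)" by (auto simp: symp_def ultra_rel_def eq_commute)
  show "transp (ultra_rel :: ('x set \<Rightarrow> 'a) \<Rightarrow> _)"
    unfolding transp_def ultra_rel_def by (auto elim: eventually_elim2)
qed

instantiation ultra :: (type, field) field
begin

lift_definition zero_ultra :: "('a, 'b) ultra" is "\<lambda>_. 0" .
lift_definition one_ultra :: "('a, 'b) ultra" is "\<lambda>_. 1" .
lift_definition plus_ultra :: "('a, 'b) ultra \<Rightarrow> ('a, 'b) ultra \<Rightarrow> ('a, 'b) ultra" is "\<lambda>f g s. f s + g s"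
  unfolding ultra_rel_def by (auto elim: eventually_elim2)
lift_definition times_ultra :: "('a, 'b) ultra \<Rightarrow> ('a, 'b) ultra \<Rightarrow> ('a, 'b) ultra" is "\<lambda>f g s. f s * g s"
  unfolding ultra_rel_def by (auto elim: eventually_elim2)
lift_definition minus_ultra :: "('a, 'b) ultra \<Rightarrow> ('a, 'b) ultra \<Rightarrow> ('a, 'b) ultra" is "\<lambda>f g s. f s - g s"
  unfolding ultra_rel_def by (auto elim: eventually_elim2)
lift_definition uminus_ultra :: "('a, 'b) ultra \<Rightarrow> ('a, 'b) ultra" is "\<lambda>f s. - f s"
  unfolding ultra_rel_def by (auto elim: eventually_mono)
lift_definition inverse_ultra :: "('a, 'b) ultra \<Rightarrow> ('a, 'b) ultra" is "\<lambda>f s. inverse (f s)"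
  unfolding ultra_rel_def by (auto elim: eventually_mono)
lift_definition divide_ultra :: "('a, 'b) ultra \<Rightarrow> ('a, 'b) ultra \<Rightarrow> ('a, 'b) ultra" is "\<lambda>f g s. f s / g s"
  unfolding ultra_rel_def by (auto elim: eventually_elim2)

instance
proof
  fix a b c :: "('a, 'b) ultra"
  show "a + b + c = a + (b + c)" "a + b = b + a" "0 + a = a" "- a + a = 0" "a - b = a + - b"
    "a * b * c = a * (b * c)" "a * b = b * a" "1 * a = a" "(a + b) * c = a * c + b * c"
    "a div b = a * inverse b" "inverse (0 :: ('a, 'b) ultra) = 0"
    by (transfer, simp add: ultra_rel_def algebra_simps divide_inverse)+
  show "0 \<noteq> (1 :: ('a, 'b) ultra)"
    by transfer (simp add: ultra_rel_def)
  show "a \<noteq> 0 \<Longrightarrow> inverse a * a = 1"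
  proof (transfer, unfold ultra_rel_def)
    fix f :: "'a set \<Rightarrow> 'b"
    assume "\<not> eventually (\<lambda>s. f s = 0) fin_ultra"
    \<comment> \<open>Maximality of the filter is what turns a nonzero class into a class with
      almost everywhere invertible entries.\<close>
    then have "eventually (\<lambda>s. f s \<noteq> 0) fin_ultra" by (simp add: eventually_not_fin_ultra)
    then show "eventually (\<lambda>s. inverse (f s) * f s = 1) fin_ultra"
      by (rule eventually_mono) simp
  qed
qed

end

lift_definition ultra_of :: "('x set \<Rightarrow> 'a) \<Rightarrow> ('x, 'a) ultra" is "\<lambda>f. f" .

lemma ultra_of_eq_iff: "ultra_of f = ultra_of g \<longleftrightarrow> eventually (\<lambda>s. f s = g s) fin_ultra"
  by transfer (simp add: ultra_rel_def)

lemma ultra_of_0 [simp]: "ultra_of (\<lambda>_. 0) = 0" by transfer (simp add: ultra_rel_def)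
lemma ultra_of_1 [simp]: "ultra_of (\<lambda>_. 1) = 1" by transfer (simp add: ultra_rel_def)

lemma ultra_of_add: "ultra_of (\<lambda>s. f s + g s) = ultra_of f + ultra_of g"
  by transfer (simp add: ultra_rel_def)

lemma ultra_of_mult: "ultra_of (\<lambda>s. f s * g s) = ultra_of f * ultra_of g"
  by transfer (simp add: ultra_rel_def)

lemma ultra_of_diff: "ultra_of (\<lambda>s. f s - g s) = ultra_of f - ultra_of g"
  by transfer (simp add: ultra_rel_def)

lemma ultra_of_sum: "ultra_of (\<lambda>s. \<Sum>i\<in>I. f i s) = (\<Sum>i\<in>I. ultra_of (f i))"
  by (induction I rule: infinite_finite_induct) (auto simp: ultra_of_add)

lemma ultra_of_eq_0_iff: "ultra_of f = 0 \<longleftrightarrow> eventually (\<lambda>s. f s = 0) fin_ultra"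
  using ultra_of_eq_iff[of f "\<lambda>_. 0"] by simp

lemma ultra_of_surj: "\<exists>f. x = ultra_of f"
  by (transfer, rule exI, rule equivp_reflp[OF ultra_equivp])

lemma of_nat_ultra: "of_nat n = (ultra_of (\<lambda>_. of_nat n) :: ('x, 'a :: field) ultra)"
proof (induction n)
  case (Suc n)
  then show ?case by (simp add: ultra_of_add)
qed simp

text \<open>Characteristic zero will make minimal relations separable when derivations are
  extended.\<close>

instance ultra :: (type, field_char_0) field_char_0
proof
  show "inj (of_nat :: nat \<Rightarrow> ('a, 'b) ultra)"
    by (auto simp: inj_def of_nat_ultra ultra_of_eq_iff)
qed

lemma of_int_ultra: "of_int n = (ultra_of (\<lambda>_. of_int n) :: ('x, 'a :: field) ultra)"
  by (cases n rule: int_diff_cases) (simp add: of_nat_ultra ultra_of_diff)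

section \<open>Extending derivations\<close>

text \<open>Subrings rather than subfields: relations are reduced by pseudo-division, so inverses
  never have to stay inside, and adjoining an element takes only polynomials in it.\<close>

definition subring :: "'a :: ring_1 set \<Rightarrow> bool" where
  "subring F \<longleftrightarrow> 1 \<in> F \<and> (\<forall>x\<in>F. \<forall>y\<in>F. x - y \<in> F \<and> x * y \<in> F)"

lemma subring_0: "subring F \<Longrightarrow> 0 \<in> F"
  unfolding subring_def by (metis diff_self)

lemma subring_1: "subring F \<Longrightarrow> 1 \<in> F"
  by (simp add: subring_def)

lemma subring_mult: "subring F \<Longrightarrow> x \<in> F \<Longrightarrow> y \<in> F \<Longrightarrow> x * y \<in> F"
  by (simp add: subring_def)

lemma subring_diff: "subring F \<Longrightarrow> x \<in> F \<Longrightarrow> y \<in> F \<Longrightarrow> x - y \<in> F"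
  by (simp add: subring_def)

lemma subring_add: "subring F \<Longrightarrow> x \<in> F \<Longrightarrow> y \<in> F \<Longrightarrow> x + y \<in> F"
  using subring_diff[of F x "0 - y"] subring_diff[of F 0 y] subring_0[of F] by simp

lemma subring_sum: "subring F \<Longrightarrow> (\<And>i. i \<in> I \<Longrightarrow> f i \<in> F) \<Longrightarrow> sum f I \<in> F"
  by (induction I rule: infinite_finite_induct) (auto intro: subring_0 subring_add)

text \<open>The values may leave \<open>F\<close>. This freedom matters when an algebraic element is
  adjoined: its derivative is a quotient, and \<open>F\<close> is only a ring.\<close>

definition derivation_on :: "'a :: ring_1 set \<Rightarrow> ('a \<Rightarrow> 'a) \<Rightarrow> bool" where
  "derivation_on F D \<longleftrightarrow> (\<forall>x\<in>F. \<forall>y\<in>F. D (x + y) = D x + D y \<and> D (x * y) = x * D y + D x * y)"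

lemma derivation_on_add: "derivation_on F D \<Longrightarrow> x \<in> F \<Longrightarrow> y \<in> F \<Longrightarrow> D (x + y) = D x + D y"
  by (simp add: derivation_on_def)

lemma derivation_on_mult: "derivation_on F D \<Longrightarrow> x \<in> F \<Longrightarrow> y \<in> F \<Longrightarrow> D (x * y) = x * D y + D x * y"
  by (simp add: derivation_on_def)

lemma derivation_on_0: "subring F \<Longrightarrow> derivation_on F D \<Longrightarrow> D 0 = 0"
  using derivation_on_add[of F D 0 0] subring_0[of F] by simp

lemma derivation_on_1: "subring F \<Longrightarrow> derivation_on F D \<Longrightarrow> D 1 = 0"
  using derivation_on_mult[of F D 1 1] subring_1[of F] by simp

lemma derivation_on_sum:
  assumes "subring F" "derivation_on F D" "\<And>i. i \<in> I \<Longrightarrow> f i \<in> F"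
  shows "D (sum f I) = (\<Sum>i\<in>I. D (f i))"
  using assms(3)
proof (induction I rule: infinite_finite_induct)
  case (insert i I)
  then show ?case
    using derivation_on_add[OF assms(2), of "f i" "sum f I"] subring_sum[OF assms(1), of I f] by auto
qed (auto simp: derivation_on_0[OF assms(1,2)])

definition polys_over :: "'a :: zero set \<Rightarrow> 'a poly set" where
  "polys_over F = {q. \<forall>n. coeff q n \<in> F}"

lemma subring_polys_over:
  fixes F :: "'a :: comm_ring_1 set"
  assumes F: "subring F"
  shows "subring (polys_over F)"
  unfolding subring_def polys_over_def
  using subring_0[OF F] subring_1[OF F] subring_diff[OF F]
  by (auto simp: coeff_mult intro!: subring_sum[OF F] subring_mult[OF F])

lemma monom_polys_over: "subring F \<Longrightarrow> c \<in> F \<Longrightarrow> monom c n \<in> polys_over F"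
  by (auto simp: polys_over_def subring_0)

context
  fixes F :: "'a :: field_char_0 set" and D and \<theta> \<delta> :: 'a
  assumes F: "subring F" and D: "derivation_on F D"
begin

text \<open>The only candidate for the value at \<open>q(\<theta>)\<close> of an extension of \<open>D\<close> with \<open>\<theta> \<mapsto> \<delta>\<close>.\<close>

private definition E :: "'a poly \<Rightarrow> 'a" where
  "E q = poly (map_poly D q) \<theta> + poly (pderiv q) \<theta> * \<delta>"

private lemma D0: "D 0 = 0"
  by (rule derivation_on_0[OF F D])

private lemma E_add: "p \<in> polys_over F \<Longrightarrow> q \<in> polys_over F \<Longrightarrow> E (p + q) = E p + E q"
proof -
  assume pq: "p \<in> polys_over F" "q \<in> polys_over F"
  then have "map_poly D (p + q) = map_poly D p + map_poly D q"
    by (intro poly_eqI) (auto simp: coeff_map_poly D0 polys_over_def derivation_on_add[OF D])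
  then show ?thesis by (simp add: E_def pderiv_add algebra_simps)
qed

private lemma E_diff: "p \<in> polys_over F \<Longrightarrow> q \<in> polys_over F \<Longrightarrow> E (p - q) = E p - E q"
  using E_add[of "p - q" q] subring_diff[OF subring_polys_over[OF F], of p q] by simp

private lemma E_mult:
  assumes "p \<in> polys_over F" "q \<in> polys_over F"
  shows "E (p * q) = poly p \<theta> * E q + E p * poly q \<theta>"
proof -
  have c: "coeff p n \<in> F" "coeff q n \<in> F" for n
    using assms by (auto simp: polys_over_def)
  have "map_poly D (p * q) = p * map_poly D q + map_poly D p * q"
  proof (rule poly_eqI)
    fix n
    have "coeff (map_poly D (p * q)) n = D (\<Sum>i\<le>n. coeff p i * coeff q (n - i))"
      by (simp add: coeff_map_poly D0 coeff_mult)
    also have "\<dots> = (\<Sum>i\<le>n. D (coeff p i * coeff q (n - i)))"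
      by (rule derivation_on_sum[OF F D]) (auto intro: subring_mult[OF F] c)
    also have "\<dots> = coeff (p * map_poly D q + map_poly D p * q) n"
      by (simp add: derivation_on_mult[OF D] c coeff_mult coeff_map_poly D0 sum.distrib)
    finally show "coeff (map_poly D (p * q)) n = coeff (p * map_poly D q + map_poly D p * q) n" .
  qed
  then show ?thesis by (simp add: E_def pderiv_mult algebra_simps)
qed

text \<open>\<open>E\<close> descends to a derivation on \<open>F[\<theta>]\<close> exactly when it
  kills every relation of \<open>\<theta>\<close>. The hypothesis is vacuous for a transcendental
  element; for an algebraic one it is enough that \<open>E\<close> kills one relation of least
  degree, to which the others reduce by induction on the degree.\<close>

lemma derivation_extend_step:
  assumes min: "\<And>q. q \<in> polys_over F \<Longrightarrow> q \<noteq> 0 \<Longrightarrow> poly q \<theta> = 0 \<Longrightarrow>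
      \<exists>\<mu>\<in>polys_over F. \<mu> \<noteq> 0 \<and> poly \<mu> \<theta> = 0 \<and> degree \<mu> \<le> degree q \<and>
        poly (map_poly D \<mu>) \<theta> + poly (pderiv \<mu>) \<theta> * \<delta> = 0"
  shows "\<exists>F' D'. subring F' \<and> F \<subseteq> F' \<and> \<theta> \<in> F' \<and> derivation_on F' D' \<and>
    (\<forall>x\<in>F. D' x = D x) \<and> D' \<theta> = \<delta>"
proof -
  note R = subring_polys_over[OF F]
  have E_zero: "E q = 0" if "q \<in> polys_over F" "poly q \<theta> = 0" for q
    using that
  proof (induction "degree q" arbitrary: q rule: less_induct)
    case less
    show ?case
    proof (cases "q = 0")
      case True
      then show ?thesis by (simp add: E_def)
    next
      case False
      with min less.prems obtain \<mu> where \<mu>: "\<mu> \<in> polys_over F" "\<mu> \<noteq> 0" "poly \<mu> \<theta> = 0"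
        "degree \<mu> \<le> degree q" "E \<mu> = 0" unfolding E_def by blast
      define c where "c = lead_coeff \<mu>"
      define m where "m = monom (lead_coeff q) (degree q - degree \<mu>)"
      \<comment> \<open>Pseudo-remainder: multiplying \<open>q\<close> by the leading coefficient of
        \<open>\<mu>\<close> avoids division in \<open>F\<close>. As \<open>q\<close> and
        \<open>\<mu>\<close> vanish at \<open>\<theta>\<close> and \<open>E \<mu> = 0\<close>, the
        Leibniz rule leaves \<open>E r = c * E q\<close>.\<close>
      define r where "r = [:c:] * q - m * \<mu>"
      have c: "c \<in> F" "c \<noteq> 0" using \<mu> by (auto simp: c_def polys_over_def)
      have cm: "[:c:] \<in> polys_over F" using monom_polys_over[OF F c(1), of 0] by (simp add: monom_0)
      have m: "m \<in> polys_over F"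
        unfolding m_def by (rule monom_polys_over[OF F]) (use less.prems in \<open>auto simp: polys_over_def\<close>)
      have rF: "r \<in> polys_over F"
        unfolding r_def using cm less.prems m \<mu> by (intro subring_diff[OF R] subring_mult[OF R]) auto
      have r0: "poly r \<theta> = 0" by (simp add: r_def less.prems \<mu>)
      have "E r = 0"
      proof (cases "r = 0")
        case False
        have "degree ([:c:] * q) = degree q" using c by simp
        moreover have "degree (m * \<mu>) = degree q"
          using False \<mu> \<open>q \<noteq> 0\<close> by (subst degree_mult_eq) (auto simp: m_def degree_monom_eq)
        moreover have "coeff r (degree q) = 0"
          using \<mu>(4) by (simp add: r_def m_def coeff_monom_mult c_def)
        ultimately have "degree r < degree q"
          using False by (metis degree_diff_le le_neq_implies_less leading_coeff_0_iff order_refl r_def)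
        then show ?thesis using less.hyps rF r0 by blast
      qed (simp add: E_def)
      moreover have "E r = c * E q"
      proof -
        have "E r = E ([:c:] * q) - E (m * \<mu>)"
          unfolding r_def using cm less.prems m \<mu> by (intro E_diff subring_mult[OF R]) auto
        also have "\<dots> = c * E q"
          using E_mult[OF cm less.prems(1)] E_mult[OF m \<mu>(1)] less.prems \<mu> by simp
        finally show ?thesis .
      qed
      ultimately show ?thesis using c by simp
    qed
  qed
  define F' where "F' = (\<lambda>q. poly q \<theta>) ` polys_over F"
  \<comment> \<open>The choice of representative is immaterial: two of them differ by a relation,
    which \<open>E\<close> kills.\<close>
  define D' where "D' y = E (SOME q. q \<in> polys_over F \<and> poly q \<theta> = y)" for y
  have D': "D' (poly q \<theta>) = E q" if "q \<in> polys_over F" for q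
  proof -
    let ?q = "SOME p. p \<in> polys_over F \<and> poly p \<theta> = poly q \<theta>"
    have p: "?q \<in> polys_over F \<and> poly ?q \<theta> = poly q \<theta>" by (rule someI[of _ q]) (use that in simp)
    then have "E (?q - q) = 0" by (intro E_zero subring_diff[OF R]) (use that in auto)
    then show ?thesis using E_diff[OF conjunct1[OF p] that] by (simp add: D'_def)
  qed
  have F'I: "poly q \<theta> \<in> F'" if "q \<in> polys_over F" for q
    using that by (simp add: F'_def)
  have F'E: "\<exists>q\<in>polys_over F. y = poly q \<theta>" if "y \<in> F'" for y
    using that by (auto simp: F'_def)
  have "subring F'"
    unfolding subring_def
  proof (intro conjI ballI)
    show "1 \<in> F'" using F'I[OF subring_1[OF R]] by simp
    fix x y assume "x \<in> F'" "y \<in> F'"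
    with F'E obtain p q where pq: "p \<in> polys_over F" "x = poly p \<theta>" "q \<in> polys_over F" "y = poly q \<theta>"
      by metis
    show "x - y \<in> F'" using F'I[OF subring_diff[OF R pq(1,3)]] pq by simp
    show "x * y \<in> F'" using F'I[OF subring_mult[OF R pq(1,3)]] pq by simp
  qed
  moreover have cF: "[:x:] \<in> polys_over F" if "x \<in> F" for x
    using monom_polys_over[OF F that, of 0] by (simp add: monom_0)
  have "F \<subseteq> F'" using F'I[OF cF] by auto
  moreover have X: "[:0, 1:] \<in> polys_over F"
    using monom_polys_over[OF F subring_1[OF F], of 1] by (simp add: monom_Suc monom_0)
  have "\<theta> \<in> F'" using F'I[OF X] by simp
  moreover have "derivation_on F' D'"
    unfolding derivation_on_def
  proof (intro ballI conjI)
    fix x y assume "x \<in> F'" "y \<in> F'"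
    with F'E obtain p q where pq: "p \<in> polys_over F" "x = poly p \<theta>" "q \<in> polys_over F" "y = poly q \<theta>"
      by metis
    show "D' (x + y) = D' x + D' y"
      using D'[OF subring_add[OF R pq(1,3)]] D'[OF pq(1)] D'[OF pq(3)] E_add[OF pq(1,3)] pq by simp
    show "D' (x * y) = x * D' y + D' x * y"
      using D'[OF subring_mult[OF R pq(1,3)]] D'[OF pq(1)] D'[OF pq(3)] E_mult[OF pq(1,3)] pq by simp
  qed
  moreover have "\<forall>x\<in>F. D' x = D x"
    using D'[OF cF] by (auto simp: E_def map_poly_pCons D0)
  moreover have "D' \<theta> = \<delta>"
    using D'[OF X] derivation_on_1[OF F D] by (simp add: E_def map_poly_pCons D0 pderiv_pCons)
  ultimately show ?thesis by blast
qed

end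

definition transcendental_over :: "'a :: field set \<Rightarrow> 'a \<Rightarrow> bool" where
  "transcendental_over F \<theta> \<longleftrightarrow> (\<forall>q\<in>polys_over F. poly q \<theta> = 0 \<longrightarrow> q = 0)"

lemma derivation_extend_transcendental:
  fixes F :: "'a :: field_char_0 set"
  assumes "subring F" "derivation_on F D" "transcendental_over F \<theta>"
  shows "\<exists>F' D'. subring F' \<and> F \<subseteq> F' \<and> \<theta> \<in> F' \<and> derivation_on F' D' \<and>
    (\<forall>x\<in>F. D' x = D x) \<and> D' \<theta> = \<delta>"
  by (rule derivation_extend_step) (use assms in \<open>auto simp: transcendental_over_def\<close>)

text \<open>For algebraic \<open>\<theta>\<close> the value is forced by differentiating a relation
  of least degree. Its formal derivative is nonzero in characteristic zero, has smaller degree and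
  coefficients in \<open>F\<close>, so minimality prevents it from vanishing at
  \<open>\<theta>\<close>.\<close>

lemma derivation_extend_one:
  fixes F :: "'a :: field_char_0 set"
  assumes F: "subring F" and D: "derivation_on F D"
  shows "\<exists>F' D'. subring F' \<and> F \<subseteq> F' \<and> \<theta> \<in> F' \<and> derivation_on F' D' \<and> (\<forall>x\<in>F. D' x = D x)"
proof (cases "transcendental_over F \<theta>")
  case True
  show ?thesis using derivation_extend_transcendental[OF F D True, of 0] by blast
next
  case False
  let ?P = "\<lambda>q. q \<in> polys_over F \<and> q \<noteq> 0 \<and> poly q \<theta> = 0"
  define \<mu> where "\<mu> = (ARG_MIN degree q. ?P q)"
  obtain q0 where "?P q0" using False by (auto simp: transcendental_over_def)
  then have \<mu>: "?P \<mu>" "\<And>q. ?P q \<Longrightarrow> degree \<mu> \<le> degree q"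
    unfolding \<mu>_def using arg_min_natI[of ?P q0 degree] arg_min_nat_le[of ?P _ degree] by auto
  have deg: "degree \<mu> > 0"
  proof (rule ccontr)
    assume "\<not> degree \<mu> > 0"
    then obtain c where "\<mu> = [:c:]" by (metis degree_0_id gr0I)
    with \<mu>(1) show False by simp
  qed
  have "pderiv \<mu> \<in> polys_over F"
  proof -
    have "of_nat n \<in> F" for n
      by (induction n) (auto intro: subring_0[OF F] subring_add[OF F] subring_1[OF F])
    then show ?thesis
      using \<mu>(1) by (simp add: polys_over_def coeff_pderiv subring_mult[OF F] del: of_nat_Suc)
  qed
  moreover have "degree (pderiv \<mu>) < degree \<mu>" "pderiv \<mu> \<noteq> 0"
    using deg by (auto simp: degree_pderiv pderiv_eq_0_iff)
  ultimately have sep: "poly (pderiv \<mu>) \<theta> \<noteq> 0"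
    using \<mu>(2)[of "pderiv \<mu>"] by auto
  \<comment> \<open>The only value at \<open>\<theta>\<close> compatible with the relation
    \<open>\<mu>\<close>.\<close>
  define \<delta> where "\<delta> = - poly (map_poly D \<mu>) \<theta> / poly (pderiv \<mu>) \<theta>"
  have "\<exists>F' D'. subring F' \<and> F \<subseteq> F' \<and> \<theta> \<in> F' \<and> derivation_on F' D' \<and>
      (\<forall>x\<in>F. D' x = D x) \<and> D' \<theta> = \<delta>"
  proof (rule derivation_extend_step[OF F D])
    fix q assume "q \<in> polys_over F" "q \<noteq> 0" "poly q \<theta> = 0"
    then show "\<exists>\<mu>\<in>polys_over F. \<mu> \<noteq> 0 \<and> poly \<mu> \<theta> = 0 \<and> degree \<mu> \<le> degree q \<and>
        poly (map_poly D \<mu>) \<theta> + poly (pderiv \<mu>) \<theta> * \<delta> = 0"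
      using \<mu> sep by (intro bexI[of _ \<mu>]) (auto simp: \<delta>_def)
  qed
  then show ?thesis by blast
qed

theorem derivation_extend:
  fixes F :: "'a :: field_char_0 set"
  assumes F: "subring F" and D: "derivation_on F D"
  shows "\<exists>D'. derivation_on UNIV D' \<and> (\<forall>x\<in>F. D' x = D x)"
proof -
  define ext where "ext F' D' \<longleftrightarrow> subring F' \<and> F \<subseteq> F' \<and> derivation_on F' D' \<and> (\<forall>x\<in>F. D' x = D x)"
    for F' D'
  \<comment> \<open>Inclusion of graphs encodes both enlargement of the domain and agreement of the
    derivations.\<close>
  define graph where "graph F' D' = (\<lambda>x. (x, D' x)) ` F'" for F' and D' :: "'a \<Rightarrow> 'a"
  define \<A> where "\<A> = {G. \<exists>F' D'. ext F' D' \<and> G = graph F' D'}"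
  have "\<exists>M\<in>\<A>. \<forall>G\<in>\<A>. M \<subseteq> G \<longrightarrow> G = M"
  proof (rule subset_Zorn_nonempty)
    show "\<A> \<noteq> {}" using F D by (auto simp: \<A>_def ext_def)
    fix \<C> assume "\<C> \<noteq> {}" and chain: "subset.chain \<A> \<C>"
    define G where "G = \<Union>\<C>"
    define F' where "F' = fst ` G"
    define D' where "D' x = (SOME y. (x, y) \<in> G)" for x
    \<comment> \<open>Each axiom involves at most two elements of the domain, and the chain puts
      these into a single member, where the axiom is known.\<close>
    have two: "\<exists>F1 D1. ext F1 D1 \<and> graph F1 D1 \<in> \<C> \<and> p \<in> graph F1 D1 \<and> q \<in> graph F1 D1"
      if "p \<in> G" "q \<in> G" for p q
    proof -
      from that obtain G1 G2 where "G1 \<in> \<C>" "G2 \<in> \<C>" "p \<in> G1" "q \<in> G2"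
        unfolding G_def by blast
      moreover from this have "G1 \<subseteq> G2 \<or> G2 \<subseteq> G1" using chain by (auto simp: subset.chain_def)
      moreover have "\<C> \<subseteq> \<A>" using chain by (simp add: subset.chain_def)
      ultimately have "\<exists>G3\<in>\<A>. G3 \<in> \<C> \<and> p \<in> G3 \<and> q \<in> G3" by blast
      then show ?thesis unfolding \<A>_def by blast
    qed
    have D': "D' x = y" if "(x, y) \<in> G" for x y
    proof -
      have "(x, D' x) \<in> G" unfolding D'_def by (rule someI) (rule that)
      from two[OF this that] show ?thesis by (auto simp: graph_def)
    qed
    have G: "G = graph F' D'"
      using D' by (force simp: F'_def graph_def image_iff)
    have two': "\<exists>F1 D1. ext F1 D1 \<and> F1 \<subseteq> F' \<and> (\<forall>z\<in>F1. D' z = D1 z) \<and> x \<in> F1 \<and> y \<in> F1"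
      if "x \<in> F'" "y \<in> F'" for x y
    proof -
      from that have "(x, D' x) \<in> G" "(y, D' y) \<in> G" unfolding G by (auto simp: graph_def)
      from two[OF this] obtain F1 D1 where *: "ext F1 D1" "graph F1 D1 \<in> \<C>" "x \<in> F1" "y \<in> F1"
        by (auto simp: graph_def)
      have "graph F1 D1 \<subseteq> graph F' D'" using *(2) G unfolding G_def by blast
      then have "F1 \<subseteq> F'" "\<forall>z\<in>F1. D' z = D1 z" by (auto simp: graph_def)
      with * show ?thesis by blast
    qed
    obtain G0 where "G0 \<in> \<C>" using \<open>\<C> \<noteq> {}\<close> by blast
    moreover from this have "G0 \<in> \<A>" using chain by (auto simp: subset.chain_def)
    ultimately obtain F0 D0 where 0: "ext F0 D0" "graph F0 D0 \<in> \<C>"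
      unfolding \<A>_def by blast
    have "graph F0 D0 \<subseteq> graph F' D'" using 0(2) G unfolding G_def by blast
    then have 1: "F0 \<subseteq> F'" "\<forall>z\<in>F0. D' z = D0 z" by (auto simp: graph_def)
    have "ext F' D'"
      unfolding ext_def
    proof (intro conjI ballI)
      have "F \<subseteq> F0" "\<And>x. x \<in> F \<Longrightarrow> D0 x = D x" "1 \<in> F0"
        using 0(1) by (simp_all add: ext_def subring_def)
      with 1 show "F \<subseteq> F'" "\<And>x. x \<in> F \<Longrightarrow> D' x = D x" by auto
      have "1 \<in> F'" using \<open>1 \<in> F0\<close> 1 by blast
      moreover have "x - y \<in> F'" "x * y \<in> F'" if xy: "x \<in> F'" "y \<in> F'" for x y
      proof -
        obtain F1 D1 where *: "ext F1 D1" "F1 \<subseteq> F'" "x \<in> F1" "y \<in> F1" using two'[OF xy] by blast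
        then have "subring F1" by (simp add: ext_def)
        then show "x - y \<in> F'" "x * y \<in> F'"
          using * subring_diff[of F1 x y] subring_mult[of F1 x y] by auto
      qed
      ultimately show "subring F'" by (simp add: subring_def)
      show "derivation_on F' D'"
        unfolding derivation_on_def
      proof (intro ballI)
        fix x y assume xy: "x \<in> F'" "y \<in> F'"
        obtain F1 D1 where *: "ext F1 D1" "F1 \<subseteq> F'" "\<forall>z\<in>F1. D' z = D1 z" "x \<in> F1" "y \<in> F1"
          using two'[OF xy] by blast
        then have "subring F1" "derivation_on F1 D1" by (simp_all add: ext_def)
        with * show "D' (x + y) = D' x + D' y \<and> D' (x * y) = x * D' y + D' x * y"
          using subring_add[of F1 x y] subring_mult[of F1 x y] by (simp add: derivation_on_def)
      qed
    qed
    then show "\<Union>\<C> \<in> \<A>" unfolding G_def[symmetric] \<A>_def using G by blast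
  qed
  then obtain M where M: "M \<in> \<A>" "\<forall>G\<in>\<A>. M \<subseteq> G \<longrightarrow> G = M" ..
  from M(1) obtain F1 D1 where 1: "ext F1 D1" "M = graph F1 D1" unfolding \<A>_def by blast
  \<comment> \<open>A missing element could be adjoined by \<open>derivation_extend_one\<close>,
    contrary to maximality.\<close>
  have "\<theta> \<in> F1" for \<theta>
  proof -
    obtain F2 D2 where 2: "subring F2" "F1 \<subseteq> F2" "\<theta> \<in> F2" "derivation_on F2 D2" "\<forall>x\<in>F1. D2 x = D1 x"
      using derivation_extend_one[of F1 D1 \<theta>] 1(1) unfolding ext_def by blast
    have "ext F2 D2"
      unfolding ext_def using 1(1) 2 by (metis ext_def subset_iff)
    then have "graph F2 D2 \<in> \<A>" unfolding \<A>_def by blast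
    moreover have "M \<subseteq> graph F2 D2"
    proof
      fix p assume "p \<in> M"
      then obtain x where "x \<in> F1" "p = (x, D1 x)" by (auto simp: 1(2) graph_def)
      with 2(2,5) show "p \<in> graph F2 D2" by (metis graph_def imageI subsetD)
    qed
    ultimately have "graph F2 D2 = graph F1 D1" using M(2) 1(2) by simp
    then show ?thesis using 2 by (auto simp: graph_def)
  qed
  then have "F1 = UNIV" by blast
  with 1(1) have "derivation_on UNIV D1" "\<forall>x\<in>F. D1 x = D x" by (simp_all add: ext_def)
  then show ?thesis by blast
qed

text \<open>The partial derivative with respect to \<open>\<theta>\<close> on
  \<open>F[\<theta>]\<close>, extended to the whole field by choices that are not canonical.\<close>

corollary derivation_transcendental:
  fixes F :: "'a :: field_char_0 set"
  assumes F: "subring F" and \<theta>: "transcendental_over F \<theta>"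
  shows "\<exists>D. derivation_on UNIV D \<and> (\<forall>x\<in>F. D x = 0) \<and> D \<theta> = 1"
proof -
  have "derivation_on F (\<lambda>_. 0)" by (simp add: derivation_on_def)
  from derivation_extend_transcendental[OF F this \<theta>, of 1]
  obtain F' D' where "subring F'" "F \<subseteq> F'" "\<theta> \<in> F'" "derivation_on F' D'" "\<forall>x\<in>F. D' x = 0" "D' \<theta> = 1"
    by blast
  moreover from this derivation_extend[of F' D']
  obtain D where "derivation_on UNIV D" "\<forall>x\<in>F'. D x = D' x" by blast
  ultimately show ?thesis by (intro exI[of _ D]) auto
qed

section \<open>Evaluation and derivatives of Laurent polynomials\<close>

alias lookup = Poly_Mapping.lookup
alias keys = Poly_Mapping.keys
alias single = Poly_Mapping.single

definition mon :: "'a :: field ^ 'n::finite \<Rightarrow> int ^ 'n \<Rightarrow> 'a" where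
  "mon x a = (\<Prod>m\<in>UNIV. x $ m powi (a $ m))"

lemma mon_0 [simp]: "mon x 0 = 1"
  by (simp add: mon_def)

lemma mon_nonzero: "(\<And>m. x $ m \<noteq> 0) \<Longrightarrow> mon x a \<noteq> 0"
  by (simp add: mon_def)

lemma mon_add: "(\<And>m. x $ m \<noteq> 0) \<Longrightarrow> mon x (a + b) = mon x a * mon x b"
  by (simp add: mon_def power_int_add prod.distrib)

lemma mon_axis: "mon x (axis m 1) = x $ m"
proof -
  have "mon x (axis m 1) = (\<Prod>p\<in>UNIV. if p = m then x $ p else 1)"
    unfolding mon_def axis_def by (intro prod.cong) auto
  then show ?thesis by simp
qed

lemma laurent_eval_superset:
  assumes "finite S" "keys g \<subseteq> S"
  shows "laurent_eval g x = (\<Sum>a\<in>S. lookup g a * mon x a)"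
  unfolding laurent_eval_def mon_def
  by (rule sum.mono_neutral_left) (use assms in \<open>auto simp: in_keys_iff\<close>)

lemma laurent_eval_keys: "laurent_eval g x = (\<Sum>a\<in>keys g. lookup g a * mon x a)"
  by (rule laurent_eval_superset) auto

lemma laurent_eval_0 [simp]: "laurent_eval 0 x = 0"
  by (simp add: laurent_eval_keys)

lemma laurent_eval_single [simp]: "laurent_eval (single a c) x = c * mon x a"
  by (simp add: laurent_eval_keys)

lemma laurent_eval_1 [simp]: "laurent_eval 1 x = 1"
  by (simp add: laurent_eval_keys)

lemma laurent_eval_add: "laurent_eval (f + g) x = laurent_eval f x + laurent_eval g x"
proof -
  have "finite (keys f \<union> keys g)" "keys (f + g) \<subseteq> keys f \<union> keys g"
    using Poly_Mapping.keys_add[of f g] by simp_all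
  then show ?thesis
    by (simp add: laurent_eval_superset[of "keys f \<union> keys g"] lookup_add sum.distrib algebra_simps)
qed

lemma laurent_eval_uminus: "laurent_eval (- g) x = - laurent_eval g x"
  using laurent_eval_add[of g "- g" x] by (simp add: eq_neg_iff_add_eq_0 add.commute)

lemma laurent_eval_diff: "laurent_eval (f - g) x = laurent_eval f x - laurent_eval g x"
  using laurent_eval_add[of f "- g" x] by (simp add: laurent_eval_uminus)

lemma laurent_eval_sum: "laurent_eval (\<Sum>i\<in>I. f i) x = (\<Sum>i\<in>I. laurent_eval (f i) x)"
  by (induction I rule: infinite_finite_induct) (auto simp: laurent_eval_add)

lemma laurent_as_sum: "g = (\<Sum>a\<in>keys g. single a (lookup g a))"
proof (rule poly_mapping_eqI)
  fix b
  have "lookup (\<Sum>a\<in>keys g. single a (lookup g a)) b = (\<Sum>a\<in>keys g. if a = b then lookup g a else 0)"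
    by (simp add: lookup_sum lookup_single when_def)
  then show "lookup g b = lookup (\<Sum>a\<in>keys g. single a (lookup g a)) b"
    by (auto simp: in_keys_iff)
qed

lemma torus_nonzero: "x \<in> torus \<Longrightarrow> x $ m \<noteq> 0"
  by (simp add: torus_def)

lemma laurent_eval_mult:
  assumes "x \<in> torus"
  shows "laurent_eval (f * g) x = laurent_eval f x * laurent_eval g x"
proof -
  have "f * g = (\<Sum>a\<in>keys f. \<Sum>b\<in>keys g. single (a + b) (lookup f a * lookup g b))"
    by (subst laurent_as_sum[of f], subst laurent_as_sum[of g])
      (simp add: sum_product mult_single)
  then show ?thesis
    by (simp add: laurent_eval_sum laurent_eval_keys[of f] laurent_eval_keys[of g] sum_product
        mon_add torus_nonzero[OF assms] algebra_simps)
qed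

lemma lookup_const_mult: "lookup (single 0 c * g) a = c * lookup g (a :: int ^ 'n::finite)"
proof -
  have "lookup (Poly_Mapping.map ((*) c) g) a = c * lookup g a"
    by transfer (simp add: when_def)
  then show ?thesis by (simp add: mult_map_scale_conv_mult)
qed

text \<open>The logarithmic derivative \<open>x\<^sub>m \<partial>/\<partial>x\<^sub>m\<close>, which acts diagonally on monomials.\<close>

definition euler :: "'n \<Rightarrow> 'n::finite laurent \<Rightarrow> 'n laurent" where
  "euler m g = (\<Sum>a\<in>keys g. single a (of_int (a $ m) * lookup g a))"

lemma lookup_euler: "lookup (euler m g) b = of_int (b $ m) * lookup g b"
proof -
  have "lookup (euler m g) b = (\<Sum>a\<in>keys g. if a = b then of_int (a $ m) * lookup g a else 0)"
    by (simp add: euler_def lookup_sum lookup_single when_def)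
  then show ?thesis by (auto simp: in_keys_iff)
qed

lemma keys_euler: "keys (euler m g) \<subseteq> keys g"
  by (auto simp: in_keys_iff lookup_euler)

lemma laurent_eval_euler:
  assumes "finite S" "keys g \<subseteq> S"
  shows "laurent_eval (euler m g) x = (\<Sum>a\<in>S. of_int (a $ m) * lookup g a * mon x a)"
  using laurent_eval_superset[of S "euler m g"] keys_euler[of m g] assms
  by (simp add: lookup_euler)

lemma mon_has_derivative:
  fixes x :: "complex ^ 'n::finite"
  assumes "x \<in> torus"
  shows "((\<lambda>x. mon x a) has_derivative (\<lambda>u. \<Sum>m\<in>UNIV. of_int (a $ m) * mon x a * (u $ m / x $ m))) (at x)"
proof -
  note x = torus_nonzero[OF assms]
  have "((\<lambda>x. mon x a) has_derivative
     (\<lambda>u. \<Sum>m\<in>UNIV. (u $ m * (of_int (a $ m) * x $ m powi (a $ m - 1))) * (\<Prod>p\<in>UNIV - {m}. x $ p powi (a $ p)))) (at x)"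
    unfolding mon_def
    by (intro has_derivative_prod has_derivative_power_int x bounded_linear_imp_has_derivative
        bounded_linear_vec_nth)
  moreover have "(u $ m * (of_int (a $ m) * x $ m powi (a $ m - 1))) * (\<Prod>p\<in>UNIV - {m}. x $ p powi (a $ p))
      = of_int (a $ m) * mon x a * (u $ m / x $ m)" for u m
  proof -
    have "mon x a = x $ m powi (a $ m) * (\<Prod>p\<in>UNIV - {m}. x $ p powi (a $ p))"
      unfolding mon_def by (rule prod.remove) auto
    moreover have "x $ m powi (a $ m - 1) = x $ m powi (a $ m) / x $ m"
      by (simp add: power_int_diff x)
    ultimately show ?thesis by simp
  qed
  ultimately show ?thesis by simp
qed

lemma laurent_eval_has_derivative:
  fixes x :: "complex ^ 'n::finite"
  assumes "x \<in> torus"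
  shows "(laurent_eval g has_derivative (\<lambda>u. \<Sum>m\<in>UNIV. laurent_eval (euler m g) x / x $ m * u $ m)) (at x)"
proof -
  have "((\<lambda>x. \<Sum>a\<in>keys g. lookup g a * mon x a) has_derivative
     (\<lambda>u. \<Sum>a\<in>keys g. lookup g a * (\<Sum>m\<in>UNIV. of_int (a $ m) * mon x a * (u $ m / x $ m)))) (at x)"
    by (intro derivative_intros mon_has_derivative assms)
  moreover have "(\<lambda>x. \<Sum>a\<in>keys g. lookup g a * mon x a) = laurent_eval g"
    by (simp add: fun_eq_iff laurent_eval_keys)
  moreover have "(\<Sum>a\<in>keys g. lookup g a * (\<Sum>m\<in>UNIV. of_int (a $ m) * mon x a * (u $ m / x $ m)))
     = (\<Sum>m\<in>UNIV. laurent_eval (euler m g) x / x $ m * u $ m)" for u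
  proof -
    have "(\<Sum>a\<in>keys g. lookup g a * (\<Sum>m\<in>UNIV. of_int (a $ m) * mon x a * (u $ m / x $ m)))
        = (\<Sum>m\<in>UNIV. \<Sum>a\<in>keys g. lookup g a * (of_int (a $ m) * mon x a * (u $ m / x $ m)))"
      unfolding sum_distrib_left by (rule sum.swap)
    also have "\<dots> = (\<Sum>m\<in>UNIV. laurent_eval (euler m g) x / x $ m * u $ m)"
    proof (rule sum.cong[OF refl])
      fix m
      have "laurent_eval (euler m g) x / x $ m * u $ m = laurent_eval (euler m g) x * (u $ m / x $ m)"
        by simp
      also have "\<dots> = (\<Sum>a\<in>keys g. lookup g a * (of_int (a $ m) * mon x a * (u $ m / x $ m)))"
        unfolding laurent_eval_euler[OF finite_keys order_refl] sum_distrib_right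
        by (rule sum.cong) (simp_all only: mult_ac)
      finally show "(\<Sum>a\<in>keys g. lookup g a * (of_int (a $ m) * mon x a * (u $ m / x $ m)))
        = laurent_eval (euler m g) x / x $ m * u $ m" ..
    qed
    finally show ?thesis .
  qed
  ultimately show ?thesis by simp
qed

lemma frechet_laurent_eval:
  "x \<in> torus \<Longrightarrow> frechet_derivative (laurent_eval g) (at x) =
    (\<lambda>u. \<Sum>m\<in>UNIV. laurent_eval (euler m g) x / x $ m * u $ m)"
  by (rule frechet_derivative_at[OF laurent_eval_has_derivative, symmetric])

lemma continuous_on_laurent_eval: "continuous_on torus (laurent_eval g)"
  by (rule has_derivative_continuous_on[OF has_derivative_at_withinI[OF laurent_eval_has_derivative]])

text \<open>Scaling the m-th partial derivative by the unit \<open>x $ m\<close> does not affect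
  linear relations among differentials. In logarithmic form the gradients are Laurent polynomials
  without new monomials.\<close>

lemma regular_system_iff:
  "regular_system i h \<longleftrightarrow> (\<forall>x\<in>torus_zeros i h. \<forall>c.
     (\<forall>m. (\<Sum>j\<in>{1..i}. c j * laurent_eval (euler m (h j)) x) = 0) \<longrightarrow> (\<forall>j\<in>{1..i}. c j = 0))"
proof -
  have "(\<forall>u. (\<Sum>j\<in>{1..i}. c j * frechet_derivative (laurent_eval (h j)) (at x) u) = 0) \<longleftrightarrow>
      (\<forall>m. (\<Sum>j\<in>{1..i}. c j * laurent_eval (euler m (h j)) x) = 0)" (is "?L \<longleftrightarrow> ?R")
    if "x \<in> torus" for x c
  proof -
    have *: "(\<Sum>j\<in>{1..i}. c j * frechet_derivative (laurent_eval (h j)) (at x) u)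
        = (\<Sum>m\<in>UNIV. (\<Sum>j\<in>{1..i}. c j * laurent_eval (euler m (h j)) x) * (u $ m / x $ m))" for u
    proof -
      have "(\<Sum>j\<in>{1..i}. c j * frechet_derivative (laurent_eval (h j)) (at x) u)
          = (\<Sum>j\<in>{1..i}. \<Sum>m\<in>UNIV. c j * laurent_eval (euler m (h j)) x * (u $ m / x $ m))"
        by (simp add: frechet_laurent_eval[OF that] sum_distrib_left mult_ac)
      also have "\<dots> = (\<Sum>m\<in>UNIV. \<Sum>j\<in>{1..i}. c j * laurent_eval (euler m (h j)) x * (u $ m / x $ m))"
        by (rule sum.swap)
      finally show ?thesis by (simp only: sum_distrib_right)
    qed
    show ?thesis
    proof
      assume L: ?L
      show ?R
      proof
        fix m
        \<comment> \<open>Testing on the m-th coordinate vector scaled by \<open>x $ m\<close>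
          cancels the denominator.\<close>
        have "(\<Sum>p\<in>UNIV. (\<Sum>j\<in>{1..i}. c j * laurent_eval (euler p (h j)) x) * (axis m (x $ m) $ p / x $ p)) = 0"
          using L * by metis
        moreover have "(\<Sum>p\<in>UNIV. (\<Sum>j\<in>{1..i}. c j * laurent_eval (euler p (h j)) x) * (axis m (x $ m) $ p / x $ p))
          = (\<Sum>p\<in>UNIV. if p = m then \<Sum>j\<in>{1..i}. c j * laurent_eval (euler p (h j)) x else 0)"
          by (rule sum.cong) (auto simp: axis_def torus_nonzero[OF that])
        ultimately show "(\<Sum>j\<in>{1..i}. c j * laurent_eval (euler m (h j)) x) = 0"
          by simp
      qed
    next
      assume ?R
      then show ?L unfolding * by simp
    qed
  qed
  then show ?thesis by (auto simp: regular_system_def torus_zeros_def)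
qed

lemma additive_int_vec:
  fixes f :: "int ^ 'n::finite \<Rightarrow> 'a :: ring_1"
  assumes add: "\<And>a b. f (a + b) = f a + f b"
  shows "f a = (\<Sum>m\<in>UNIV. of_int (a $ m) * f (axis m 1))"
proof -
  have 0: "f 0 = 0" using add[of 0 0] by simp
  have sum: "f (\<Sum>i\<in>I. g i) = (\<Sum>i\<in>I. f (g i))" for I :: "'n set" and g
    by (induction I rule: infinite_finite_induct) (auto simp: 0 add)
  have ax: "f (axis m z) = of_int z * f (axis m 1)" for m z
  proof -
    have inc: "f (axis m (z + 1)) = f (axis m z) + f (axis m 1)" for z
      using add[of "axis m z" "axis m 1"] by (simp add: axis_def vec_eq_iff plus_vec_def if_distrib cong: if_cong)
    show ?thesis
    proof (induction z rule: int_induct[of _ 0])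
      case base
      have "axis m 0 = (0 :: int ^ 'n)" by (simp add: axis_def vec_eq_iff)
      then have "f (axis m 0) = 0" by (simp only: 0)
      then show ?case by simp
    next
      case (step1 z)
      then show ?case using inc[of z] by (simp add: algebra_simps)
    next
      case (step2 z)
      then show ?case using inc[of "z - 1"] by (simp add: algebra_simps)
    qed
  qed
  have "a = (\<Sum>m\<in>UNIV. axis m (a $ m))"
    by (simp add: vec_eq_iff axis_def)
  then have "f a = f (\<Sum>m\<in>UNIV. axis m (a $ m))" by (rule arg_cong)
  also have "\<dots> = (\<Sum>m\<in>UNIV. f (axis m (a $ m)))" by (rule sum)
  also have "\<dots> = (\<Sum>m\<in>UNIV. of_int (a $ m) * f (axis m 1))" by (rule sum.cong[OF refl ax])
  finally show ?thesis .
qed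

text \<open>The logarithmic derivative turns products of monomials into sums, so it is additive in
  the exponent and determined on the standard basis; \<open>\<eta> m\<close> is the logarithmic
  derivative of the m-th coordinate.\<close>

lemma derivation_monomial:
  fixes D :: "('x, complex) ultra \<Rightarrow> ('x, complex) ultra" and x :: "'x set \<Rightarrow> complex ^ 'n::finite"
  assumes D: "derivation_on UNIV D" and x: "\<And>s. x s \<in> torus"
  shows "\<exists>\<eta>. \<forall>a. D (ultra_of (\<lambda>s. mon (x s) a)) =
    ultra_of (\<lambda>s. mon (x s) a) * (\<Sum>m\<in>UNIV. of_int (a $ m) * \<eta> m)"
proof -
  define M where "M a = ultra_of (\<lambda>s. mon (x s) a)" for a
  have M0: "M a \<noteq> 0" for a
    unfolding M_def ultra_of_eq_0_iff
    using mon_nonzero[OF torus_nonzero[OF x]] by simp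
  have M_add: "M (a + b) = M a * M b" for a b
    unfolding M_def ultra_of_mult[symmetric]
    by (simp add: mon_add[OF torus_nonzero[OF x]])
  define f where "f a = D (M a) / M a" for a
  have "f (a + b) = f a + f b" for a b
    using M0 derivation_on_mult[OF D, of "M a" "M b"]
    by (simp add: f_def M_add field_simps)
  then have "f a = (\<Sum>m\<in>UNIV. of_int (a $ m) * f (axis m 1))" for a
    by (rule additive_int_vec)
  then have "D (M a) = M a * (\<Sum>m\<in>UNIV. of_int (a $ m) * f (axis m 1))" for a
    using M0[of a] by (simp add: f_def divide_eq_eq mult.commute)
  then show ?thesis unfolding M_def by (intro exI[of _ "\<lambda>m. f (axis m 1)"] allI)
qed

section \<open>Generic smoothness\<close>

lemma lookup_cwprod: "lookup (v \<star> f) a = lookup v a * lookup f a"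
proof -
  have "lookup (v \<star> f) a = (\<Sum>b\<in>keys f. if b = a then lookup v b * lookup f b else 0)"
    by (simp add: cwprod_def lookup_sum lookup_single when_def)
  then show ?thesis by (auto simp: in_keys_iff)
qed

lemma keys_cwprod_subset: "keys (v \<star> f) \<subseteq> keys v"
  by (auto simp: in_keys_iff lookup_cwprod)

lemma laurent_spaceD: "f \<in> laurent_space A \<Longrightarrow> a \<notin> A \<Longrightarrow> lookup f a = 0"
  by (auto simp: laurent_space_def in_keys_iff)

lemma laurent_space_iff: "f \<in> laurent_space A \<longleftrightarrow> (\<forall>a. a \<notin> A \<longrightarrow> lookup f a = 0)"
  by (auto simp: laurent_space_def in_keys_iff)

lemma coeff_polynomials_mono: "p \<in> coeff_polynomials B \<Longrightarrow> B \<subseteq> A \<Longrightarrow> p \<in> coeff_polynomials A"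
  by (induction rule: coeff_polynomials.induct) (auto intro: coeff_polynomials.intros)

lemma coeff_polynomials_cong:
  "p \<in> coeff_polynomials B \<Longrightarrow> (\<And>a. a \<in> B \<Longrightarrow> lookup f a = lookup g a) \<Longrightarrow> p f = p g"
  by (induction rule: coeff_polynomials.induct) auto

lemma coeff_polynomials_sum:
  "(\<And>i. i \<in> I \<Longrightarrow> p i \<in> coeff_polynomials A) \<Longrightarrow> (\<lambda>f. \<Sum>i\<in>I. p i f) \<in> coeff_polynomials A"
  by (induction I rule: infinite_finite_induct) (auto intro: coeff_polynomials.intros)

lemma coeff_polynomials_power:
  "p \<in> coeff_polynomials A \<Longrightarrow> (\<lambda>f. p f ^ n) \<in> coeff_polynomials A"
  by (induction n) (auto intro: coeff_polynomials.intros)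

lemma coeff_polynomials_diff:
  assumes "p \<in> coeff_polynomials A" "q \<in> coeff_polynomials A"
  shows "(\<lambda>f. p f - q f) \<in> coeff_polynomials A"
proof -
  have "(\<lambda>f. p f + (- 1) * q f) \<in> coeff_polynomials A"
    using assms by (intro coeff_polynomials.intros)
  then show ?thesis by simp
qed

lemma coeff_polynomial_on_line:
  assumes "p \<in> coeff_polynomials A"
  shows "\<exists>q. \<forall>t. p (f + single 0 t * g) = poly q t"
  using assms
proof induction
  case (const c)
  show ?case by (rule exI[of _ "[:c:]"]) simp
next
  case (coord a)
  show ?case
    by (rule exI[of _ "[:lookup f a, lookup g a:]"]) (simp add: lookup_add lookup_const_mult)
next
  case (add p q)
  then obtain r s where "\<forall>t. p (f + single 0 t * g) = poly r t" "\<forall>t. q (f + single 0 t * g) = poly s t"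
    by blast
  then show ?case by (intro exI[of _ "r + s"]) simp
next
  case (mult p q)
  then obtain r s where "\<forall>t. p (f + single 0 t * g) = poly r t" "\<forall>t. q (f + single 0 t * g) = poly s t"
    by blast
  then show ?case by (intro exI[of _ "r * s"]) simp
qed

definition nonzero_coeff_polys :: "(int ^ 'n::finite) set \<Rightarrow> ('n laurent \<Rightarrow> complex) set" where
  "nonzero_coeff_polys A = {p \<in> coeff_polynomials A. \<exists>f\<in>laurent_space A. p f \<noteq> 0}"

text \<open>The space of coefficients is irreducible: on the line joining a point with
  \<open>p\<close> nonzero to one with \<open>q\<close> nonzero, both become nonzero polynomials in
  one variable, and so does their product.\<close>

lemma nonzero_coeff_polys_mult:
  assumes "p \<in> nonzero_coeff_polys A" "q \<in> nonzero_coeff_polys A"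
  shows "(\<lambda>f. p f * q f) \<in> nonzero_coeff_polys A"
proof -
  from assms obtain f g where p: "p \<in> coeff_polynomials A" "f \<in> laurent_space A" "p f \<noteq> 0"
    and q: "q \<in> coeff_polynomials A" "g \<in> laurent_space A" "q g \<noteq> 0"
    by (auto simp: nonzero_coeff_polys_def)
  define h where "h t = f + single 0 t * (g - f)" for t
  have h_space: "h t \<in> laurent_space A" for t
    using p(2) q(2) by (auto simp: laurent_space_iff h_def lookup_add lookup_const_mult lookup_minus)
  have h01: "h 0 = f" "h 1 = g" by (simp_all add: h_def)
  obtain r s where r: "\<And>t. p (h t) = poly r t" and s: "\<And>t. q (h t) = poly s t"
    using coeff_polynomial_on_line[OF p(1)] coeff_polynomial_on_line[OF q(1)] unfolding h_def by metis
  have "r \<noteq> 0" "s \<noteq> 0" using r[of 0] s[of 1] p(3) q(3) by (auto simp: h01)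
  then have "r * s \<noteq> 0" by simp
  then obtain t where "poly (r * s) t \<noteq> 0" using poly_all_0_iff_0[of "r * s"] by blast
  then have "p (h t) * q (h t) \<noteq> 0" by (simp add: r s)
  then show ?thesis
    using h_space coeff_polynomials.mult[OF p(1) q(1)] by (auto simp: nonzero_coeff_polys_def)
qed

lemma nonzero_coeff_polys_prod:
  assumes "finite I" "\<And>i. i \<in> I \<Longrightarrow> p i \<in> nonzero_coeff_polys A"
  shows "(\<lambda>f. \<Prod>i\<in>I. p i f) \<in> nonzero_coeff_polys A"
  using assms
proof (induction I rule: finite_induct)
  case empty
  have "0 \<in> laurent_space A" by (simp add: laurent_space_iff)
  then show ?case by (auto simp: nonzero_coeff_polys_def intro: coeff_polynomials.intros)
next
  case (insert i I)
  then show ?case using nonzero_coeff_polys_mult[of "p i" A "\<lambda>f. \<Prod>i\<in>I. p i f"] by simp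
qed

text \<open>\<open>f\<close> represents a point over the ultrapower at which no nonzero polynomial
  with complex coefficients vanishes: its coefficients at \<open>A\<close> are algebraically
  independent over \<complex>.\<close>

context
  fixes A :: "(int ^ 'n::finite) set" and f :: "'x set \<Rightarrow> 'n laurent"
  assumes space: "\<And>s. f s \<in> laurent_space A"
    and generic: "\<And>p. p \<in> nonzero_coeff_polys A \<Longrightarrow> eventually (\<lambda>s. p (f s) \<noteq> 0) fin_ultra"
begin

text \<open>The ring generated over \<complex> by all coefficients of the generic \<open>f\<close>
  except the one at \<open>b\<close>.\<close>

private definition R :: "int ^ 'n \<Rightarrow> ('x, complex) ultra set" where
  "R b = (\<lambda>p. ultra_of (\<lambda>s. p (f s))) ` coeff_polynomials (A - {b})"

private lemma RI: "p \<in> coeff_polynomials (A - {b}) \<Longrightarrow> ultra_of (\<lambda>s. p (f s)) \<in> R b"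
  by (auto simp: R_def)

private lemma subring_R: "subring (R b)"
  unfolding subring_def
proof (intro conjI ballI)
  show "1 \<in> R b" using RI[OF coeff_polynomials.const[of 1]] by simp
  fix x y assume "x \<in> R b" "y \<in> R b"
  then obtain p q where pq: "p \<in> coeff_polynomials (A - {b})" "x = ultra_of (\<lambda>s. p (f s))"
    "q \<in> coeff_polynomials (A - {b})" "y = ultra_of (\<lambda>s. q (f s))"
    by (auto simp: R_def)
  show "x - y \<in> R b" using RI[OF coeff_polynomials_diff[OF pq(1,3)]] by (simp add: pq ultra_of_diff)
  show "x * y \<in> R b" using RI[OF coeff_polynomials.mult[OF pq(1,3)]] by (simp add: pq ultra_of_mult)
qed

private lemma ultra_of_power: "ultra_of (\<lambda>s. h s ^ n) = ultra_of h ^ n"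
  by (induction n) (simp_all add: ultra_of_mult)

text \<open>A relation for the coefficient at \<open>b\<close> lifts to a polynomial in all
  coefficients that vanishes at the generic point, hence identically. Letting the coefficient at
  \<open>b\<close> vary while the others stay fixed shows that the coefficients of the relation
  vanish identically too.\<close>

private lemma transcendental_coeff:
  assumes b: "b \<in> A"
  shows "transcendental_over (R b) (ultra_of (\<lambda>s. lookup (f s) b))"
  unfolding transcendental_over_def
proof (intro ballI impI)
  fix q assume q: "q \<in> polys_over (R b)" "poly q (ultra_of (\<lambda>s. lookup (f s) b)) = 0"
  have "\<forall>e. \<exists>p. p \<in> coeff_polynomials (A - {b}) \<and> coeff q e = ultra_of (\<lambda>s. p (f s))"
    using q(1) by (auto simp: polys_over_def R_def)
  then obtain p where p: "\<And>e. p e \<in> coeff_polynomials (A - {b})"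
    "\<And>e. coeff q e = ultra_of (\<lambda>s. p e (f s))" by metis
  define P where "P g = (\<Sum>e\<le>degree q. p e g * lookup g b ^ e)" for g
  have P: "P \<in> coeff_polynomials A"
    unfolding P_def[abs_def]
    by (intro coeff_polynomials_sum coeff_polynomials.mult coeff_polynomials_power
        coeff_polynomials.coord b coeff_polynomials_mono[OF p(1)]) auto
  have "ultra_of (\<lambda>s. P (f s)) = poly q (ultra_of (\<lambda>s. lookup (f s) b))"
    by (simp add: P_def ultra_of_sum ultra_of_mult ultra_of_power p(2) poly_altdef)
  then have "eventually (\<lambda>s. P (f s) = 0) fin_ultra"
    using q(2) by (simp add: ultra_of_eq_0_iff)
  then have "\<not> eventually (\<lambda>s. P (f s) \<noteq> 0) fin_ultra"
    by (simp add: eventually_not_fin_ultra)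
  then have "P \<notin> nonzero_coeff_polys A" using generic by blast
  with P have P0: "P g = 0" if "g \<in> laurent_space A" for g
    using that by (auto simp: nonzero_coeff_polys_def)
  have "p e g = 0" if g: "g \<in> laurent_space A" and e: "e \<le> degree q" for e g
  proof -
    define r where "r = (\<Sum>e\<le>degree q. monom (p e g) e)"
    have "poly r t = 0" for t
    proof -
      \<comment> \<open>Replaces the coefficient at \<open>b\<close> by \<open>t\<close>; the
        polynomials \<open>p e\<close> do not see this change.\<close>
      define h where "h = g + single b (t - lookup g b)"
      have "h \<in> laurent_space A"
        using g b by (auto simp: laurent_space_iff h_def lookup_add lookup_single when_def)
      moreover have "lookup h b = t" by (simp add: h_def lookup_add)
      moreover have "p e h = p e g" for e
        by (rule coeff_polynomials_cong[OF p(1)]) (auto simp: h_def lookup_add lookup_single when_def)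
      ultimately show ?thesis using P0[of h] by (simp add: P_def r_def poly_sum poly_monom)
    qed
    then have "r = 0" using poly_all_0_iff_0 by blast
    then have "coeff r e = 0" by simp
    then show ?thesis using e by (simp add: r_def coeff_sum)
  qed
  then have "coeff q e = 0" if "e \<le> degree q" for e
    using that space by (simp add: p(2))
  then show "q = 0" by (metis leading_coeff_0_iff order_refl)
qed

lemma generic_derivation:
  assumes "b \<in> A"
  shows "\<exists>D. derivation_on UNIV D \<and> (\<forall>c. D (ultra_of (\<lambda>_. c)) = 0) \<and>
    (\<forall>a\<in>A. D (ultra_of (\<lambda>s. lookup (f s) a)) = (if a = b then 1 else 0))"
proof -
  obtain D where D: "derivation_on UNIV D" "\<forall>x\<in>R b. D x = 0" "D (ultra_of (\<lambda>s. lookup (f s) b)) = 1"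
    using derivation_transcendental[OF subring_R transcendental_coeff[OF assms]] by blast
  have "D (ultra_of (\<lambda>_. c)) = 0" for c
    using D(2) RI[OF coeff_polynomials.const[of c]] by simp
  moreover have "D (ultra_of (\<lambda>s. lookup (f s) a)) = 0" if "a \<in> A" "a \<noteq> b" for a
    using D(2) RI[OF coeff_polynomials.coord[of a]] that by simp
  ultimately show ?thesis using D by (intro exI[of _ D]) auto
qed

end

text \<open>A relation counts as nontrivial when \<Sum> c_j u_j is nonzero, not merely when
  \<open>c\<close> is. For independent \<open>u\<close> this is the same, but in this form the
  notion depends only on the span of \<open>u\<close>.\<close>

definition singular_at :: "nat \<Rightarrow> (nat \<Rightarrow> 'n::finite laurent) \<Rightarrow> 'n laurent \<Rightarrow>
    complex ^ 'n \<Rightarrow> (nat \<Rightarrow> complex) \<Rightarrow> bool" where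
  "singular_at i u f x c \<longleftrightarrow> x \<in> torus_zeros i (\<lambda>j. u j \<star> f) \<and>
     (\<forall>m. (\<Sum>j\<in>{1..i}. c j * laurent_eval (euler m (u j \<star> f)) x) = 0) \<and>
     (\<exists>a. (\<Sum>j\<in>{1..i}. c j * lookup (u j) a) \<noteq> 0)"

theorem generic_smoothness:
  fixes A :: "(int ^ 'n::finite) set"
  assumes A: "finite A" and u: "\<And>j. j \<in> {1..i} \<Longrightarrow> u j \<in> laurent_space A"
  shows "\<exists>p\<in>nonzero_coeff_polys A. \<forall>f\<in>laurent_space A. p f \<noteq> 0 \<longrightarrow> (\<forall>x c. \<not> singular_at i u f x c)"
proof (rule ccontr)
  assume "\<not> ?thesis"
  then have contr: "\<exists>f\<in>laurent_space A. p f \<noteq> 0 \<and> (\<exists>x c. singular_at i u f x c)"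
    if "p \<in> nonzero_coeff_polys A" for p
    using that by blast
  \<comment> \<open>Bundling the polynomial with its solution and relation lets one appeal to
    saturation choose all three coherently.\<close>
  define Y where "Y = {(f, x, c). f \<in> laurent_space A \<and> singular_at i u f x c}"
  have fip: "\<exists>y\<in>Y. \<forall>p\<in>F. p (fst y) \<noteq> 0" if "finite F" "F \<subseteq> nonzero_coeff_polys A" for F
  proof -
    \<comment> \<open>Avoiding finitely many hypersurfaces amounts to avoiding the zero set of one
      product.\<close>
    have "(\<lambda>f. \<Prod>p\<in>F. p f) \<in> nonzero_coeff_polys A"
      using nonzero_coeff_polys_prod[of F "\<lambda>p. p"] that by blast
    from contr[OF this] obtain f x c
      where f: "f \<in> laurent_space A" "(\<Prod>p\<in>F. p f) \<noteq> 0" "singular_at i u f x c" by blast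
    then have "(f, x, c) \<in> Y" "\<forall>p\<in>F. p f \<noteq> 0" using that(1) by (auto simp: Y_def)
    then show ?thesis by (intro bexI[of _ "(f, x, c)"]) auto
  qed
  obtain y :: "('n laurent \<Rightarrow> complex) set \<Rightarrow> _" where y: "\<And>s. y s \<in> Y"
    "\<And>p. p \<in> nonzero_coeff_polys A \<Longrightarrow> eventually (\<lambda>s. p (fst (y s)) \<noteq> 0) fin_ultra"
  proof (rule fin_ultra_saturated[of "nonzero_coeff_polys A" Y "\<lambda>p y. p (fst y) \<noteq> 0"])
    show "\<exists>y\<in>Y. \<forall>p\<in>F. p (fst y) \<noteq> 0" if "finite F" "F \<subseteq> nonzero_coeff_polys A" for F
      by (rule fip[OF that])
  qed (rule that)
  define f x c where "f s = fst (y s)" and "x s = fst (snd (y s))" and "c s = snd (snd (y s))" for s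
  have sp: "f s \<in> laurent_space A" and sing: "singular_at i u (f s) (x s) (c s)" for s
    using y(1)[of s] by (auto simp: Y_def f_def x_def c_def split: prod.splits)
  have tor: "x s \<in> torus" for s using sing by (simp add: singular_at_def torus_zeros_def)
  define U where "U j a = (ultra_of (\<lambda>_. lookup (u j) a) :: ('n laurent \<Rightarrow> complex, complex) ultra)" for j a
  define F where "F a = ultra_of (\<lambda>s. lookup (f s) a)" for a
  define M where "M a = ultra_of (\<lambda>s. mon (x s) a)" for a
  define \<Lambda> where "\<Lambda> j = ultra_of (\<lambda>s. c s j)" for j
  have keys: "keys (u j \<star> f s) \<subseteq> A" if "j \<in> {1..i}" for j s
    using keys_cwprod_subset[of "u j" "f s"] u[OF that] by (auto simp: laurent_space_def)
  have G0: "(\<Sum>a\<in>A. U j a * F a * M a) = 0" if "j \<in> {1..i}" for j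
  proof -
    have "laurent_eval (u j \<star> f s) (x s) = 0" for s
      using sing[of s] that by (simp add: singular_at_def torus_zeros_def)
    then have "(\<Sum>a\<in>A. lookup (u j) a * lookup (f s) a * mon (x s) a) = 0" for s
      using laurent_eval_superset[OF A keys[OF that]] by (simp add: lookup_cwprod)
    then have "ultra_of (\<lambda>s. \<Sum>a\<in>A. lookup (u j) a * lookup (f s) a * mon (x s) a) = 0" by simp
    then show ?thesis by (simp add: ultra_of_sum ultra_of_mult U_def F_def M_def)
  qed
  have E0: "(\<Sum>j\<in>{1..i}. \<Lambda> j * (\<Sum>a\<in>A. of_int (a $ m) * (U j a * F a) * M a)) = 0" for m
  proof -
    have "(\<Sum>j\<in>{1..i}. c s j * (\<Sum>a\<in>A. of_int (a $ m) * (lookup (u j) a * lookup (f s) a) * mon (x s) a)) = 0" for s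
    proof -
      have "(\<Sum>j\<in>{1..i}. c s j * (\<Sum>a\<in>A. of_int (a $ m) * (lookup (u j) a * lookup (f s) a) * mon (x s) a))
          = (\<Sum>j\<in>{1..i}. c s j * laurent_eval (euler m (u j \<star> f s)) (x s))"
        by (rule sum.cong[OF refl]) (simp add: laurent_eval_euler[OF A keys] lookup_cwprod)
      then show ?thesis using sing[of s] unfolding singular_at_def by metis
    qed
    then have "ultra_of (\<lambda>s. \<Sum>j\<in>{1..i}. c s j * (\<Sum>a\<in>A. of_int (a $ m) * (lookup (u j) a * lookup (f s) a) * mon (x s) a)) = 0"
      by simp
    then show ?thesis by (simp add: ultra_of_sum ultra_of_mult U_def F_def M_def \<Lambda>_def of_int_ultra)
  qed
  have rel: "(\<Sum>j\<in>{1..i}. \<Lambda> j * U j b) = 0" if b: "b \<in> A" for b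
  proof -
    obtain D where D: "derivation_on UNIV D" "\<And>c. D (ultra_of (\<lambda>_. c)) = 0"
      and DF: "\<And>a. a \<in> A \<Longrightarrow> D (F a) = (if a = b then 1 else 0)"
      using generic_derivation[of f A b, OF sp] y(2) b unfolding F_def f_def by blast
    obtain \<eta> where \<eta>: "\<And>a. D (M a) = M a * (\<Sum>m\<in>UNIV. of_int (a $ m) * \<eta> m)"
      using derivation_monomial[of D x, OF D(1) tor] unfolding M_def by blast
    have Dmult: "D (p * q) = p * D q + D p * q" for p q
      using derivation_on_mult[OF D(1)] by simp
    have Dsum: "D (sum g I) = (\<Sum>i\<in>I. D (g i))" for g and I :: "(int ^ 'n) set"
      by (rule derivation_on_sum[OF _ D(1)]) (auto simp: subring_def)
    have D0: "D 0 = 0" using D(2)[of 0] by simp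
    have DU: "D (U j a) = 0" for j a using D(2) by (simp add: U_def)
    \<comment> \<open>Differentiating the j-th equation: the motion of \<open>x\<close> gives a
      combination of its Euler derivatives, and among the coefficients only the one at
      \<open>b\<close> moves.\<close>
    have "(\<Sum>m\<in>UNIV. \<eta> m * (\<Sum>a\<in>A. of_int (a $ m) * (U j a * F a) * M a)) + U j b * M b = 0"
      if "j \<in> {1..i}" for j
    proof -
      have "0 = D (\<Sum>a\<in>A. U j a * F a * M a)" using G0[OF that] D0 by simp
      also have "\<dots> = (\<Sum>a\<in>A. U j a * F a * M a * (\<Sum>m\<in>UNIV. of_int (a $ m) * \<eta> m) + (if a = b then U j a * M a else 0))"
        unfolding Dsum by (rule sum.cong) (auto simp: Dmult DU DF \<eta> algebra_simps)
      also have "\<dots> = (\<Sum>a\<in>A. \<Sum>m\<in>UNIV. \<eta> m * (of_int (a $ m) * (U j a * F a) * M a)) + U j b * M b"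
        by (simp add: sum.distrib A b sum_distrib_left algebra_simps)
      also have "(\<Sum>a\<in>A. \<Sum>m\<in>UNIV. \<eta> m * (of_int (a $ m) * (U j a * F a) * M a))
          = (\<Sum>m\<in>UNIV. \<eta> m * (\<Sum>a\<in>A. of_int (a $ m) * (U j a * F a) * M a))"
        unfolding sum_distrib_left by (rule sum.swap)
      finally show ?thesis by simp
    qed
    \<comment> \<open>Summing with weights \<open>\<Lambda> j\<close>, the coefficients of the
      \<open>\<eta> m\<close> are the sums in \<open>E0\<close> and drop out.\<close>
    then have "(\<Sum>j\<in>{1..i}. \<Lambda> j * ((\<Sum>m\<in>UNIV. \<eta> m * (\<Sum>a\<in>A. of_int (a $ m) * (U j a * F a) * M a)) + U j b * M b)) = 0"
      by (simp only: sum.neutral_const mult_zero_right cong: sum.cong)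
    then have "(\<Sum>j\<in>{1..i}. \<Sum>m\<in>UNIV. \<eta> m * (\<Lambda> j * (\<Sum>a\<in>A. of_int (a $ m) * (U j a * F a) * M a)))
        + (\<Sum>j\<in>{1..i}. \<Lambda> j * U j b) * M b = 0"
      by (simp add: distrib_left sum.distrib sum_distrib_left sum_distrib_right mult_ac)
    moreover have "(\<Sum>j\<in>{1..i}. \<Sum>m\<in>UNIV. \<eta> m * (\<Lambda> j * (\<Sum>a\<in>A. of_int (a $ m) * (U j a * F a) * M a)))
        = (\<Sum>m\<in>UNIV. \<eta> m * (\<Sum>j\<in>{1..i}. \<Lambda> j * (\<Sum>a\<in>A. of_int (a $ m) * (U j a * F a) * M a)))"
      unfolding sum_distrib_left[of "\<eta> _"] by (rule sum.swap)
    moreover have "M b \<noteq> 0"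
      unfolding M_def ultra_of_eq_0_iff using mon_nonzero[OF torus_nonzero[OF tor]] by simp
    ultimately show ?thesis by (simp only: E0 mult_zero_right sum.neutral_const add_0 mult_eq_0_iff) blast
  qed
  have "eventually (\<lambda>s. (\<Sum>j\<in>{1..i}. c s j * lookup (u j) b) = 0) fin_ultra" if "b \<in> A" for b
    using rel[OF that] unfolding \<Lambda>_def U_def ultra_of_mult[symmetric] ultra_of_sum[symmetric] ultra_of_eq_0_iff .
  \<comment> \<open>\<open>A\<close> is finite, so a single complex stage \<open>s\<close> satisfies
    all these equations and contradicts the singularity chosen there.\<close>
  then have "eventually (\<lambda>s. \<forall>b\<in>A. (\<Sum>j\<in>{1..i}. c s j * lookup (u j) b) = 0) fin_ultra"
    using A by (simp add: eventually_ball_finite_distrib)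
  then obtain s where s: "\<forall>b\<in>A. (\<Sum>j\<in>{1..i}. c s j * lookup (u j) b) = 0"
    using eventually_happens[OF _] fin_ultra_neq_bot by blast
  have "(\<Sum>j\<in>{1..i}. c s j * lookup (u j) b) = 0" for b
  proof (cases "b \<in> A")
    case False
    have "c s j * lookup (u j) b = 0" if "j \<in> {1..i}" for j
      using laurent_spaceD[OF u[OF that] False] by simp
    then show ?thesis by (intro sum.neutral) blast
  qed (use s in blast)
  with sing[of s] show False by (simp add: singular_at_def)
qed

section \<open>The codimension of a regular system\<close>

text \<open>Families rather than sets: a repeated vector is a dependence of its own, which the set
  of values does not record.\<close>

lemma vec_dependent_family:
  fixes w :: "nat \<Rightarrow> 'a :: field ^ 'n::finite"
  assumes "N > CARD('n)"
  shows "\<exists>c. (\<exists>t<N. c t \<noteq> 0) \<and> (\<Sum>t<N. c t *s w t) = 0"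
proof (cases "inj_on w {..<N}")
  case False
  then obtain p q where pq: "p < N" "q < N" "p \<noteq> q" "w p = w q"
    by (auto simp: inj_on_def)
  let ?c = "\<lambda>t. if t = p then 1 else if t = q then - 1 else (0 :: 'a)"
  have "(\<Sum>t<N. ?c t *s w t) = (\<Sum>t\<in>{p, q}. ?c t *s w t)"
    by (rule sum.mono_neutral_right) (use pq in auto)
  also have "\<dots> = 0" using pq by (simp add: vec.scale_minus_left)
  finally show ?thesis using pq(1) by (intro exI[of _ ?c]) auto
next
  case True
  have "vec.dependent (w ` {..<N})"
  proof (rule ccontr)
    assume "\<not> vec.dependent (w ` {..<N})"
    then have "card (w ` {..<N}) \<le> vec.dim (w ` {..<N})"
      using vec.independent_bound_general by blast
    also have "\<dots> \<le> CARD('n)" using vec.dim_subset_UNIV[of "w ` {..<N}"]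
      by (simp add: vec.dimension_def card_cart_basis)
    finally show False using assms True by (simp add: card_image)
  qed
  then obtain u v where u: "v \<in> w ` {..<N}" "u v \<noteq> 0" "(\<Sum>v\<in>w ` {..<N}. u v *s v) = 0"
    using vec.dependent_finite[of "w ` {..<N}"] by auto
  then have "(\<Sum>t<N. u (w t) *s w t) = 0" using sum.reindex[OF True, of "\<lambda>v. u v *s v"] by (simp add: o_def)
  with u(1,2) show ?thesis by (intro exI[of _ "\<lambda>t. u (w t)"]) auto
qed

section \<open>Ideals of irreducible sets and the upper bound for the length of chains\<close>

definition vanishes_on :: "(complex ^ 'n::finite) set \<Rightarrow> 'n laurent \<Rightarrow> bool" where
  "vanishes_on Y g \<longleftrightarrow> (\<forall>y\<in>Y. laurent_eval g y = 0)"

lemma torus_closed_subset: "torus_closed Y \<Longrightarrow> Y \<subseteq> torus"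
  by (auto simp: torus_closed_def)

lemma torus_closed_Int_zeros:
  assumes "torus_closed Y"
  shows "torus_closed {y \<in> Y. laurent_eval g y = 0}"
proof -
  obtain S where S: "Y = {x \<in> torus. \<forall>g\<in>S. laurent_eval g x = 0}"
    using assms by (auto simp: torus_closed_def)
  have "{y \<in> Y. laurent_eval g y = 0} = {x \<in> torus. \<forall>g\<in>insert g S. laurent_eval g x = 0}"
    unfolding S by auto
  then show ?thesis unfolding torus_closed_def by blast
qed

lemma vanishes_on_irreducible_mult:
  assumes Y: "torus_irreducible Y" and "vanishes_on Y (f * g)"
  shows "vanishes_on Y f \<or> vanishes_on Y g"
proof -
  have cl: "torus_closed Y" using Y by (simp add: torus_irreducible_def)
  let ?Z = "\<lambda>g. {y \<in> Y. laurent_eval g y = 0}"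
  have "Y = ?Z f \<union> ?Z g"
    using assms(2) torus_closed_subset[OF cl] by (auto simp: vanishes_on_def laurent_eval_mult subset_iff)
  then have "Y = ?Z f \<or> Y = ?Z g"
    using Y torus_closed_Int_zeros[OF cl] unfolding torus_irreducible_def by blast
  then show ?thesis by (auto simp: vanishes_on_def)
qed

lemma torus_closed_separate:
  assumes "torus_closed Y" "torus_closed Y'" "Y \<subset> Y'"
  shows "\<exists>g. vanishes_on Y g \<and> \<not> vanishes_on Y' g"
proof -
  obtain S where S: "Y = {x \<in> torus. \<forall>g\<in>S. laurent_eval g x = 0}"
    using assms(1) by (auto simp: torus_closed_def)
  obtain y where y: "y \<in> Y'" "y \<notin> Y" using assms(3) by blast
  with torus_closed_subset[OF assms(2)] S obtain g where "g \<in> S" "laurent_eval g y \<noteq> 0" by auto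
  with S y show ?thesis by (intro exI[of _ g]) (auto simp: vanishes_on_def)
qed

text \<open>\<open>R[s 0, ..., s (k - 1)]\<close>, generated one element at a time, so that
  \<open>s k\<close> can be compared with polynomials over the preceding stage.\<close>

primrec tower :: "(nat \<Rightarrow> 'a :: comm_ring_1) \<Rightarrow> 'a set \<Rightarrow> nat \<Rightarrow> 'a set" where
  "tower s R 0 = R"
| "tower s R (Suc k) = (\<lambda>q. poly q (s k)) ` polys_over (tower s R k)"

lemma subring_poly_image:
  fixes R :: "'a :: comm_ring_1 set"
  assumes R: "subring R"
  shows "subring ((\<lambda>q. poly q t) ` polys_over R)" "R \<subseteq> (\<lambda>q. poly q t) ` polys_over R"
    "t \<in> (\<lambda>q. poly q t) ` polys_over R"
proof -
  note P = subring_polys_over[OF R]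
  let ?I = "(\<lambda>q. poly q t) ` polys_over R"
  have I: "poly q t \<in> ?I" if "q \<in> polys_over R" for q using that by simp
  show "subring ?I"
    unfolding subring_def
  proof (intro conjI ballI)
    show "1 \<in> ?I" using I[OF subring_1[OF P]] by simp
    fix x y assume "x \<in> ?I" "y \<in> ?I"
    then obtain p q where pq: "p \<in> polys_over R" "x = poly p t" "q \<in> polys_over R" "y = poly q t" by auto
    show "x - y \<in> ?I" using I[OF subring_diff[OF P pq(1,3)]] by (simp add: pq)
    show "x * y \<in> ?I" using I[OF subring_mult[OF P pq(1,3)]] by (simp add: pq)
  qed
  show "R \<subseteq> ?I"
  proof
    fix c assume "c \<in> R"
    from I[OF monom_polys_over[OF R this, of 0]] show "c \<in> ?I" by (simp add: poly_monom)
  qed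
  show "t \<in> ?I" using I[OF monom_polys_over[OF R subring_1[OF R], of 1]] by (simp add: poly_monom)
qed

lemma subring_tower: "subring R \<Longrightarrow> subring (tower s R k)"
  by (induction k) (simp_all add: subring_poly_image(1))

lemma tower_mono:
  assumes "subring R" "k \<le> k'"
  shows "tower s R k \<subseteq> tower s R k'"
  using _ assms(2)
proof (rule lift_Suc_mono_le)
  show "tower s R n \<subseteq> tower s R (Suc n)" for n
    using subring_poly_image(2)[OF subring_tower[OF assms(1)], of s n] by simp
qed

lemma tower_gen: "subring R \<Longrightarrow> j < k \<Longrightarrow> s j \<in> tower s R k"
  using subring_poly_image(3)[OF subring_tower[of R s j], of "s j"] tower_mono[of R "Suc j" k s] by auto

lemma polys_over_pCons: "pCons c q \<in> polys_over R \<longleftrightarrow> c \<in> R \<and> q \<in> polys_over R"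
proof
  assume *: "pCons c q \<in> polys_over R"
  have "coeff (pCons c q) 0 \<in> R" "coeff (pCons c q) (Suc n) \<in> R" for n
    using * unfolding polys_over_def by blast+
  then show "c \<in> R \<and> q \<in> polys_over R" by (simp add: polys_over_def)
next
  assume "c \<in> R \<and> q \<in> polys_over R"
  then show "pCons c q \<in> polys_over R" by (simp add: polys_over_def coeff_pCons split: nat.splits)
qed

text \<open>A strict chain of irreducible sets yields algebraically independent functions, one in each
  step of the chain of their ideals.\<close>

lemma tower_vanishing:
  fixes Y :: "nat \<Rightarrow> (complex ^ 'n::finite) set"
  assumes irr: "\<And>k. k \<le> d \<Longrightarrow> torus_irreducible (Y k)"
    and sub: "\<And>k. k < d \<Longrightarrow> Y k \<subseteq> Y (Suc k)"
    and s: "\<And>k. k < d \<Longrightarrow> vanishes_on (Y k) (s k) \<and> \<not> vanishes_on (Y (Suc k)) (s k)"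
  defines "R \<equiv> range (single 0) :: 'n laurent set"
  shows "k \<le> d \<Longrightarrow> g \<in> tower s R k \<Longrightarrow> vanishes_on (Y k) g \<Longrightarrow> g = 0"
    and "k < d \<Longrightarrow> q \<in> polys_over (tower s R k) \<Longrightarrow> vanishes_on (Y (Suc k)) (poly q (s k)) \<Longrightarrow> q = 0"
proof -
  have step: "q = 0"
    if IH: "\<And>g. g \<in> tower s R k \<Longrightarrow> vanishes_on (Y k) g \<Longrightarrow> g = 0" and k: "k < d"
      and q: "q \<in> polys_over (tower s R k)" "vanishes_on (Y (Suc k)) (poly q (s k))" for k q
    using q
  proof (induction q)
    case (pCons c q)
    have tor: "Y (Suc k) \<subseteq> torus" using irr[of "Suc k"] k torus_closed_subset by (auto simp: torus_irreducible_def)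
    have ev: "laurent_eval (c + s k * poly q (s k)) y = 0" if "y \<in> Y (Suc k)" for y
      using pCons.prems(2) that by (simp add: vanishes_on_def)
    \<comment> \<open>On \<open>Y k\<close> the function \<open>s k\<close> vanishes, so only the
      constant term is left there; the hypothesis on \<open>tower s R k\<close> removes it.\<close>
    have "vanishes_on (Y k) c"
      unfolding vanishes_on_def
    proof
      fix y assume y: "y \<in> Y k"
      then have y': "y \<in> Y (Suc k)" using sub[OF k] by blast
      have "laurent_eval (s k) y = 0" using s[OF k] y by (simp add: vanishes_on_def)
      with ev[OF y'] tor y' show "laurent_eval c y = 0"
        by (auto simp: laurent_eval_add laurent_eval_mult)
    qed
    with pCons.prems(1) IH have c: "c = 0" by (simp add: polys_over_pCons)
    \<comment> \<open>On the irreducible \<open>Y (Suc k)\<close> the factor \<open>s k\<close> is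
      not identically zero and cancels, which lowers the degree.\<close>
    with ev have "vanishes_on (Y (Suc k)) (s k * poly q (s k))" by (simp add: vanishes_on_def)
    then have "vanishes_on (Y (Suc k)) (poly q (s k))"
      using vanishes_on_irreducible_mult[OF irr[of "Suc k"]] s[OF k] k by auto
    with pCons.IH pCons.prems(1) have "q = 0" by (simp add: polys_over_pCons)
    with c show ?case by simp
  qed simp
  have 1: "g = 0" if "k \<le> d" "g \<in> tower s R k" "vanishes_on (Y k) g" for k g
    using that
  proof (induction k arbitrary: g)
    case 0
    obtain y where "y \<in> Y 0" using irr[of 0] by (auto simp: torus_irreducible_def)
    with 0 show ?case by (auto simp: R_def vanishes_on_def)
  next
    case (Suc k)
    from Suc.prems(2) obtain q where q: "q \<in> polys_over (tower s R k)" "g = poly q (s k)" by auto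
    have "q = 0"
      by (rule step[of k q]) (use Suc.IH Suc.prems q in auto)
    with q show ?case by simp
  qed
  then show "k \<le> d \<Longrightarrow> g \<in> tower s R k \<Longrightarrow> vanishes_on (Y k) g \<Longrightarrow> g = 0" .
  show "k < d \<Longrightarrow> q \<in> polys_over (tower s R k) \<Longrightarrow> vanishes_on (Y (Suc k)) (poly q (s k)) \<Longrightarrow> q = 0"
    by (rule step[of k q]) (use 1[of k] in auto)
qed

text \<open>Chain rule with one tuple \<open>\<eta>\<close> for all \<open>g\<close>:
  \<open>D\<close> acts on functions at the point \<open>x\<close> as a tangent vector in
  logarithmic coordinates.\<close>

lemma derivation_laurent:
  fixes D :: "('x, complex) ultra \<Rightarrow> ('x, complex) ultra" and x :: "'x set \<Rightarrow> complex ^ 'n::finite"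
  assumes D: "derivation_on UNIV D" and c: "\<And>c. D (ultra_of (\<lambda>_. c)) = 0" and x: "\<And>s. x s \<in> torus"
  shows "\<exists>\<eta>. \<forall>g. D (ultra_of (\<lambda>s. laurent_eval g (x s))) =
    (\<Sum>m\<in>UNIV. ultra_of (\<lambda>s. laurent_eval (euler m g) (x s)) * \<eta> m)"
proof -
  define M where "M a = ultra_of (\<lambda>s. mon (x s) a)" for a
  obtain \<eta> where \<eta>: "\<And>a. D (M a) = M a * (\<Sum>m\<in>UNIV. of_int (a $ m) * \<eta> m)"
    using derivation_monomial[of D x, OF D x] unfolding M_def by blast
  have Dsum: "D (sum g I) = (\<Sum>i\<in>I. D (g i))" for g and I :: "(int ^ 'n) set"
    by (rule derivation_on_sum[OF _ D]) (auto simp: subring_def)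
  show ?thesis
  proof (intro exI allI)
    fix g :: "'n laurent"
    let ?U = "\<lambda>a. ultra_of (\<lambda>_. lookup g a) :: ('x, complex) ultra"
    have "ultra_of (\<lambda>s. laurent_eval g (x s)) = (\<Sum>a\<in>keys g. ?U a * M a)"
      by (simp add: laurent_eval_keys ultra_of_sum ultra_of_mult M_def)
    then have "D (ultra_of (\<lambda>s. laurent_eval g (x s))) = (\<Sum>a\<in>keys g. D (?U a * M a))"
      by (simp only: Dsum)
    also have "\<dots> = (\<Sum>a\<in>keys g. \<Sum>m\<in>UNIV. of_int (a $ m) * ?U a * M a * \<eta> m)"
      by (rule sum.cong) (simp_all add: derivation_on_mult[OF D] c \<eta> sum_distrib_left mult_ac)
    also have "\<dots> = (\<Sum>m\<in>UNIV. \<Sum>a\<in>keys g. of_int (a $ m) * ?U a * M a * \<eta> m)"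
      by (rule sum.swap)
    also have "\<dots> = (\<Sum>m\<in>UNIV. ultra_of (\<lambda>s. laurent_eval (euler m g) (x s)) * \<eta> m)"
      by (simp only: laurent_eval_euler[OF finite_keys order_refl] ultra_of_sum ultra_of_mult
          of_int_ultra M_def sum_distrib_right)
    finally show "D (ultra_of (\<lambda>s. laurent_eval g (x s))) =
      (\<Sum>m\<in>UNIV. ultra_of (\<lambda>s. laurent_eval (euler m g) (x s)) * \<eta> m)" .
  qed
qed

theorem chain_length_le:
  fixes h :: "nat \<Rightarrow> 'n::finite laurent"
  assumes reg: "regular_system i h"
    and irr: "\<And>k. k \<le> d \<Longrightarrow> torus_irreducible (Y k)"
    and Z: "Y d \<subseteq> torus_zeros i h"
    and strict: "\<And>k. k < d \<Longrightarrow> Y k \<subset> Y (Suc k)"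
  shows "i + d \<le> CARD('n)"
proof (rule ccontr)
  assume big: "\<not> i + d \<le> CARD('n)"
  have closed: "torus_closed (Y k)" if "k \<le> d" for k using irr[OF that] by (simp add: torus_irreducible_def)
  have "\<exists>g. vanishes_on (Y k) g \<and> \<not> vanishes_on (Y (Suc k)) g" if "k < d" for k
    using torus_closed_separate[OF closed closed strict[OF that]] that by simp
  then obtain s where s: "\<And>k. k < d \<Longrightarrow> vanishes_on (Y k) (s k) \<and> \<not> vanishes_on (Y (Suc k)) (s k)"
    by metis
  define R where "R = (range (single 0) :: 'n laurent set)"
  have R: "subring R"
    unfolding subring_def
  proof (intro conjI ballI)
    show "1 \<in> R" unfolding R_def by (rule range_eqI[of _ _ 1]) simp
    fix x y assume "x \<in> R" "y \<in> R"
    then obtain a b where "x = single 0 a" "y = single 0 b" by (auto simp: R_def)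
    then have "x - y = single 0 (a - b)" "x * y = single 0 (a * b)" by (simp_all add: single_diff mult_single)
    then show "x - y \<in> R" "x * y \<in> R" by (simp_all add: R_def)
  qed
  have tv: "q = 0" if "k < d" "q \<in> polys_over (tower s R k)" "vanishes_on (Y (Suc k)) (poly q (s k))" for k q
    using tower_vanishing(2)[of d Y s k q, OF irr _ s] strict that unfolding R_def by blast
  have mono: "Y (Suc k) \<subseteq> Y d" if "k < d" for k
    using Suc_leI[OF that]
  proof (induction rule: inc_induct)
    case (step k)
    with strict[of k] show ?case by blast
  qed simp
  have "\<exists>y\<in>Y d. \<forall>g\<in>F. laurent_eval g y \<noteq> 0"
    if "finite F" "F \<subseteq> {g. \<not> vanishes_on (Y d) g}" for F
  proof -
    \<comment> \<open>The ideal of \<open>Y d\<close> is prime, so a point of \<open>Y d\<close> can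
      avoid the zeros of finitely many functions outside the ideal at once.\<close>
    have "\<not> vanishes_on (Y d) (\<Prod>g\<in>F. g)"
      using that
    proof (induction F)
      case empty
      obtain y where "y \<in> Y d" using irr[of d] by (auto simp: torus_irreducible_def)
      then show ?case by (auto simp: vanishes_on_def)
    next
      case (insert g F)
      then show ?case using vanishes_on_irreducible_mult[OF irr[OF order_refl], of g "\<Prod>g\<in>F. g"] by auto
    qed
    then obtain y where y: "y \<in> Y d" "laurent_eval (\<Prod>g\<in>F. g) y \<noteq> 0" by (auto simp: vanishes_on_def)
    have "y \<in> torus" using y(1) closed torus_closed_subset by blast
    with that(1) have "laurent_eval (\<Prod>g\<in>F. g) y = (\<Prod>g\<in>F. laurent_eval g y)"
      by (induction F rule: finite_induct) (simp_all add: laurent_eval_mult)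
    with y that(1) show ?thesis by auto
  qed
  note fip = this
  \<comment> \<open>A generic point of \<open>Y d\<close> over the ultrapower: only functions in the
    ideal of \<open>Y d\<close> vanish at it.\<close>
  obtain y :: "'n laurent set \<Rightarrow> _" where y: "\<And>s. y s \<in> Y d"
    and gen: "\<And>g. g \<in> {g. \<not> vanishes_on (Y d) g} \<Longrightarrow> eventually (\<lambda>s. laurent_eval g (y s) \<noteq> 0) fin_ultra"
  proof (rule fin_ultra_saturated[of "{g. \<not> vanishes_on (Y d) g}" "Y d" "\<lambda>g y. laurent_eval g y \<noteq> 0"])
    show "\<exists>y\<in>Y d. \<forall>g\<in>F. laurent_eval g y \<noteq> 0" if "finite F" "F \<subseteq> {g. \<not> vanishes_on (Y d) g}" for F
      by (rule fip[OF that])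
  qed (rule that)
  have tor: "y t \<in> torus" for t using y closed torus_closed_subset by blast
  define ev where "ev g = ultra_of (\<lambda>t. laurent_eval g (y t))" for g
  have ev_0_iff: "ev g = 0 \<longleftrightarrow> vanishes_on (Y d) g" for g
  proof
    assume "ev g = 0"
    then have "\<not> eventually (\<lambda>t. laurent_eval g (y t) \<noteq> 0) fin_ultra"
      by (simp add: ev_def ultra_of_eq_0_iff eventually_not_fin_ultra)
    then show "vanishes_on (Y d) g" using gen[of g] by blast
  next
    assume "vanishes_on (Y d) g"
    then show "ev g = 0" using y by (simp add: ev_def vanishes_on_def)
  qed
  have ev_hom: "ev 1 = 1" "ev (f + g) = ev f + ev g" "ev (f - g) = ev f - ev g" "ev (f * g) = ev f * ev g" for f g
    using tor by (simp_all add: ev_def laurent_eval_add laurent_eval_diff laurent_eval_mult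
        ultra_of_add ultra_of_diff ultra_of_mult)
  have ev_0: "ev 0 = 0" by (simp add: ev_def)
  have ev_sum: "ev (sum f I) = (\<Sum>i\<in>I. ev (f i))" for f and I :: "nat set"
    by (induction I rule: infinite_finite_induct) (simp_all add: ev_0 ev_hom)
  have ev_power: "ev (f ^ n) = ev f ^ n" for f n
    by (induction n) (simp_all add: ev_hom)
  \<comment> \<open>\<open>s k\<close> is transcendental over the values of the preceding functions,
    so some derivation kills \<open>s 0, ..., s (k - 1)\<close> and sends \<open>s k\<close> to 1.
    Its values on later functions are unknown, which makes the duality triangular only.\<close>
  have "\<exists>\<eta>. (\<forall>g. vanishes_on (Y d) g \<longrightarrow> (\<Sum>m\<in>UNIV. ev (euler m g) * \<eta> m) = 0) \<and>
      (\<forall>j<k. (\<Sum>m\<in>UNIV. ev (euler m (s j)) * \<eta> m) = 0) \<and>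
      (\<Sum>m\<in>UNIV. ev (euler m (s k)) * \<eta> m) = 1" if k: "k < d" for k
  proof -
    let ?F = "ev ` tower s R k"
    note T = subring_tower[OF R, of s k]
    have FI: "ev g \<in> ?F" if "g \<in> tower s R k" for g using that by simp
    have "subring ?F"
      unfolding subring_def
    proof (intro conjI ballI)
      show "1 \<in> ?F" using FI[OF subring_1[OF T]] by (simp add: ev_hom)
      fix a b assume "a \<in> ?F" "b \<in> ?F"
      then obtain f g where fg: "f \<in> tower s R k" "a = ev f" "g \<in> tower s R k" "b = ev g" by auto
      show "a - b \<in> ?F" using FI[OF subring_diff[OF T fg(1,3)]] by (simp add: fg ev_hom)
      show "a * b \<in> ?F" using FI[OF subring_mult[OF T fg(1,3)]] by (simp add: fg ev_hom)
    qed
    moreover have "transcendental_over ?F (ev (s k))"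
      unfolding transcendental_over_def
    proof (intro ballI impI)
      fix q assume q: "q \<in> polys_over ?F" "poly q (ev (s k)) = 0"
      have "\<forall>e. \<exists>p. p \<in> tower s R k \<and> coeff q e = ev p"
        using q(1) by (auto simp: polys_over_def)
      then obtain p where p: "\<And>e. p e \<in> tower s R k" "\<And>e. coeff q e = ev (p e)" by metis
      define Q where "Q = (\<Sum>e\<le>degree q. monom (p e) e)"
      have Q: "Q \<in> polys_over (tower s R k)"
        unfolding Q_def by (intro subring_sum subring_polys_over T monom_polys_over p)
      have "poly Q (s k) = (\<Sum>e\<le>degree q. p e * s k ^ e)"
        by (simp add: Q_def poly_sum poly_monom)
      then have "ev (poly Q (s k)) = poly q (ev (s k))"
        by (simp add: ev_sum ev_hom ev_power p(2) poly_altdef[of q])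
      then have "vanishes_on (Y d) (poly Q (s k))" using q(2) by (simp add: ev_0_iff)
      \<comment> \<open>The relation is known on \<open>Y d\<close>; its restriction to the smaller
        \<open>Y (Suc k)\<close> is what \<open>tv\<close> speaks about.\<close>
      then have "vanishes_on (Y (Suc k)) (poly Q (s k))" using mono[OF k] by (auto simp: vanishes_on_def)
      then have "Q = 0" by (rule tv[OF k Q])
      have "coeff q e = 0" if "e \<le> degree q" for e
      proof -
        have "p e = coeff Q e" using that by (simp add: Q_def coeff_sum)
        then show ?thesis by (simp add: p(2) \<open>Q = 0\<close> ev_0)
      qed
      then show "q = 0" by (metis leading_coeff_0_iff order_refl)
    qed
    ultimately obtain D where D: "derivation_on UNIV D" "\<And>z. z \<in> ?F \<Longrightarrow> D z = 0" "D (ev (s k)) = 1"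
      using derivation_transcendental[of ?F "ev (s k)"] by blast
    have "D (ultra_of (\<lambda>_. c)) = 0" for c
    proof -
      have "single 0 c \<in> tower s R k" using tower_mono[OF R, of 0 k s] by (auto simp: R_def)
      from D(2)[OF FI[OF this]] show ?thesis by (simp add: ev_def)
    qed
    from derivation_laurent[of D y, OF D(1) this tor]
    obtain \<eta> where \<eta>: "\<And>g. D (ev g) = (\<Sum>m\<in>UNIV. ev (euler m g) * \<eta> m)" unfolding ev_def by blast
    have "D 0 = 0" by (rule derivation_on_0[OF _ D(1)]) (simp add: subring_def)
    then have "\<forall>g. vanishes_on (Y d) g \<longrightarrow> (\<Sum>m\<in>UNIV. ev (euler m g) * \<eta> m) = 0"
      using \<eta> by (metis ev_0_iff)
    moreover have "\<forall>j<k. (\<Sum>m\<in>UNIV. ev (euler m (s j)) * \<eta> m) = 0"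
      using D(2)[OF FI[OF tower_gen[OF R]]] \<eta> by metis
    moreover have "(\<Sum>m\<in>UNIV. ev (euler m (s k)) * \<eta> m) = 1" using D(3) \<eta> by simp
    ultimately show ?thesis by blast
  qed
  note dual = this
  define dual_to where "dual_to k \<eta> \<longleftrightarrow>
      (\<forall>g. vanishes_on (Y d) g \<longrightarrow> (\<Sum>m\<in>UNIV. ev (euler m g) * \<eta> m) = 0) \<and>
      (\<forall>j<k. (\<Sum>m\<in>UNIV. ev (euler m (s j)) * \<eta> m) = 0) \<and>
      (\<Sum>m\<in>UNIV. ev (euler m (s k)) * \<eta> m) = 1" for k and \<eta> :: "'n \<Rightarrow> _"
  have "\<forall>k. \<exists>\<eta>. k < d \<longrightarrow> dual_to k \<eta>" using dual unfolding dual_to_def by blast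
  then obtain \<eta> where \<eta>: "\<forall>k. k < d \<longrightarrow> dual_to k (\<eta> k)" by (rule choice[THEN exE])
  then have \<eta>0: "\<And>k g. k < d \<Longrightarrow> vanishes_on (Y d) g \<Longrightarrow> (\<Sum>m\<in>UNIV. ev (euler m g) * \<eta> k m) = 0"
    and \<eta>_lt: "\<And>k j. k < d \<Longrightarrow> j < k \<Longrightarrow> (\<Sum>m\<in>UNIV. ev (euler m (s j)) * \<eta> k m) = 0"
    and \<eta>_eq: "\<And>k. k < d \<Longrightarrow> (\<Sum>m\<in>UNIV. ev (euler m (s k)) * \<eta> k m) = 1"
    by (simp_all add: dual_to_def)
  \<comment> \<open>The gradients of the \<open>i\<close> equations, with a shift because
    \<open>h\<close> is indexed from 1, followed by those of the chain functions. There are more of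
    them than coordinates, so they are dependent.\<close>
  define w where "w t = (\<chi> m. ev (euler m (if t < i then h (Suc t) else s (t - i))))" for t
  obtain c where c: "\<exists>t<i + d. c t \<noteq> 0" "(\<Sum>t<i + d. c t *s w t) = 0"
    using vec_dependent_family[of "i + d" w] big by auto
  have c_comp: "(\<Sum>t<i + d. c t * w t $ m) = 0" for m
  proof -
    have "(\<Sum>t<i + d. c t *s w t) $ m = 0" using c(2) by simp
    then show ?thesis by simp
  qed
  have h_van: "vanishes_on (Y d) (h (Suc t))" if "t < i" for t
    using Z that by (auto simp: vanishes_on_def torus_zeros_def)
  \<comment> \<open>Pairing the relation with the derivation for the largest \<open>k\<close> whose
    coefficient is nonzero isolates that coefficient: the equations lie in the ideal of
    \<open>Y d\<close> and pair to zero, and so do the earlier \<open>s j\<close>.\<close>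
  have c0: "c (i + k) = 0" if "k < d" for k
  proof (rule ccontr)
    assume "c (i + k) \<noteq> 0"
    define K where "K = {k. k < d \<and> c (i + k) \<noteq> 0}"
    have K: "finite K" "K \<noteq> {}" using that \<open>c (i + k) \<noteq> 0\<close> by (auto simp: K_def)
    define k0 where "k0 = Max K"
    have k0: "k0 < d" "c (i + k0) \<noteq> 0" using Max_in[OF K] by (simp_all add: k0_def K_def)
    have above: "c (i + k) = 0" if "k < d" "k0 < k" for k
    proof (rule ccontr)
      assume "c (i + k) \<noteq> 0"
      then have "k \<in> K" using that by (simp add: K_def)
      then show False using Max_ge[OF K(1), of k] that by (simp add: k0_def)
    qed
    have summand: "c t * (\<Sum>m\<in>UNIV. w t $ m * \<eta> k0 m) = (if t = i + k0 then c t else 0)" if "t < i + d" for t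
    proof (cases "t < i")
      case True
      then show ?thesis using \<eta>0[OF k0(1) h_van[OF True]] by (simp add: w_def)
    next
      case False
      define j where "j = t - i"
      have j: "t = i + j" "j < d" using False that by (auto simp: j_def)
      consider "j < k0" | "j = k0" | "k0 < j" by linarith
      then show ?thesis
      proof cases
        case 1
        then show ?thesis using \<eta>_lt[OF k0(1) 1] by (simp add: w_def j)
      next
        case 2
        then show ?thesis using \<eta>_eq[OF k0(1)] by (simp add: w_def j)
      next
        case 3
        then show ?thesis using above[OF j(2)] by (simp add: j)
      qed
    qed
    have "0 = (\<Sum>m\<in>UNIV. (\<Sum>t<i + d. c t * w t $ m) * \<eta> k0 m)" by (simp add: c_comp)
    also have "\<dots> = (\<Sum>t<i + d. \<Sum>m\<in>UNIV. c t * w t $ m * \<eta> k0 m)"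
      unfolding sum_distrib_right by (rule sum.swap)
    also have "\<dots> = (\<Sum>t<i + d. c t * (\<Sum>m\<in>UNIV. w t $ m * \<eta> k0 m))"
      by (simp add: sum_distrib_left mult_ac)
    also have "\<dots> = (\<Sum>t<i + d. if t = i + k0 then c t else 0)" by (rule sum.cong) (auto simp: summand)
    also have "\<dots> = c (i + k0)" using k0 by simp
    finally show False using k0 by simp
  qed
  \<comment> \<open>The surviving relation involves only the equations. Its coefficients are
    represented by complex families, and regularity at the complex points \<open>y r\<close> makes
    almost all entries zero.\<close>
  have "\<forall>t. \<exists>e. c t = ultra_of e" by (simp add: ultra_of_surj)
  then obtain e where e: "\<And>t. c t = ultra_of (e t)" by metis
  have "eventually (\<lambda>r. \<forall>m\<in>UNIV. (\<Sum>j\<in>{1..i}. e (j - 1) r * laurent_eval (euler m (h j)) (y r)) = 0) fin_ultra"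
  proof (rule eventually_ball_finite, simp, intro ballI)
    fix m
    have "(\<Sum>t<i + d. c t * w t $ m) = (\<Sum>t<i. c t * w t $ m)"
      by (rule sum.mono_neutral_right) (auto simp: not_less dest!: le_Suc_ex intro!: c0)
    also have "\<dots> = (\<Sum>t<i. c t * ev (euler m (h (Suc t))))" by (simp add: w_def)
    also have "\<dots> = (\<Sum>j\<in>{1..i}. c (j - 1) * ev (euler m (h j)))"
      by (rule sum.reindex_bij_witness[of _ "\<lambda>j. j - 1" Suc]) auto
    finally have "ultra_of (\<lambda>r. \<Sum>j\<in>{1..i}. e (j - 1) r * laurent_eval (euler m (h j)) (y r)) = 0"
      unfolding c_comp by (simp add: ultra_of_sum ultra_of_mult e ev_def)
    then show "eventually (\<lambda>r. (\<Sum>j\<in>{1..i}. e (j - 1) r * laurent_eval (euler m (h j)) (y r)) = 0) fin_ultra"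
      by (simp only: ultra_of_eq_0_iff)
  qed
  then have ev0: "eventually (\<lambda>r. \<forall>j\<in>{1..i}. e (j - 1) r = 0) fin_ultra"
  proof (rule eventually_mono)
    fix r assume "\<forall>m\<in>UNIV. (\<Sum>j\<in>{1..i}. e (j - 1) r * laurent_eval (euler m (h j)) (y r)) = 0"
    then have "\<forall>m. (\<Sum>j\<in>{1..i}. e (j - 1) r * laurent_eval (euler m (h j)) (y r)) = 0" by simp
    moreover have "y r \<in> torus_zeros i h" using y Z by blast
    ultimately show "\<forall>j\<in>{1..i}. e (j - 1) r = 0"
      using reg[unfolded regular_system_iff, THEN bspec, THEN spec, of "y r" "\<lambda>j. e (j - 1) r"] by simp
  qed
  have "c t = 0" if "t < i" for t
  proof -
    have "eventually (\<lambda>r. e t r = 0) fin_ultra"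
      using ev0
    proof (rule eventually_mono)
      fix r assume "\<forall>j\<in>{1..i}. e (j - 1) r = 0"
      from bspec[OF this, of "Suc t"] that show "e t r = 0" by simp
    qed
    then show ?thesis by (simp add: e ultra_of_eq_0_iff)
  qed
  moreover obtain t where "t < i + d" "c t \<noteq> 0" using c(1) by blast
  ultimately show False using c0[of "t - i"] by (cases "t < i") (auto simp: less_diff_conv2)
qed

section \<open>Local coordinates on the zero set and long chains of irreducible sets\<close>

lemma euler_add: "euler m (f + g) = euler m f + euler m g"
  by (rule poly_mapping_eqI) (simp add: lookup_euler lookup_add algebra_simps)

lemma euler_0 [simp]: "euler m 0 = 0"
  by (rule poly_mapping_eqI) (simp add: lookup_euler)

lemma euler_sum: "euler m (\<Sum>i\<in>I. f i) = (\<Sum>i\<in>I. euler m (f i))"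
  by (induction I rule: infinite_finite_induct) (simp_all add: euler_add)

lemma euler_single: "euler m (single a c) = single a (of_int (a $ m) * c)"
  by (rule poly_mapping_eqI) (auto simp: lookup_euler lookup_single when_def)

text \<open>A complementary coordinate: its gradient in ordinary coordinates is the constant vector
  \<open>r\<close>, so any basis that extends the gradients of the equations can be
  realised.\<close>

definition linear_form :: "complex ^ 'n \<Rightarrow> 'n::finite laurent" where
  "linear_form r = (\<Sum>m\<in>UNIV. single (axis m 1) (r $ m))"

lemma laurent_eval_euler_linear_form: "laurent_eval (euler m (linear_form r)) x = r $ m * x $ m"
proof -
  have axis_nth: "axis p (1 :: int) $ m = (if p = m then 1 else 0)" for p
    by (simp add: axis_def)
  have "laurent_eval (euler m (linear_form r)) x = (\<Sum>p\<in>UNIV. if p = m then r $ p * x $ p else 0)"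
    unfolding linear_form_def euler_sum laurent_eval_sum euler_single
    by (rule sum.cong) (auto simp: mon_axis axis_nth)
  then show ?thesis by simp
qed

definition zariski_closure :: "(complex ^ 'n::finite) set \<Rightarrow> (complex ^ 'n) set" where
  "zariski_closure S = {x \<in> torus. \<forall>g. vanishes_on S g \<longrightarrow> laurent_eval g x = 0}"

lemma torus_closed_zariski_closure: "torus_closed (zariski_closure S)"
  unfolding torus_closed_def zariski_closure_def by (rule exI[of _ "{g. vanishes_on S g}"]) auto

lemma subset_zariski_closure: "S \<subseteq> torus \<Longrightarrow> S \<subseteq> zariski_closure S"
  by (auto simp: zariski_closure_def vanishes_on_def)

lemma zariski_closure_minimal:
  assumes "S \<subseteq> Y" "torus_closed Y"
  shows "zariski_closure S \<subseteq> Y"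
proof -
  obtain G where "Y = {x \<in> torus. \<forall>g\<in>G. laurent_eval g x = 0}"
    using assms(2) by (auto simp: torus_closed_def)
  with assms(1) show ?thesis by (force simp: zariski_closure_def vanishes_on_def)
qed

lemma vanishes_on_zariski_closure: "vanishes_on S g \<Longrightarrow> vanishes_on (zariski_closure S) g"
  by (auto simp: zariski_closure_def vanishes_on_def)

text \<open>If neither \<open>Y1\<close> nor \<open>Y2\<close> contains \<open>S\<close>, take for
  each an equation that fails somewhere on \<open>S\<close>: their product vanishes on
  \<open>S\<close>, contrary to primeness.\<close>

lemma torus_irreducible_zariski_closure:
  assumes S: "S \<subseteq> torus" "S \<noteq> {}"
    and prime: "\<And>f g. vanishes_on S (f * g) \<Longrightarrow> vanishes_on S f \<or> vanishes_on S g"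
  shows "torus_irreducible (zariski_closure S)"
proof -
  have "zariski_closure S = Y1 \<or> zariski_closure S = Y2"
    if cl: "torus_closed Y1" "torus_closed Y2" and un: "zariski_closure S = Y1 \<union> Y2" for Y1 Y2
  proof (rule ccontr)
    assume "\<not> ?thesis"
    then have "\<not> S \<subseteq> Y1" "\<not> S \<subseteq> Y2"
      using zariski_closure_minimal[OF _ cl(1), of S] zariski_closure_minimal[OF _ cl(2), of S] un by auto
    then obtain y1 y2 where y: "y1 \<in> S" "y1 \<notin> Y1" "y2 \<in> S" "y2 \<notin> Y2" by blast
    obtain G1 G2 where G: "Y1 = {x \<in> torus. \<forall>g\<in>G1. laurent_eval g x = 0}"
      "Y2 = {x \<in> torus. \<forall>g\<in>G2. laurent_eval g x = 0}"
      using cl unfolding torus_closed_def by blast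
    with y S(1) obtain f g where fg: "f \<in> G1" "laurent_eval f y1 \<noteq> 0" "g \<in> G2" "laurent_eval g y2 \<noteq> 0"
      by blast
    have "laurent_eval (f * g) x = 0" if "x \<in> S" for x
    proof -
      have "x \<in> torus" "x \<in> Y1 \<union> Y2" using that S(1) subset_zariski_closure[OF S(1)] un by auto
      then show ?thesis using fg G by (auto simp: laurent_eval_mult)
    qed
    then have "vanishes_on S f \<or> vanishes_on S g" by (intro prime) (simp add: vanishes_on_def)
    with fg y show False by (auto simp: vanishes_on_def)
  qed
  moreover have "zariski_closure S \<noteq> {}" using subset_zariski_closure[OF S(1)] S(2) by blast
  ultimately show ?thesis
    unfolding torus_irreducible_def using torus_closed_zariski_closure by blast
qed

lemma open_torus: "open (torus :: (complex ^ 'n::finite) set)"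
proof -
  have "torus = (\<Inter>m\<in>UNIV. {x :: complex ^ 'n. x $ m \<noteq> 0})" by (auto simp: torus_def)
  moreover have "open (\<Inter>m\<in>UNIV. {x :: complex ^ 'n. x $ m \<noteq> 0})"
    by (intro open_INT finite ballI open_Collect_neq continuous_intros)
  ultimately show ?thesis by simp
qed

definition laurent_map :: "('n \<Rightarrow> 'n::finite laurent) \<Rightarrow> complex ^ 'n \<Rightarrow> complex ^ 'n" where
  "laurent_map H x = (\<chi> p. laurent_eval (H p) x)"

definition jacobian :: "('n \<Rightarrow> 'n::finite laurent) \<Rightarrow> complex ^ 'n \<Rightarrow> complex ^ 'n \<Rightarrow> complex ^ 'n" where
  "jacobian H x u = (\<chi> p. \<Sum>m\<in>UNIV. laurent_eval (euler m (H p)) x / x $ m * u $ m)"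

lemma laurent_map_has_derivative:
  fixes x :: "complex ^ 'n::finite"
  assumes "x \<in> torus"
  shows "(laurent_map H has_derivative jacobian H x) (at x)"
proof (subst has_derivative_componentwise_within, intro ballI)
  fix b :: "complex ^ 'n" assume "b \<in> Basis"
  then obtain p c where b: "b = axis p c" by (auto simp: Basis_vec_def)
  show "((\<lambda>y. laurent_map H y \<bullet> b) has_derivative (\<lambda>u. jacobian H x u \<bullet> b)) (at x)"
    unfolding b inner_axis laurent_map_def jacobian_def vec_lambda_beta
    by (intro has_derivative_inner_left laurent_eval_has_derivative assms)
qed

text \<open>Complex linearity; the derivatives in the inverse function theorem are only real linear
  maps.\<close>

lemma jacobian_scale: "jacobian H x (c *s u) = c *s jacobian H x u"
  by (simp add: jacobian_def vec_eq_iff sum_distrib_left mult_ac)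

lemma bounded_linear_jacobian: "x \<in> torus \<Longrightarrow> bounded_linear (jacobian H x)"
  using laurent_map_has_derivative has_derivative_bounded_linear by blast

text \<open>The real inverse function theorem yields a holomorphic inverse, because the derivative
  of \<open>g\<close> is the inverse of a complex linear bijection. A ball as domain makes its
  intersections with affine subspaces convex.\<close>

lemma laurent_map_local_inverse:
  fixes x0 :: "complex ^ 'n::finite"
  assumes x0: "x0 \<in> torus" and inj: "\<And>u. jacobian H x0 u = 0 \<Longrightarrow> u = 0"
  obtains \<epsilon> g g' where "\<epsilon> > 0" "g (laurent_map H x0) = x0"
    "\<And>y. y \<in> ball (laurent_map H x0) \<epsilon> \<Longrightarrow> g y \<in> torus \<and> laurent_map H (g y) = y \<and>
       (g has_derivative g' y) (at y) \<and> (\<forall>c u. g' y (c *s u) = c *s g' y u)"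
proof -
  define f' where "f' x = Blinfun (jacobian H x)" for x
  have f': "blinfun_apply (f' x) = jacobian H x" if "x \<in> torus" for x
    unfolding f'_def by (rule bounded_linear_Blinfun_apply[OF bounded_linear_jacobian[OF that]])
  have cont: "continuous_on torus f'"
  proof (rule continuous_on_blinfun_componentwise)
    fix u :: "complex ^ 'n"
    have "continuous_on torus (\<lambda>x. jacobian H x u)"
      unfolding jacobian_def
      by (intro continuous_intros continuous_on_laurent_eval) (simp add: torus_nonzero)
    then show "continuous_on torus (\<lambda>x. blinfun_apply (f' x) u)"
      by (rule continuous_on_eq) (simp add: f')
  qed
  have lin: "linear (jacobian H x0)" by (rule bounded_linear.linear[OF bounded_linear_jacobian[OF x0]])
  have "inj (jacobian H x0)" using inj by (simp add: linear_injective_0[OF lin])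
  from linear_injective_left_inverse[OF lin this]
  obtain j where j: "linear j" "j \<circ> jacobian H x0 = id" by blast
  have "Blinfun j o\<^sub>L f' x0 = id_blinfun"
    by (rule blinfun_eqI)
      (use j in \<open>simp add: f'[OF x0] bounded_linear_Blinfun_apply linear_conv_bounded_linear pointfree_idE\<close>)
  from inverse_function_theorem[OF open_torus _ cont x0 this, of "laurent_map H"]
  obtain U' V g g' where g: "U' \<subseteq> torus" "x0 \<in> U'" "open V" "laurent_map H x0 \<in> V"
    "homeomorphism U' V (laurent_map H) g"
    "\<And>y. y \<in> V \<Longrightarrow> (g has_derivative g' y) (at y)"
    "\<And>y. y \<in> V \<Longrightarrow> g' y = inv (blinfun_apply (f' (g y)))"
    "\<And>y. y \<in> V \<Longrightarrow> bij (blinfun_apply (f' (g y)))"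
    using laurent_map_has_derivative[of _ H] f' by metis
  obtain \<epsilon> where \<epsilon>: "\<epsilon> > 0" "ball (laurent_map H x0) \<epsilon> \<subseteq> V"
    using g(3,4) open_contains_ball by blast
  show ?thesis
  proof (rule that[OF \<epsilon>(1)])
    show "g (laurent_map H x0) = x0" using homeomorphism_apply1[OF g(5,2)] .
    fix y assume "y \<in> ball (laurent_map H x0) \<epsilon>"
    then have y: "y \<in> V" using \<epsilon> by blast
    have gy: "g y \<in> torus" using g(1,5) y by (auto simp: homeomorphism_def)
    note bij = g(8)[OF y, unfolded f'[OF gy]]
    have "g' y (c *s u) = c *s g' y u" for c u
    proof -
      have "jacobian H (g y) (c *s inv (jacobian H (g y)) u) = c *s u"
        using bij by (simp add: jacobian_scale bij_is_surj surj_f_inv_f)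
      then show ?thesis
        unfolding g(7)[OF y] f'[OF gy] using bij by (metis bij_inv_eq_iff)
    qed
    moreover have "laurent_map H (g y) = y" using homeomorphism_apply2[OF g(5) y] .
    ultimately show "g y \<in> torus \<and> laurent_map H (g y) = y \<and>
       (g has_derivative g' y) (at y) \<and> (\<forall>c u. g' y (c *s u) = c *s g' y u)"
      using gy g(6)[OF y] by blast
  qed
qed

text \<open>Laurent polynomials restrict to holomorphic functions on the complex lines of a
  holomorphically parametrised convex piece, so their vanishing ideal is prime.\<close>

lemma vanishes_on_convex_image_mult:
  fixes g :: "complex ^ 'n::finite \<Rightarrow> complex ^ 'n"
  assumes g: "\<And>y. y \<in> ball y0 \<epsilon> \<Longrightarrow> g y \<in> torus \<and> (g has_derivative g' y) (at y) \<and>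
      (\<forall>c u. g' y (c *s u) = c *s g' y u)"
    and D: "D \<subseteq> ball y0 \<epsilon>"
      "\<And>a b z. a \<in> D \<Longrightarrow> b \<in> D \<Longrightarrow> a + z *s (b - a) \<in> ball y0 \<epsilon> \<Longrightarrow> a + z *s (b - a) \<in> D"
    and van: "vanishes_on (g ` D) (p * q)"
  shows "vanishes_on (g ` D) p \<or> vanishes_on (g ` D) q"
proof (rule ccontr)
  assume "\<not> ?thesis"
  then obtain a b where ab: "a \<in> D" "laurent_eval p (g a) \<noteq> 0" "b \<in> D" "laurent_eval q (g b) \<noteq> 0"
    by (auto simp: vanishes_on_def)
  \<comment> \<open>The complex line through a point where \<open>p\<close> is nonzero and a point
    where \<open>q\<close> is nonzero; the parameters that stay in the ball form a convex
    set.\<close>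
  define l where "l z = a + z *s (b - a)" for z
  define \<Omega> where "\<Omega> = {z. l z \<in> ball y0 \<epsilon>}"
  have l_der: "(l has_derivative (\<lambda>w. w *s (b - a))) (at z)" for z
  proof (subst has_derivative_componentwise_within, intro ballI)
    fix e :: "complex ^ 'n" assume "e \<in> Basis"
    then obtain m c where e: "e = axis m c" by (auto simp: Basis_vec_def)
    show "((\<lambda>z. l z \<bullet> e) has_derivative (\<lambda>w. (w *s (b - a)) \<bullet> e)) (at z)"
      unfolding e inner_axis l_def by (auto intro!: derivative_eq_intros)
  qed
  have "continuous_on UNIV l"
    using l_der by (meson continuous_at_imp_continuous_on has_derivative_continuous)
  then have "open \<Omega>"
    unfolding \<Omega>_def using open_vimage[of "ball y0 \<epsilon>" l] by (simp add: vimage_def)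
  have "convex \<Omega>"
  proof (rule convexI)
    fix z w and s t :: real assume zw: "z \<in> \<Omega>" "w \<in> \<Omega>" "0 \<le> s" "0 \<le> t" "s + t = 1"
    have "l (s *\<^sub>R z + t *\<^sub>R w) = s *\<^sub>R l z + t *\<^sub>R l w"
    proof -
      have st: "complex_of_real s + complex_of_real t - 1 = 0"
        using zw(5) by (metis diff_self of_real_1 of_real_add)
      have "(s *\<^sub>R l z + t *\<^sub>R l w) $ m - l (s *\<^sub>R z + t *\<^sub>R w) $ m
          = (complex_of_real s + complex_of_real t - 1) * a $ m" for m
        by (simp add: l_def scaleR_conv_of_real[where 'a = complex] algebra_simps)
      then show ?thesis unfolding st by (simp add: vec_eq_iff)
    qed
    then show "s *\<^sub>R z + t *\<^sub>R w \<in> \<Omega>"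
      using convexD[OF convex_ball, of "l z" y0 \<epsilon> "l w" s t] zw by (simp add: \<Omega>_def)
  qed
  have hol: "(\<lambda>z. laurent_eval r (g (l z))) holomorphic_on \<Omega>" for r
  proof (subst holomorphic_on_open[OF \<open>open \<Omega>\<close>], intro ballI)
    fix z assume "z \<in> \<Omega>"
    then have z: "l z \<in> ball y0 \<epsilon>" by (simp add: \<Omega>_def)
    have 1: "((\<lambda>z. g (l z)) has_derivative (\<lambda>w. g' (l z) (w *s (b - a)))) (at z)"
      using has_derivative_compose[OF l_der, of g] g[OF z] by blast
    have 2: "((\<lambda>z. laurent_eval r (g (l z))) has_derivative (\<lambda>w.
      \<Sum>m\<in>UNIV. laurent_eval (euler m r) (g (l z)) / g (l z) $ m * g' (l z) (w *s (b - a)) $ m)) (at z)"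
      using has_derivative_compose[OF 1 laurent_eval_has_derivative] g[OF z] by blast
    have "(\<lambda>w. \<Sum>m\<in>UNIV. laurent_eval (euler m r) (g (l z)) / g (l z) $ m * g' (l z) (w *s (b - a)) $ m)
      = (*) (\<Sum>m\<in>UNIV. laurent_eval (euler m r) (g (l z)) / g (l z) $ m * g' (l z) (b - a) $ m)"
    proof -
      have "g' (l z) (w *s (b - a)) = w *s g' (l z) (b - a)" for w using g[OF z] by blast
      then show ?thesis
        by (simp only: fun_eq_iff sum_distrib_right vector_smult_component) (simp add: mult_ac)
    qed
    with 2 show "\<exists>f'. ((\<lambda>z. laurent_eval r (g (l z))) has_field_derivative f') (at z)"
      unfolding has_field_derivative_def by (intro exI) simp
  qed
  have 01: "0 \<in> \<Omega>" "1 \<in> \<Omega>" "l 0 = a" "l 1 = b"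
    using ab(1,3) D(1) by (auto simp: \<Omega>_def l_def)
  let ?P = "\<lambda>z. laurent_eval p (g (l z))" and ?Q = "\<lambda>z. laurent_eval q (g (l z))"
  have PQ: "?P z * ?Q z = 0" if "z \<in> \<Omega>" for z
  proof -
    have "l z \<in> D" using D(2)[OF ab(1,3), of z] that by (simp add: \<Omega>_def l_def)
    then have "laurent_eval (p * q) (g (l z)) = 0" using van by (simp add: vanishes_on_def)
    moreover have "g (l z) \<in> torus" using g that by (simp add: \<Omega>_def)
    ultimately show ?thesis by (simp add: laurent_eval_mult)
  qed
  \<comment> \<open>Near 1 the factor from \<open>q\<close> is nonzero, so the one from
    \<open>p\<close> vanishes on a nonempty open set and, by the identity theorem, on all of
    \<open>\<Omega>\<close>, in particular at 0.\<close>
  define W where "W = {z \<in> \<Omega>. ?Q z \<noteq> 0}"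
  have "open W"
  proof -
    have "W = \<Omega> \<inter> ?Q -` (- {0})" by (auto simp: W_def)
    then show ?thesis
      using continuous_open_preimage[OF holomorphic_on_imp_continuous_on[OF hol[of q]] \<open>open \<Omega>\<close>, of "- {0}"]
      by (simp add: open_Compl)
  qed
  moreover have "1 \<in> W" using 01 ab(4) by (simp add: W_def)
  ultimately have "?P 0 = 0"
    using analytic_continuation_open[OF _ \<open>open \<Omega>\<close> _ convex_connected[OF \<open>convex \<Omega>\<close>] _ hol[of p],
        of W "\<lambda>_. 0" 0] PQ 01(1) by (auto simp: W_def)
  with ab(2) 01 show False by simp
qed

text \<open>\<open>\<alpha>\<close> is indexed from 1 and \<open>r\<close> from 0, so that the
  members of \<open>r\<close> match an enumeration of the coordinates by
  \<open>{..<CARD('n)}\<close>.\<close>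

lemma extend_to_basis:
  fixes \<alpha> :: "nat \<Rightarrow> 'a :: field ^ 'n::finite"
  assumes indep: "\<And>c. (\<Sum>j\<in>{1..i}. c j *s \<alpha> j) = 0 \<Longrightarrow> \<forall>j\<in>{1..i}. c j = 0"
  obtains r where "i \<le> CARD('n)" "\<And>t. t < i \<Longrightarrow> r t = \<alpha> (Suc t)"
    "vec.span (r ` {..<CARD('n)}) = UNIV"
proof -
  have inj: "inj_on \<alpha> {1..i}"
  proof (rule inj_onI, rule ccontr)
    fix p q assume pq: "p \<in> {1..i}" "q \<in> {1..i}" "\<alpha> p = \<alpha> q" "p \<noteq> q"
    let ?c = "\<lambda>t. if t = p then 1 else if t = q then - 1 else (0 :: 'a)"
    have "(\<Sum>j\<in>{1..i}. ?c j *s \<alpha> j) = (\<Sum>j\<in>{p, q}. ?c j *s \<alpha> j)"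
      by (rule sum.mono_neutral_right) (use pq in auto)
    also have "\<dots> = 0" using pq by (simp add: vec.scale_minus_left)
    finally have "?c p = 0" using indep[of ?c] pq(1) by blast
    then show False by simp
  qed
  have "vec.independent (\<alpha> ` {1..i})"
  proof
    assume "vec.dependent (\<alpha> ` {1..i})"
    then obtain u v where u: "v \<in> \<alpha> ` {1..i}" "u v \<noteq> 0" "(\<Sum>v\<in>\<alpha> ` {1..i}. u v *s v) = 0"
      using vec.dependent_finite[of "\<alpha> ` {1..i}"] by blast
    then have "(\<Sum>j\<in>{1..i}. u (\<alpha> j) *s \<alpha> j) = 0"
      using sum.reindex[OF inj, of "\<lambda>v. u v *s v"] by (simp add: o_def)
    from indep[OF this] have "\<forall>j\<in>{1..i}. u (\<alpha> j) = 0" by simp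
    with u(1,2) show False by blast
  qed
  then obtain B where B: "\<alpha> ` {1..i} \<subseteq> B" "vec.independent B" "UNIV \<subseteq> vec.span B"
    using vec.maximal_independent_subset_extend[OF subset_UNIV, of "\<alpha> ` {1..i}"] by metis
  have cardB: "card B = CARD('n)" and finB: "finite B"
    using vec.basis_card_eq_dim[OF subset_UNIV B(3,2)] vec.finiteI_independent[OF B(2)]
    by (simp_all add: vec_dim_card card_cart_basis)
  have card\<alpha>: "card (\<alpha> ` {1..i}) = i" using card_image[OF inj] by simp
  have i: "i \<le> CARD('n)" using card_mono[OF finB B(1)] card\<alpha> cardB by simp
  have "card (B - \<alpha> ` {1..i}) = card {i..<CARD('n)}"
    using card_Diff_subset[OF finite_imageI B(1)] card\<alpha> cardB by simp
  with finB obtain g where g: "bij_betw g {i..<CARD('n)} (B - \<alpha> ` {1..i})"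
    using finite_same_card_bij[of "{i..<CARD('n)}" "B - \<alpha> ` {1..i}"] by auto
  define r where "r t = (if t < i then \<alpha> (Suc t) else g t)" for t
  have "r ` {..<CARD('n)} = B"
  proof -
    have "{..<CARD('n)} = {..<i} \<union> {i..<CARD('n)}" using i by auto
    then have "r ` {..<CARD('n)} = r ` {..<i} \<union> r ` {i..<CARD('n)}" by (simp only: image_Un)
    moreover have "r ` {..<i} = \<alpha> ` Suc ` {..<i}" by (auto simp: r_def image_image)
    moreover have "r ` {i..<CARD('n)} = g ` {i..<CARD('n)}" by (auto simp: r_def)
    moreover have "g ` {i..<CARD('n)} = B - \<alpha> ` {1..i}" using g by (simp add: bij_betw_def)
    moreover have "Suc ` {..<i} = {1..i}" by (simp add: image_Suc_lessThan)
    ultimately show ?thesis using B(1) by auto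
  qed
  with B(3) i show ?thesis by (intro that[of r]) (auto simp: r_def)
qed

theorem chain_exists:
  fixes h :: "nat \<Rightarrow> 'n::finite laurent"
  assumes reg: "regular_system i h" and x0: "x0 \<in> torus_zeros i h"
  shows "i \<le> CARD('n) \<and> (\<exists>Y. (\<forall>k\<le>CARD('n) - i. torus_irreducible (Y k) \<and> Y k \<subseteq> torus_zeros i h) \<and>
    (\<forall>k<CARD('n) - i. Y k \<subset> Y (Suc k)))"
proof -
  let ?n = "CARD('n)"
  have tor: "x0 \<in> torus" using x0 by (simp add: torus_zeros_def)
  \<comment> \<open>Gradients in ordinary coordinates at \<open>x0\<close>; regularity there is
    their independence.\<close>
  define \<alpha> where "\<alpha> j = (\<chi> m. laurent_eval (euler m (h j)) x0 / x0 $ m)" for j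
  have "\<forall>j\<in>{1..i}. c j = 0" if c: "(\<Sum>j\<in>{1..i}. c j *s \<alpha> j) = 0" for c
  proof -
    have "(\<Sum>j\<in>{1..i}. c j * laurent_eval (euler m (h j)) x0) = 0" for m
    proof -
      have "0 = (\<Sum>j\<in>{1..i}. c j *s \<alpha> j) $ m" using c by simp
      also have "\<dots> = (\<Sum>j\<in>{1..i}. c j * laurent_eval (euler m (h j)) x0) / x0 $ m"
        by (simp add: \<alpha>_def sum_divide_distrib)
      finally show ?thesis using torus_nonzero[OF tor, of m] by simp
    qed
    then show ?thesis using reg x0 unfolding regular_system_iff by blast
  qed
  from extend_to_basis[of \<alpha> i, OF this]
  obtain r where i: "i \<le> ?n" and r: "\<And>t. t < i \<Longrightarrow> r t = \<alpha> (Suc t)" and span: "vec.span (r ` {..<?n}) = UNIV"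
    by blast
  \<comment> \<open>The coordinate type carries no order; the enumeration decides which coordinates
    hold the equations and in which order the others become free.\<close>
  obtain \<iota> :: "'n \<Rightarrow> nat" where \<iota>: "bij_betw \<iota> UNIV {..<?n}"
    using ex_bij_betw_finite_nat[of "UNIV :: 'n set"] by (auto simp: atLeast0LessThan)
  have \<iota>_surj: "\<exists>p. \<iota> p = t" if "t < ?n" for t
    using \<iota> that by (metis bij_betw_imp_surj_on imageE lessThan_iff)
  \<comment> \<open>The equations together with linear forms whose gradients complete theirs to a
    basis: local coordinates at \<open>x0\<close> in which the zero set is a coordinate
    subspace.\<close>
  define H where "H p = (if \<iota> p < i then h (Suc (\<iota> p)) else linear_form (r (\<iota> p)))" for p
  have jac: "jacobian H x0 u $ p = (\<Sum>m\<in>UNIV. r (\<iota> p) $ m * u $ m)" for p u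
    using torus_nonzero[OF tor]
    by (simp add: jacobian_def H_def r \<alpha>_def laurent_eval_euler_linear_form)
  have "u = 0" if "jacobian H x0 u = 0" for u
  proof -
    have basis: "(\<Sum>m\<in>UNIV. r t $ m * u $ m) = 0" if "t < ?n" for t
      using \<iota>_surj[OF that] jac[of u] \<open>jacobian H x0 u = 0\<close> by (metis zero_index)
    have all: "(\<Sum>m\<in>UNIV. w $ m * u $ m) = 0" for w
    proof -
      have "w \<in> vec.span (r ` {..<?n})" using span by simp
      then show ?thesis
      proof (induction rule: vec.span_induct_alt)
        case (step c x y)
        then obtain t where "t < ?n" "x = r t" by auto
        with basis[of t] step show ?case
          by (simp add: distrib_right sum.distrib mult.assoc flip: sum_distrib_left)
      qed simp
    qed
    have "u $ p = 0" for p
    proof -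
      have "(\<Sum>m\<in>UNIV. axis p 1 $ m * u $ m) = (\<Sum>m\<in>UNIV. if m = p then u $ m else 0)"
        by (rule sum.cong) (auto simp: axis_def)
      with all[of "axis p 1"] show ?thesis by simp
    qed
    then show ?thesis by (simp add: vec_eq_iff)
  qed
  note inj = this
  define y0 where "y0 = laurent_map H x0"
  obtain \<epsilon> g g' where \<epsilon>: "\<epsilon> > 0" and g: "\<And>y. y \<in> ball y0 \<epsilon> \<Longrightarrow> g y \<in> torus \<and> laurent_map H (g y) = y \<and>
       (g has_derivative g' y) (at y) \<and> (\<forall>c u. g' y (c *s u) = c *s g' y u)"
    using laurent_map_local_inverse[OF tor inj] unfolding y0_def by metis
  \<comment> \<open>A flag of slices: the \<open>i\<close> equation coordinates keep their value at
    \<open>y0\<close>, which is 0, the next \<open>k\<close> coordinates are free, and the others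
    are frozen.\<close>
  define D where "D k = {y \<in> ball y0 \<epsilon>. \<forall>p. \<iota> p \<notin> {i..<i + k} \<longrightarrow> y $ p = y0 $ p}" for k
  define Y where "Y k = zariski_closure (g ` D k)" for k
  have D_sub: "D k \<subseteq> ball y0 \<epsilon>" for k by (auto simp: D_def)
  have gD: "g ` D k \<subseteq> torus" for k using g D_sub by blast
  have y0D: "y0 \<in> D k" for k using \<epsilon> by (simp add: D_def)
  have irr: "torus_irreducible (Y k)" for k
    unfolding Y_def
  proof (rule torus_irreducible_zariski_closure[OF gD])
    show "g ` D k \<noteq> {}" using y0D by blast
    show "vanishes_on (g ` D k) p \<or> vanishes_on (g ` D k) q" if "vanishes_on (g ` D k) (p * q)" for p q
    proof (rule vanishes_on_convex_image_mult[of y0 \<epsilon> g g', OF _ D_sub _ that])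
      show "g y \<in> torus \<and> (g has_derivative g' y) (at y) \<and> (\<forall>c u. g' y (c *s u) = c *s g' y u)"
        if "y \<in> ball y0 \<epsilon>" for y using g[OF that] by blast
      show "a + z *s (b - a) \<in> D k" if "a \<in> D k" "b \<in> D k" "a + z *s (b - a) \<in> ball y0 \<epsilon>" for a b z
        using that by (auto simp: D_def)
    qed
  qed
  have comp: "laurent_eval (H p) (g y) = y $ p" if "y \<in> D k" for y k p
  proof -
    have "laurent_map H (g y) = y" using g D_sub that by blast
    then have "laurent_map H (g y) $ p = y $ p" by simp
    then show ?thesis by (simp add: laurent_map_def)
  qed
  have sub: "Y k \<subseteq> torus_zeros i h" if "k \<le> ?n - i" for k
  proof
    fix x assume x: "x \<in> Y k"
    have "laurent_eval (h j) x = 0" if j: "j \<in> {1..i}" for j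
    proof -
      have "j - 1 < ?n" using j i unfolding atLeastAtMost_iff by linarith
      from \<iota>_surj[OF this] obtain p where p: "\<iota> p = j - 1" by blast
      moreover have "j - 1 < i" "Suc (j - 1) = j" using j unfolding atLeastAtMost_iff by linarith+
      ultimately have Hp: "H p = h j" by (simp add: H_def)
      have "y0 $ p = 0" using x0 j by (simp add: y0_def laurent_map_def Hp torus_zeros_def)
      then have "vanishes_on (g ` D k) (h j)"
        using comp[of _ k p] p \<open>j - 1 < i\<close> by (auto simp: vanishes_on_def D_def Hp)
      then show ?thesis using x by (simp add: Y_def zariski_closure_def)
    qed
    moreover have "x \<in> torus" using x by (simp add: Y_def zariski_closure_def)
    ultimately show "x \<in> torus_zeros i h" by (simp add: torus_zeros_def)
  qed
  have strict: "Y k \<subset> Y (Suc k)" if k: "k < ?n - i" for k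
  proof -
    have "g ` D k \<subseteq> g ` D (Suc k)" by (auto simp: D_def)
    then have "Y k \<subseteq> Y (Suc k)"
      unfolding Y_def
      by (intro zariski_closure_minimal torus_closed_zariski_closure)
        (use subset_zariski_closure[OF gD[of "Suc k"]] in blast)
    moreover have "Y k \<noteq> Y (Suc k)"
    proof -
      have "i + k < ?n" using k by linarith
      from \<iota>_surj[OF this] obtain p where p: "\<iota> p = i + k" by blast
      \<comment> \<open>The coordinate that becomes free in passing from \<open>D k\<close> to
        \<open>D (Suc k)\<close>, normalised to vanish on the smaller slice.\<close>
      define P where "P = H p - single 0 (y0 $ p)"
      have evP: "laurent_eval P (g y) = y $ p - y0 $ p" if "y \<in> D k'" for y k'
        using comp[OF that, of p] by (simp add: P_def laurent_eval_diff)
      have "vanishes_on (g ` D k) P" using evP[of _ k] p by (auto simp: vanishes_on_def D_def)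
      then have van: "vanishes_on (Y k) P" unfolding Y_def by (rule vanishes_on_zariski_closure)
      define y where "y = y0 + axis p (of_real (\<epsilon> / 2))"
      have "norm (axis p (complex_of_real (\<epsilon> / 2)) :: complex ^ 'n) = norm (complex_of_real (\<epsilon> / 2))"
        unfolding norm_eq_sqrt_inner inner_axis_axis by simp
      then have "y \<in> ball y0 \<epsilon>" using \<epsilon> by (simp add: y_def dist_norm)
      moreover have "y $ p' = y0 $ p'" if "\<iota> p' \<notin> {i..<i + Suc k}" for p'
        using p that by (auto simp: y_def axis_def)
      ultimately have yD: "y \<in> D (Suc k)" by (simp add: D_def)
      then have "g y \<in> Y (Suc k)" unfolding Y_def using subset_zariski_closure[OF gD] by blast
      moreover have "laurent_eval P (g y) \<noteq> 0"
      proof -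
        have "y $ p - y0 $ p = complex_of_real (\<epsilon> / 2)" by (simp add: y_def)
        also have "\<dots> \<noteq> 0" using \<epsilon> by simp
        finally show ?thesis unfolding evP[OF yD] .
      qed
      ultimately show ?thesis using van by (auto simp: vanishes_on_def)
    qed
    ultimately show ?thesis by blast
  qed
  show ?thesis using i irr sub strict by blast
qed

theorem regular_system_codim:
  fixes h :: "nat \<Rightarrow> 'n::finite laurent"
  assumes reg: "regular_system i h"
  shows "has_codim (torus_zeros i h) i"
proof (cases "torus_zeros i h = {}")
  case False
  then obtain x0 where x0: "x0 \<in> torus_zeros i h" by blast
  let ?n = "CARD('n)"
  let ?C = "{enat d | d. \<exists>Y :: nat \<Rightarrow> (complex ^ 'n) set.
     (\<forall>k\<le>d. torus_irreducible (Y k) \<and> Y k \<subseteq> torus_zeros i h) \<and> (\<forall>k<d. Y k \<subset> Y (Suc k))}"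
  note ex = chain_exists[OF reg x0]
  have "Sup ?C = enat (?n - i)"
  proof (rule antisym)
    show "Sup ?C \<le> enat (?n - i)"
    proof (rule Sup_least)
      fix e assume "e \<in> ?C"
      then obtain d Y where e: "e = enat d" and Y: "\<forall>k\<le>d. torus_irreducible (Y k) \<and> Y k \<subseteq> torus_zeros i h"
        "\<forall>k<d. Y k \<subset> Y (Suc k)" by blast
      have "i + d \<le> ?n" by (rule chain_length_le[OF reg, of d Y]) (use Y in auto)
      then show "e \<le> enat (?n - i)" by (simp add: e)
    qed
    show "enat (?n - i) \<le> Sup ?C" using ex by (intro Sup_upper) blast
  qed
  then show ?thesis using ex by (simp add: has_codim_def krull_dim_def)
qed (simp add: has_codim_def)

section \<open>Support sequences and leading parts\<close>

lemma laurent_eval_const_mult: "laurent_eval (single 0 c * g) x = c * laurent_eval g x"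
proof -
  have "keys (single 0 c * g) \<subseteq> keys g" by (auto simp: in_keys_iff lookup_const_mult)
  then show ?thesis
    by (simp add: laurent_eval_superset[of "keys g"] lookup_const_mult sum_distrib_left mult.assoc)
qed

lemma euler_const_mult: "euler m (single 0 c * g) = single 0 c * euler m g"
  by (rule poly_mapping_eqI) (simp add: lookup_euler lookup_const_mult)

text \<open>The zeros are transported by expressing \<open>w\<close> through \<open>u\<close>, the
  relation by expressing \<open>u\<close> through \<open>w\<close>: the new \<open>c'\<close> is
  \<open>c\<close> times the matrix of the latter expression.\<close>

lemma singular_at_span:
  assumes uw: "\<And>j. j \<in> {1..i} \<Longrightarrow> \<exists>M. \<forall>a. lookup (u j) a = (\<Sum>m\<in>{1..i}. M m * lookup (w m) a)"
    and wu: "\<And>j. j \<in> {1..i} \<Longrightarrow> \<exists>M. \<forall>a. lookup (w j) a = (\<Sum>m\<in>{1..i}. M m * lookup (u m) a)"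
    and sing: "singular_at i u f x c"
  shows "\<exists>c'. singular_at i w f x c'"
proof -
  have cw: "g \<star> f = (\<Sum>m\<in>{1..i}. single 0 (M m) * (h m \<star> f))"
    if "\<And>a. lookup g a = (\<Sum>m\<in>{1..i}. M m * lookup (h m) a)" for g M and h :: "nat \<Rightarrow> 'a laurent"
    by (rule poly_mapping_eqI)
      (simp add: lookup_cwprod lookup_sum lookup_const_mult that sum_distrib_right mult.assoc)
  have "\<forall>j. \<exists>M. j \<in> {1..i} \<longrightarrow> (\<forall>a. lookup (u j) a = (\<Sum>m\<in>{1..i}. M m * lookup (w m) a))"
    using uw by blast
  then obtain M where M: "\<forall>j. j \<in> {1..i} \<longrightarrow> (\<forall>a. lookup (u j) a = (\<Sum>m\<in>{1..i}. M j m * lookup (w m) a))"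
    by (rule choice[THEN exE])
  have x: "x \<in> torus" "\<And>j. j \<in> {1..i} \<Longrightarrow> laurent_eval (u j \<star> f) x = 0"
    using sing by (auto simp: singular_at_def torus_zeros_def)
  have "laurent_eval (w j \<star> f) x = 0" if j: "j \<in> {1..i}" for j
  proof -
    obtain N where "\<And>a. lookup (w j) a = (\<Sum>m\<in>{1..i}. N m * lookup (u m) a)" using wu[OF j] by blast
    then have "laurent_eval (w j \<star> f) x = (\<Sum>m\<in>{1..i}. N m * laurent_eval (u m \<star> f) x)"
      by (simp add: cw laurent_eval_sum laurent_eval_const_mult)
    also have "\<dots> = 0" by (rule sum.neutral) (simp add: x(2))
    finally show ?thesis .
  qed
  with x have zeros: "x \<in> torus_zeros i (\<lambda>j. w j \<star> f)" by (simp add: torus_zeros_def)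
  define c' where "c' m = (\<Sum>j\<in>{1..i}. c j * M j m)" for m
  have c': "(\<Sum>m\<in>{1..i}. c' m * e m) = (\<Sum>j\<in>{1..i}. c j * (\<Sum>m\<in>{1..i}. M j m * e m))" for e
    unfolding c'_def sum_distrib_left sum_distrib_right by (subst sum.swap) (simp add: mult.assoc)
  have "(\<Sum>m\<in>{1..i}. c' m * laurent_eval (euler p (w m \<star> f)) x) = 0" for p
  proof -
    have "(\<Sum>m\<in>{1..i}. M j m * laurent_eval (euler p (w m \<star> f)) x) = laurent_eval (euler p (u j \<star> f)) x"
      if "j \<in> {1..i}" for j
    proof -
      have "u j \<star> f = (\<Sum>m\<in>{1..i}. single 0 (M j m) * (w m \<star> f))" using M that by (intro cw) blast
      then show ?thesis by (simp add: euler_sum euler_const_mult laurent_eval_sum laurent_eval_const_mult)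
    qed
    then have "(\<Sum>m\<in>{1..i}. c' m * laurent_eval (euler p (w m \<star> f)) x)
        = (\<Sum>j\<in>{1..i}. c j * laurent_eval (euler p (u j \<star> f)) x)"
      unfolding c' by (intro sum.cong) auto
    then show ?thesis using sing by (simp add: singular_at_def)
  qed
  moreover obtain a where a: "(\<Sum>j\<in>{1..i}. c j * lookup (u j) a) \<noteq> 0"
    using sing unfolding singular_at_def by blast
  have "(\<Sum>m\<in>{1..i}. c' m * lookup (w m) a) = (\<Sum>j\<in>{1..i}. c j * lookup (u j) a)"
    unfolding c' by (rule sum.cong) (use M in auto)
  with a have "\<exists>a. (\<Sum>m\<in>{1..i}. c' m * lookup (w m) a) \<noteq> 0" by metis
  ultimately show ?thesis using zeros unfolding singular_at_def by blast
qed

lemma lookup_lead_l: "lookup (lead_l l g) a = (if ldeg l a = deg_l l g then lookup g a else 0)"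
proof -
  have "lookup (lead_l l g) a =
      (\<Sum>b\<in>{b \<in> keys g. ldeg l b = deg_l l g}. if b = a then lookup g b else 0)"
    by (simp add: lead_l_def lookup_sum lookup_single when_def)
  then show ?thesis by (simp add: in_keys_iff)
qed

lemma generically_of_nonzero:
  assumes "p \<in> nonzero_coeff_polys A" "\<And>f. f \<in> laurent_space A \<Longrightarrow> p f \<noteq> 0 \<Longrightarrow> P f"
  shows "generically A P"
  unfolding generically_def
  by (rule exI[of _ "{p}"]) (use assms in \<open>auto simp: nonzero_coeff_polys_def\<close>)

definition comb :: "(nat \<Rightarrow> 'n::finite laurent) \<Rightarrow> (nat \<Rightarrow> complex) \<Rightarrow> nat \<Rightarrow> int ^ 'n \<Rightarrow> complex" where
  "comb v c j a = (\<Sum>i\<in>{1..j}. c i * lookup (v i) a)"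

lemma comb_Suc: "comb v c (Suc j) a = comb v c j a + c (Suc j) * lookup (v (Suc j)) a"
  by (simp add: comb_def)

lemma comb_cong: "(\<And>i. i \<in> {1..j} \<Longrightarrow> c i = c' i) \<Longrightarrow> comb v c j a = comb v c' j a"
  unfolding comb_def by (rule sum.cong) auto

lemma comb_extend:
  assumes "j \<le> k" "\<And>i. i \<in> {1..k} \<Longrightarrow> j < i \<Longrightarrow> c i = 0"
  shows "comb v c k a = comb v c j a"
  unfolding comb_def by (rule sum.mono_neutral_right) (use assms in auto)

lemma lin_indep_restr_subset:
  assumes "lin_indep_restr J v B" "I \<subseteq> J" "finite J"
  shows "lin_indep_restr I v B"
  unfolding lin_indep_restr_def
proof (intro allI impI)
  fix c :: "nat \<Rightarrow> complex"
  assume c: "\<forall>a\<in>B. (\<Sum>i\<in>I. c i * lookup (v i) a) = 0"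
  define c' where "c' i = (if i \<in> I then c i else 0)" for i
  have "(\<Sum>i\<in>J. c' i * lookup (v i) a) = (\<Sum>i\<in>I. c i * lookup (v i) a)" for a
    by (rule sum.mono_neutral_cong_right) (use assms in \<open>auto simp: c'_def\<close>)
  with c have "\<forall>a\<in>B. (\<Sum>i\<in>J. c' i * lookup (v i) a) = 0" by simp
  with assms(1) have "\<forall>i\<in>J. c' i = 0" unfolding lin_indep_restr_def by blast
  then have "c' i = 0" if "i \<in> I" for i using assms(2) that by blast
  then show "\<forall>i\<in>I. c i = 0" by (simp add: c'_def)
qed

section \<open>Minimal degrees and the support sequence\<close>

context
  fixes A :: "(int ^ 'n::finite) set" and v :: "nat \<Rightarrow> 'n laurent" and k :: nat
  assumes A: "finite A"
    and indep: "lin_indep_restr {1..k} v A"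
begin

text \<open>The minimal \<open>l\<close>-degree on the affine space \<open>v\<^sub>j + \<langle>v\<^sub>1, \<dots>, v\<^sub>j\<^sub>-\<^sub>1\<rangle>\<close> is less than \<open>d\<close>.\<close>

definition lowers :: "int ^ 'n \<Rightarrow> nat \<Rightarrow> int \<Rightarrow> bool" where
  "lowers l j d \<longleftrightarrow> (\<exists>c. c j = 1 \<and> (\<forall>a\<in>A. d \<le> ldeg l a \<longrightarrow> comb v c j a = 0))"

lemma lowers_mono: "lowers l j d \<Longrightarrow> d \<le> d' \<Longrightarrow> lowers l j d'"
  unfolding lowers_def by fastforce

text \<open>Dividing by the last nonzero coefficient turns a combination with highest index
  \<open>j\<close> into an element of the affine space on which the degree is minimised.\<close>

lemma lowersI:
  assumes "j \<in> {1..k}" "b j \<noteq> 0" "\<And>i. i \<in> {1..k} \<Longrightarrow> j < i \<Longrightarrow> b i = 0"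
    and "\<And>a. a \<in> A \<Longrightarrow> d \<le> ldeg l a \<Longrightarrow> comb v b k a = 0"
  shows "lowers l j d"
proof -
  have "comb v (\<lambda>i. b i / b j) j a = 0" if "a \<in> A" "d \<le> ldeg l a" for a
  proof -
    have "comb v (\<lambda>i. b i / b j) j a = comb v b j a / b j"
      by (simp add: comb_def sum_divide_distrib)
    also have "comb v b j a = comb v b k a"
      by (rule comb_extend[symmetric]) (use assms in auto)
    finally show ?thesis using assms(4)[OF that] by simp
  qed
  then show ?thesis
    unfolding lowers_def using assms(2) by (intro exI[of _ "\<lambda>i. b i / b j"]) auto
qed

lemma comb_zero_iff:
  assumes "\<And>a. a \<in> A \<Longrightarrow> comb v c k a = 0" "i \<in> {1..k}"
  shows "c i = 0"
  using indep[unfolded lin_indep_restr_def, rule_format, of c i] assms by (simp add: comb_def)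

text \<open>Below all degrees of \<open>A\<close> the condition would make a nontrivial combination
  vanish on \<open>A\<close>, contrary to independence; above all degrees it is empty. Monotonicity
  leaves a threshold.\<close>

lemma ex_min_degree:
  assumes j: "j \<in> {1..k}"
  shows "\<exists>\<psi>. \<forall>d. lowers l j d \<longleftrightarrow> \<psi> < d"
proof -
  have "bdd_below (ldeg l ` A)" "bdd_above (ldeg l ` A)" using A by simp_all
  then obtain N M where N: "\<And>a. a \<in> A \<Longrightarrow> N \<le> ldeg l a" and M: "\<And>a. a \<in> A \<Longrightarrow> ldeg l a \<le> M"
    unfolding bdd_below_def bdd_above_def by auto
  have low: "\<not> lowers l j d" if "d \<le> N" for d
  proof
    assume "lowers l j d"
    then obtain c where c: "c j = 1" "\<And>a. a \<in> A \<Longrightarrow> d \<le> ldeg l a \<Longrightarrow> comb v c j a = 0"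
      unfolding lowers_def by blast
    have c0: "comb v c j a = 0" if "a \<in> A" for a
      by (rule c(2)[OF that order_trans[OF \<open>d \<le> N\<close> N[OF that]]])
    define c' where "c' i = (if i \<le> j then c i else 0)" for i
    have "comb v c' k a = comb v c j a" for a
    proof -
      have "comb v c' k a = comb v c' j a" by (rule comb_extend) (use j in \<open>auto simp: c'_def\<close>)
      also have "\<dots> = comb v c j a" by (rule comb_cong) (simp add: c'_def)
      finally show ?thesis .
    qed
    then have "c' j = 0" using comb_zero_iff[of c' j] c0 j by simp
    then show False using c(1) by (simp add: c'_def)
  qed
  have high: "lowers l j d" if "d > M" for d
    unfolding lowers_def using M that by (intro exI[of _ "\<lambda>_. 1"]) force
  define n where "n = (LEAST n. lowers l j (N + int n))"
  \<comment> \<open>Truncation by \<open>nat\<close> can only raise this value, so it exceeds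
    \<open>M\<close> in any case.\<close>
  have "lowers l j (N + int (nat (M + 1 - N)))" by (rule high) simp
  then have n: "lowers l j (N + int n)" unfolding n_def by (rule LeastI)
  have "lowers l j d \<longleftrightarrow> N + int n - 1 < d" for d
  proof
    assume d: "lowers l j d"
    then have "d > N" using low[of d] by force
    with d have "lowers l j (N + int (nat (d - N)))" by simp
    then have "n \<le> nat (d - N)" unfolding n_def by (rule Least_le)
    with \<open>d > N\<close> show "N + int n - 1 < d" by linarith
  next
    assume "N + int n - 1 < d"
    then show "lowers l j d" using lowers_mono[OF n] by simp
  qed
  then show ?thesis by blast
qed

definition min_degree :: "int ^ 'n \<Rightarrow> nat \<Rightarrow> int" where
  "min_degree l j = (SOME \<psi>. \<forall>d. lowers l j d \<longleftrightarrow> \<psi> < d)"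

lemma lowers_iff: "j \<in> {1..k} \<Longrightarrow> lowers l j d \<longleftrightarrow> min_degree l j < d"
  unfolding min_degree_def using someI_ex[OF ex_min_degree] by blast

text \<open>The largest index occurring in a relation on the part of degree at least
  \<open>d\<close> would have minimal degree below \<open>d\<close>, but every index in play has
  minimal degree at least \<open>d\<close>.\<close>

lemma l_lin_indep_min_degree:
  assumes \<phi>: "\<And>i. i \<in> {1..k} \<Longrightarrow> \<phi> i = min_degree l i"
  shows "l_lin_indep l A v k \<phi>"
  unfolding l_lin_indep_def lin_indep_restr_def
proof (intro allI impI, rule ccontr)
  fix d c
  let ?I = "{i \<in> {1..k}. d \<le> \<phi> i}"
  assume c: "\<forall>a\<in>{a \<in> A. d \<le> ldeg l a}. (\<Sum>i\<in>?I. c i * lookup (v i) a) = 0"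
    and nz: "\<not> (\<forall>i\<in>?I. c i = 0)"
  define K where "K = {i \<in> ?I. c i \<noteq> 0}"
  have K: "finite K" "K \<noteq> {}" using nz by (auto simp: K_def)
  define j where "j = Max K"
  have j: "j \<in> {1..k}" "d \<le> \<phi> j" "c j \<noteq> 0" using Max_in[OF K] by (auto simp: j_def K_def)
  define b where "b i = (if i \<in> ?I then c i else 0)" for i
  have "lowers l j d"
  proof (rule lowersI[OF j(1)])
    show "b j \<noteq> 0" using j by (simp add: b_def)
    show "b i = 0" if "i \<in> {1..k}" "j < i" for i
    proof (rule ccontr)
      assume "b i \<noteq> 0"
      then have "i \<in> K" by (auto simp: b_def K_def split: if_splits)
      then show False using Max_ge[OF K(1), of i] that(2) by (simp add: j_def)
    qed
    fix a assume a: "a \<in> A" "d \<le> ldeg l a"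
    have "comb v b k a = (\<Sum>i\<in>?I. c i * lookup (v i) a)"
      unfolding comb_def by (rule sum.mono_neutral_cong_right) (auto simp: b_def)
    then show "comb v b k a = 0" using c a by simp
  qed
  then show False using j \<phi> by (simp add: lowers_iff)
qed

text \<open>Where degrees are at least \<open>d\<close>, a vector of minimal degree below
  \<open>d\<close> agrees with a combination of earlier ones. Eliminating from the top index down
  leaves only indices of minimal degree at least \<open>d\<close>.\<close>

lemma eliminate_low:
  assumes "j \<le> k"
  shows "\<exists>b'. (\<forall>i. b' i \<noteq> 0 \<longrightarrow> i \<in> {1..j} \<and> d \<le> min_degree l i) \<and>
    (\<forall>a\<in>A. d \<le> ldeg l a \<longrightarrow> comb v b' j a = comb v b j a)"
  using assms
proof (induction j arbitrary: b)
  case 0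
  show ?case by (rule exI[of _ "\<lambda>_. 0"]) (simp add: comb_def)
next
  case (Suc j)
  have j: "Suc j \<in> {1..k}" using Suc.prems by simp
  show ?case
  proof (cases "d \<le> min_degree l (Suc j)")
    case True
    obtain b' where b': "\<And>i. b' i \<noteq> 0 \<Longrightarrow> i \<in> {1..j} \<and> d \<le> min_degree l i"
      "\<And>a. a \<in> A \<Longrightarrow> d \<le> ldeg l a \<Longrightarrow> comb v b' j a = comb v b j a"
      using Suc.IH[of b] Suc.prems by auto
    define b'' where "b'' = b'(Suc j := b (Suc j))"
    have "comb v b'' j a = comb v b' j a" for a by (rule comb_cong) (auto simp: b''_def)
    then have "comb v b'' (Suc j) a = comb v b (Suc j) a" if "a \<in> A" "d \<le> ldeg l a" for a
      using b'(2)[OF that] by (simp add: comb_Suc b''_def)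
    moreover have "i \<in> {1..Suc j} \<and> d \<le> min_degree l i" if "b'' i \<noteq> 0" for i
      using b'(1)[of i] True that by (cases "i = Suc j") (auto simp: b''_def)
    ultimately show ?thesis by blast
  next
    case False
    then have "lowers l (Suc j) d" using lowers_iff[OF j] by simp
    then obtain e where e: "e (Suc j) = 1" "\<And>a. a \<in> A \<Longrightarrow> d \<le> ldeg l a \<Longrightarrow> comb v e (Suc j) a = 0"
      unfolding lowers_def by blast
    let ?b = "\<lambda>i. b i - b (Suc j) * e i"
    obtain b' where b': "\<And>i. b' i \<noteq> 0 \<Longrightarrow> i \<in> {1..j} \<and> d \<le> min_degree l i"
      "\<And>a. a \<in> A \<Longrightarrow> d \<le> ldeg l a \<Longrightarrow> comb v b' j a = comb v ?b j a"
      using Suc.IH[of ?b] Suc.prems by auto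
    have "b' (Suc j) = 0" using b'(1)[of "Suc j"] by auto
    moreover have "comb v ?b j a = comb v b (Suc j) a" if "a \<in> A" "d \<le> ldeg l a" for a
    proof -
      have "comb v ?b j a = comb v b j a - b (Suc j) * comb v e j a"
        by (simp add: comb_def sum_subtractf sum_distrib_left left_diff_distrib mult.assoc)
      also have "comb v e j a = - lookup (v (Suc j)) a"
        using e(2)[OF that] e(1) by (simp add: comb_Suc eq_neg_iff_add_eq_0)
      finally show ?thesis by (simp add: comb_Suc)
    qed
    ultimately have "comb v b' (Suc j) a = comb v b (Suc j) a" if "a \<in> A" "d \<le> ldeg l a" for a
      using b'(2)[OF that] that by (simp add: comb_Suc)
    moreover have "i \<in> {1..Suc j} \<and> d \<le> min_degree l i" if "b' i \<noteq> 0" for i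
      using b'(1)[OF that] by auto
    ultimately show ?thesis by blast
  qed
qed

text \<open>In degrees at least \<open>d\<close> the vector \<open>v i\<close> is a combination of
  earlier vectors, which \<open>eliminate_low\<close> rewrites through those of minimal degree at
  least \<open>d\<close>. These are the earlier indices that enter the independence condition at
  level \<open>d\<close>.\<close>

lemma not_l_lin_indep_above_min_degree:
  assumes i: "i \<in> {1..k}" and d: "min_degree l i < d"
    and \<phi>: "\<And>j. j \<in> {1..<i} \<Longrightarrow> \<phi> j = min_degree l j"
  shows "\<not> l_lin_indep l A v i (\<phi>(i := d))"
proof
  assume li: "l_lin_indep l A v i (\<phi>(i := d))"
  let ?I = "{j \<in> {1..i}. d \<le> (\<phi>(i := d)) j}"
  obtain j where ij: "i = Suc j" "j \<le> k" using i by (cases i) auto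
  obtain c where c: "c i = 1" "\<And>a. a \<in> A \<Longrightarrow> d \<le> ldeg l a \<Longrightarrow> comb v c i a = 0"
    using lowers_iff[OF i] d unfolding lowers_def by blast
  obtain b where b: "\<And>m. b m \<noteq> 0 \<Longrightarrow> m \<in> {1..j} \<and> d \<le> min_degree l m"
      "\<And>a. a \<in> A \<Longrightarrow> d \<le> ldeg l a \<Longrightarrow> comb v b j a = comb v c j a"
    using eliminate_low[OF ij(2), of d l c] by auto
  let ?b = "b(i := 1)"
  have "(\<Sum>m\<in>?I. ?b m * lookup (v m) a) = 0" if a: "a \<in> A" "d \<le> ldeg l a" for a
  proof -
    have "?b m = 0" if "m \<in> {1..i}" "m \<notin> ?I" for m
      using that b(1)[of m] \<phi>[of m] ij by (cases "b m = 0") auto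
    then have "(\<Sum>m\<in>?I. ?b m * lookup (v m) a) = comb v ?b i a"
      unfolding comb_def by (intro sum.mono_neutral_left) auto
    also have "\<dots> = comb v ?b j a + lookup (v i) a" by (simp add: ij comb_Suc)
    also have "comb v ?b j a = comb v b j a" by (rule comb_cong) (simp add: ij)
    also have "comb v b j a + lookup (v i) a = comb v c i a" using b(2)[OF a] c(1) by (simp add: ij comb_Suc)
    finally show ?thesis using c(2)[OF a] by simp
  qed
  then have "\<forall>m\<in>?I. ?b m = 0"
    using li[unfolded l_lin_indep_def lin_indep_restr_def, rule_format, of d ?b] by blast
  then show False using i by (auto dest: bspec[of _ _ i])
qed

lemma l_lin_indep_prefix: "l_lin_indep l A v k \<phi> \<Longrightarrow> i \<le> k \<Longrightarrow> l_lin_indep l A v i \<phi>"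
  unfolding l_lin_indep_def by (intro allI, rule lin_indep_restr_subset[where J = "{j \<in> {1..k}. _ \<le> \<phi> j}"]) auto

lemma l_lin_indep_cong:
  assumes "\<And>j. j \<in> {1..i} \<Longrightarrow> \<phi> j = \<phi>' j"
  shows "l_lin_indep l A v i \<phi> \<longleftrightarrow> l_lin_indep l A v i \<phi>'"
proof -
  have "{j \<in> {1..i}. c \<le> \<phi> j} = {j \<in> {1..i}. c \<le> \<phi>' j}" for c using assms by auto
  then show ?thesis unfolding l_lin_indep_def by simp
qed

lemma l_support_min_degree:
  assumes \<phi>: "\<And>i. i \<in> {1..k} \<Longrightarrow> \<phi> i = min_degree l i"
  shows "l_support l A v k \<phi>"
  unfolding l_support_def
  using l_lin_indep_min_degree[OF \<phi>] not_l_lin_indep_above_min_degree[of _ l _ \<phi>] \<phi> by auto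

text \<open>By induction the earlier values agree. A larger value at \<open>i\<close> breaks
  independence of the prefix, and a smaller one could be raised to the minimal degree without losing
  it.\<close>

lemma l_support_eq_min_degree:
  assumes "l_support l A v k \<phi>" "i \<in> {1..k}"
  shows "\<phi> i = min_degree l i"
  using assms(2)
proof (induction i rule: less_induct)
  case (less i)
  have eq: "\<phi> j = min_degree l j" if "j \<in> {1..<i}" for j using less that by auto
  show ?case
  proof (rule antisym; rule ccontr)
    assume "\<not> \<phi> i \<le> min_degree l i"
    then have "\<not> l_lin_indep l A v i (\<phi>(i := \<phi> i))"
      using not_l_lin_indep_above_min_degree[of i l "\<phi> i" \<phi>] less.prems eq by simp
    moreover have "l_lin_indep l A v k \<phi>" using assms(1) by (simp add: l_support_def)
    then have "l_lin_indep l A v i \<phi>" by (rule l_lin_indep_prefix) (use less.prems in simp)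
    ultimately show False by simp
  next
    assume "\<not> min_degree l i \<le> \<phi> i"
    then have "\<not> l_lin_indep l A v i (\<phi>(i := min_degree l i))"
      using assms(1) less.prems by (simp add: l_support_def)
    moreover have "l_lin_indep l A v i (min_degree l)"
      by (rule l_lin_indep_prefix[OF l_lin_indep_min_degree]) (use less.prems in simp_all)
    then have "l_lin_indep l A v i (\<phi>(i := min_degree l i))"
      by (subst l_lin_indep_cong[of i _ "min_degree l"]) (use eq in auto)
    ultimately show False by simp
  qed
qed

lemma support_seq_eq_min_degree:
  assumes "i \<in> {1..k}"
  shows "support_seq l A v k i = min_degree l i"
proof -
  let ?\<phi> = "restrict (min_degree l) {1..k}"
  have "support_seq l A v k = ?\<phi>"
    unfolding support_seq_def
  proof (rule the_equality)
    show "?\<phi> \<in> extensional {1..k} \<and> l_support l A v k ?\<phi>"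
      by (auto intro!: l_support_min_degree)
    fix \<phi> assume \<phi>: "\<phi> \<in> extensional {1..k} \<and> l_support l A v k \<phi>"
    show "\<phi> = ?\<phi>"
      by (rule extensionalityI[of _ "{1..k}"]) (use \<phi> l_support_eq_min_degree in auto)
  qed
  with assms show ?thesis by simp
qed

text \<open>Column \<open>j\<close> of \<open>c\<close> attains the minimal degree on \<open>v\<^sub>j + \<langle>v\<^sub>1, \<dots>, v\<^sub>j\<^sub>-\<^sub>1\<rangle>\<close>.\<close>

definition reduced :: "int ^ 'n \<Rightarrow> (nat \<Rightarrow> nat \<Rightarrow> complex) \<Rightarrow> bool" where
  "reduced l c \<longleftrightarrow> (\<forall>j\<in>{1..k}. c j j = 1 \<and> (\<forall>i\<in>{1..k}. j < i \<longrightarrow> c i j = 0) \<and>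
     (\<forall>a\<in>A. min_degree l j < ldeg l a \<longrightarrow> comb v (\<lambda>i. c i j) k a = 0))"

lemma ex_reduced: "\<exists>c. reduced l c"
proof -
  have "\<exists>c. c j = 1 \<and> (\<forall>i\<in>{1..k}. j < i \<longrightarrow> c i = 0) \<and>
      (\<forall>a\<in>A. min_degree l j < ldeg l a \<longrightarrow> comb v c k a = 0)" if j: "j \<in> {1..k}" for j
  proof -
    have "lowers l j (min_degree l j + 1)" using lowers_iff[OF j] by simp
    then obtain c where c: "c j = 1" "\<And>a. a \<in> A \<Longrightarrow> min_degree l j + 1 \<le> ldeg l a \<Longrightarrow> comb v c j a = 0"
      unfolding lowers_def by blast
    define c' where "c' i = (if i \<le> j then c i else 0)" for i
    have "comb v c' k a = comb v c j a" for a
    proof -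
      have "comb v c' k a = comb v c' j a" by (rule comb_extend) (use j in \<open>auto simp: c'_def\<close>)
      also have "\<dots> = comb v c j a" by (rule comb_cong) (simp add: c'_def)
      finally show ?thesis .
    qed
    then show ?thesis using c by (intro exI[of _ c']) (auto simp: c'_def)
  qed
  then have "\<forall>j. \<exists>c. j \<in> {1..k} \<longrightarrow> c j = 1 \<and> (\<forall>i\<in>{1..k}. j < i \<longrightarrow> c i = 0) \<and>
      (\<forall>a\<in>A. min_degree l j < ldeg l a \<longrightarrow> comb v c k a = 0)" by blast
  then obtain c where c: "\<forall>j. j \<in> {1..k} \<longrightarrow> c j j = 1 \<and> (\<forall>i\<in>{1..k}. j < i \<longrightarrow> c j i = 0) \<and>
      (\<forall>a\<in>A. min_degree l j < ldeg l a \<longrightarrow> comb v (c j) k a = 0)" by (rule choice[THEN exE])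
  then show ?thesis by (intro exI[of _ "\<lambda>i j. c j i"]) (simp add: reduced_def)
qed

text \<open>Otherwise the column would vanish in degree \<open>min_degree l j\<close> as well, and
  the minimum would be smaller.\<close>

lemma reduced_attained:
  assumes c: "reduced l c" and j: "j \<in> {1..k}"
  shows "\<exists>a\<in>A. ldeg l a = min_degree l j \<and> comb v (\<lambda>i. c i j) k a \<noteq> 0"
proof (rule ccontr)
  assume none: "\<not> ?thesis"
  have "lowers l j (min_degree l j)"
  proof (rule lowersI[OF j, of "\<lambda>i. c i j"])
    show "c j j \<noteq> 0" using c j by (simp add: reduced_def)
    show "c i j = 0" if "i \<in> {1..k}" "j < i" for i using c j that by (simp add: reduced_def)
    fix a assume a: "a \<in> A" "min_degree l j \<le> ldeg l a"
    then show "comb v (\<lambda>i. c i j) k a = 0"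
      using none c j by (cases "ldeg l a = min_degree l j") (auto simp: reduced_def)
  qed
  then show False using lowers_iff[OF j] by simp
qed

text \<open>The \<open>u_j\<close> of the overview. It is built from \<open>v\<close> and the
  columns of \<open>c\<close>, so that \<open>f\<close> enters the leading system only as a
  coefficientwise factor.\<close>

definition top_part :: "int ^ 'n \<Rightarrow> (nat \<Rightarrow> nat \<Rightarrow> complex) \<Rightarrow> nat \<Rightarrow> 'n laurent" where
  "top_part l c j = (\<Sum>a\<in>{a \<in> A. ldeg l a = min_degree l j}. single a (comb v (\<lambda>i. c i j) k a))"

lemma lookup_top_part:
  "lookup (top_part l c j) a =
    (if a \<in> A \<and> ldeg l a = min_degree l j then comb v (\<lambda>i. c i j) k a else 0)"
proof -
  have "lookup (top_part l c j) a =
      (\<Sum>b\<in>{b \<in> A. ldeg l b = min_degree l j}. if b = a then comb v (\<lambda>i. c i j) k b else 0)"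
    by (simp add: top_part_def lookup_sum lookup_single when_def)
  then show ?thesis using A by simp
qed

section \<open>Independence and spans of the leading parts\<close>

lemma comb_comb:
  "(\<Sum>j\<in>J. b j * comb v (\<lambda>i. c i j) k a) = comb v (\<lambda>i. \<Sum>j\<in>J. b j * c i j) k a"
  unfolding comb_def sum_distrib_left sum_distrib_right
  by (subst sum.swap) (simp add: mult.assoc)

text \<open>Let \<open>j0\<close> be the largest index with nonzero coefficient in a relation.
  Leading parts of different degrees have disjoint supports, so the terms of the degree of
  \<open>j0\<close> cancel by themselves; the corresponding combination of columns has highest index
  \<open>j0\<close> and degree below the minimum.\<close>

lemma top_part_indep:
  assumes c: "reduced l c" and i: "i \<le> k"
    and rel: "\<And>a. a \<in> A \<Longrightarrow> (\<Sum>j\<in>{1..i}. b j * lookup (top_part l c j) a) = 0"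
    and j: "j \<in> {1..i}"
  shows "b j = 0"
proof (rule ccontr)
  assume nz: "b j \<noteq> 0"
  define K where "K = {j \<in> {1..i}. b j \<noteq> 0}"
  have K: "finite K" "K \<noteq> {}" using nz j by (auto simp: K_def)
  define j0 where "j0 = Max K"
  have j0: "j0 \<in> {1..i}" "b j0 \<noteq> 0" using Max_in[OF K] by (auto simp: j0_def K_def)
  have above: "b m = 0" if "m \<in> {1..i}" "j0 < m" for m
  proof (rule ccontr)
    assume "b m \<noteq> 0"
    then have "m \<in> K" using that by (simp add: K_def)
    then show False using Max_ge[OF K(1), of m] that by (simp add: j0_def)
  qed
  define d where "d = min_degree l j0"
  define J where "J = {j \<in> {1..i}. min_degree l j = d}"
  have J: "j0 \<in> J" "finite J" "J \<subseteq> {1..k}" using j0 i by (auto simp: J_def d_def)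
  define \<beta> where "\<beta> m = (\<Sum>j\<in>J. b j * c m j)" for m
  have j0k: "j0 \<in> {1..k}" using J by blast
  have summand: "b j * c m j = 0" if "j \<in> J" "m \<in> {1..k}" "j0 \<le> m" "j \<noteq> j0 \<or> j0 < m" for j m
  proof (cases "j0 < j")
    case True
    then show ?thesis using above[of j] that by (simp add: J_def)
  next
    case False
    then have "j < m" using that by auto
    then show ?thesis using c that J(3) by (auto simp: reduced_def)
  qed
  have "lowers l j0 d"
  proof (rule lowersI[OF j0k])
    have "\<beta> j0 = b j0 * c j0 j0"
    proof -
      have "(\<Sum>j\<in>J - {j0}. b j * c j0 j) = 0"
        by (rule sum.neutral) (use summand[of _ j0] j0k in blast)
      then show ?thesis unfolding \<beta>_def by (simp add: sum.remove[OF J(2,1)])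
    qed
    then show "\<beta> j0 \<noteq> 0" using j0 j0k c by (simp add: reduced_def)
    show "\<beta> m = 0" if "m \<in> {1..k}" "j0 < m" for m
      unfolding \<beta>_def by (rule sum.neutral) (use summand that in auto)
    fix a assume a: "a \<in> A" "d \<le> ldeg l a"
    have "comb v \<beta> k a = (\<Sum>j\<in>J. b j * comb v (\<lambda>i. c i j) k a)"
      unfolding comb_comb \<beta>_def ..
    also have "\<dots> = 0"
    proof (cases "ldeg l a = d")
      case True
      have "(\<Sum>j\<in>J. b j * comb v (\<lambda>i. c i j) k a) = (\<Sum>j\<in>{1..i}. b j * lookup (top_part l c j) a)"
        by (rule sum.mono_neutral_cong_left) (use a True in \<open>auto simp: J_def lookup_top_part\<close>)
      then show ?thesis using rel[OF a(1)] by simp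
    next
      case False
      then have "comb v (\<lambda>i. c i j) k a = 0" if "j \<in> J" for j
        using c that J(3) a by (auto simp: reduced_def J_def)
      then show ?thesis by simp
    qed
    finally show "comb v \<beta> k a = 0" .
  qed
  then show False using lowers_iff[OF j0k] by (simp add: d_def)
qed

text \<open>The matrix is unitriangular: subtracting a multiple of the last column removes the
  highest term, and induction does the rest.\<close>

lemma reduced_basis:
  assumes c: "reduced l c" and "j \<le> k"
  shows "\<exists>b. \<forall>a. comb v e j a = (\<Sum>m\<in>{1..j}. b m * comb v (\<lambda>i. c i m) k a)"
  using assms(2)
proof (induction j arbitrary: e)
  case 0
  show ?case by (simp add: comb_def)
next
  case (Suc j)
  have j: "Suc j \<in> {1..k}" using Suc.prems by simp
  let ?e = "\<lambda>i. e i - e (Suc j) * c i (Suc j)"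
  obtain b where b: "\<And>a. comb v ?e j a = (\<Sum>m\<in>{1..j}. b m * comb v (\<lambda>i. c i m) k a)"
    using Suc.IH[of ?e] Suc.prems by auto
  let ?b = "b(Suc j := e (Suc j))"
  have "comb v e (Suc j) a = (\<Sum>m\<in>{1..Suc j}. ?b m * comb v (\<lambda>i. c i m) k a)" for a
  proof -
    have "comb v (\<lambda>i. c i (Suc j)) k a = comb v (\<lambda>i. c i (Suc j)) (Suc j) a"
      by (rule comb_extend) (use c j in \<open>auto simp: reduced_def\<close>)
    moreover have "c (Suc j) (Suc j) = 1" using c j by (simp add: reduced_def)
    moreover have "comb v ?e j a = comb v e j a - e (Suc j) * comb v (\<lambda>i. c i (Suc j)) j a"
      by (simp add: comb_def sum_subtractf sum_distrib_left left_diff_distrib mult.assoc)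
    moreover have "(\<Sum>m\<in>{1..Suc j}. ?b m * comb v (\<lambda>i. c i m) k a)
        = (\<Sum>m\<in>{1..j}. b m * comb v (\<lambda>i. c i m) k a) + e (Suc j) * comb v (\<lambda>i. c i (Suc j)) k a"
      by simp
    ultimately show ?thesis using b[of a] by (simp add: comb_Suc algebra_simps)
  qed
  then show ?case by blast
qed

text \<open>The spans of the leading parts depend only on the preorder which \<open>l\<close> induces on \<open>A\<close>: both
  are the space of leading parts of \<open>\<langle>v\<^sub>1, \<dots>, v\<^sub>i\<rangle>\<close>.\<close>

lemma top_part_in_span:
  assumes c: "reduced l c" and c': "reduced l' c'"
    and order: "\<And>a b. a \<in> A \<Longrightarrow> b \<in> A \<Longrightarrow> ldeg l a \<le> ldeg l b \<longleftrightarrow> ldeg l' a \<le> ldeg l' b"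
    and i: "i \<le> k" and j: "j \<in> {1..i}"
  shows "\<exists>M. \<forall>a. lookup (top_part l' c' j) a = (\<Sum>m\<in>{1..i}. M m * lookup (top_part l c m) a)"
proof -
  define w' where "w' a = comb v (\<lambda>i. c' i j) k a" for a
  have jk: "j \<in> {1..k}" "j \<le> k" using i j by auto
  obtain a1 where a1: "a1 \<in> A" "ldeg l' a1 = min_degree l' j" "w' a1 \<noteq> 0"
    using reduced_attained[OF c' jk(1)] unfolding w'_def by blast
  have w'_deg: "ldeg l' a \<le> min_degree l' j" if "a \<in> A" "w' a \<noteq> 0" for a
    using c' jk(1) that unfolding reduced_def w'_def by force
  have "comb v (\<lambda>i. c' i j) k a = comb v (\<lambda>i. c' i j) j a" for a
    by (rule comb_extend) (use jk c' in \<open>auto simp: reduced_def\<close>)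
  then obtain b where b: "\<And>a. w' a = (\<Sum>m\<in>{1..j}. b m * comb v (\<lambda>i. c i m) k a)"
    using reduced_basis[OF c jk(2), of "\<lambda>i. c' i j"] unfolding w'_def by auto
  define K where "K = {m \<in> {1..j}. b m \<noteq> 0}"
  have K: "finite K" "K \<noteq> {}"
  proof -
    show "finite K" by (simp add: K_def)
    show "K \<noteq> {}"
    proof
      assume "K = {}"
      then have "w' a1 = 0" unfolding b by (intro sum.neutral) (auto simp: K_def)
      with a1 show False by simp
    qed
  qed
  \<comment> \<open>This will be the \<open>l\<close>-degree of \<open>w'\<close>: terms of this
    degree cannot cancel, because leading parts are independent.\<close>
  define d where "d = Max (min_degree l ` K)"
  have "d \<in> min_degree l ` K" unfolding d_def by (rule Max_in) (use K in simp_all)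
  then have d: "\<exists>m\<in>K. min_degree l m = d" by blast
  have d_ge: "min_degree l m \<le> d" if "m \<in> K" for m
    unfolding d_def by (rule Max_ge) (use K that in simp_all)
  define M where "M m = (if m \<in> {1..j} \<and> min_degree l m = d then b m else 0)" for m
  define T where "T a = (\<Sum>m\<in>{1..i}. M m * lookup (top_part l c m) a)" for a
  have low: "comb v (\<lambda>i. c i m) k a = 0" if "a \<in> A" "m \<in> {1..j}" "min_degree l m < ldeg l a" for a m
    using c that jk(2) by (auto simp: reduced_def)
  have w'_top: "w' a = T a" if "a \<in> A" "ldeg l a = d" for a
  proof -
    have "b m * comb v (\<lambda>i. c i m) k a = M m * lookup (top_part l c m) a" if m: "m \<in> {1..j}" for m
    proof (cases "b m = 0 \<or> min_degree l m = d")
      case True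
      then show ?thesis using m \<open>a \<in> A\<close> \<open>ldeg l a = d\<close> by (auto simp: M_def lookup_top_part)
    next
      case False
      then have "min_degree l m < d" using d_ge[of m] m by (force simp: K_def)
      with False show ?thesis using low[OF \<open>a \<in> A\<close> m] \<open>ldeg l a = d\<close> by (simp add: M_def)
    qed
    then have "w' a = (\<Sum>m\<in>{1..j}. M m * lookup (top_part l c m) a)"
      unfolding b by (rule sum.cong[OF refl])
    also have "\<dots> = T a"
      unfolding T_def by (rule sum.mono_neutral_left) (use j in \<open>auto simp: M_def\<close>)
    finally show ?thesis .
  qed
  have w'_above: "w' a = 0" if "a \<in> A" "d < ldeg l a" for a
    unfolding b
  proof (rule sum.neutral, rule ballI)
    fix m assume m: "m \<in> {1..j}"
    show "b m * comb v (\<lambda>i. c i m) k a = 0"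
    proof (cases "b m = 0")
      case False
      then have "min_degree l m < ldeg l a" using d_ge[of m] m that(2) by (force simp: K_def)
      then show ?thesis using low[OF that(1) m] by simp
    qed simp
  qed
  have T0: "T a = 0" if "\<not> (a \<in> A \<and> ldeg l a = d)" for a
    unfolding T_def by (rule sum.neutral) (use that in \<open>auto simp: M_def lookup_top_part\<close>)
  obtain a0 where a0: "a0 \<in> A" "ldeg l a0 = d" "w' a0 \<noteq> 0"
  proof -
    obtain m where m: "m \<in> K" "min_degree l m = d" using d by blast
    then have "M m \<noteq> 0" "m \<in> {1..i}" using j by (auto simp: M_def K_def)
    then obtain a where "a \<in> A" "T a \<noteq> 0"
      using top_part_indep[OF c i, of M m] unfolding T_def by blast
    moreover from this have "ldeg l a = d" using T0[of a] by blast
    ultimately show ?thesis using w'_top[of a] by (intro that[of a]) simp_all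
  qed
  \<comment> \<open>On the support of \<open>w'\<close> the point \<open>a0\<close> has maximal
    \<open>l\<close>-degree and \<open>a1\<close> maximal \<open>l'\<close>-degree. As the preorders
    agree, both maxima are attained at the same points.\<close>
  have "ldeg l a1 \<le> ldeg l a0" using w'_above[OF a1(1)] a1(3) a0(2) by force
  then have "ldeg l' a1 \<le> ldeg l' a0" using order[OF a1(1) a0(1)] by simp
  then have a0': "ldeg l' a0 = min_degree l' j" using w'_deg[OF a0(1,3)] a1(2) by simp
  have "lookup (top_part l' c' j) a = T a" for a
  proof (cases "a \<in> A \<and> w' a \<noteq> 0")
    case True
    then have a: "a \<in> A" "w' a \<noteq> 0" by auto
    have "ldeg l a \<le> d" using w'_above[OF a(1)] a(2) by force
    then have "ldeg l' a = min_degree l' j \<longleftrightarrow> ldeg l a = d"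
      using order[OF a0(1) a(1)] a0(2) a0' w'_deg[OF a] by linarith
    then show ?thesis
      using a w'_top[OF a(1)] T0[of a] by (auto simp: lookup_top_part w'_def)
  next
    case False
    then have "T a = 0" using T0[of a] w'_top[of a] by auto
    moreover have "lookup (top_part l' c' j) a = 0" using False by (auto simp: lookup_top_part w'_def)
    ultimately show ?thesis by simp
  qed
  then show ?thesis unfolding T_def by blast
qed

section \<open>Cancellation matrices and one generic condition for all of them\<close>

lemma lookup_row_times:
  assumes "\<And>i. i \<in> {1..k} \<Longrightarrow> C i j = single 0 (c i)"
  shows "lookup (row_times k (engineered v f) C j) a = comb v c k a * lookup f a"
proof -
  have "lookup (row_times k (engineered v f) C j) a = (\<Sum>i\<in>{1..k}. lookup (single 0 (c i) * (v i \<star> f)) a)"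
    unfolding row_times_def lookup_sum engineered_def
    by (rule sum.cong) (simp_all add: assms mult.commute)
  then show ?thesis
    by (simp add: lookup_const_mult lookup_cwprod comb_def sum_distrib_right mult.assoc)
qed

text \<open>As \<open>f\<close> has full support \<open>A\<close>, multiplication by
  \<open>f\<close> preserves supports. The degree condition on the polynomials is therefore a
  condition on the columns in terms of \<open>v\<close>, and every admissible matrix is
  reduced.\<close>

lemma engineered_reduced:
  assumes f: "keys f = A" and C: "engineered_cancellations A v k f C" and l: "l \<noteq> 0"
  shows "\<exists>c. reduced l c \<and>
    (\<forall>j\<in>{1..k}. lead_l l (row_times k (engineered v f) (C l) j) = top_part l c j \<star> f)"
proof -
  let ?g = "row_times k (engineered v f) (C l)"
  have ut: "upper_unitriangular k (C l)" and cm: "complex_matrix k (C l)"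
    and deg: "\<And>j. j \<in> {1..k} \<Longrightarrow> deg_l l (?g j) = min_degree l j"
    using C l support_seq_eq_min_degree by (auto simp: engineered_cancellations_def)
  define c where "c i j = lookup (C l i j) 0" for i j
  have c: "C l i j = single 0 (c i j)" if "i \<in> {1..k}" "j \<in> {1..k}" for i j
  proof -
    have "\<exists>z. C l i j = single 0 z" using cm that by (simp add: complex_matrix_def)
    then obtain z where "C l i j = single 0 z" ..
    then show ?thesis by (simp add: c_def)
  qed
  have lk: "lookup (?g j) a = comb v (\<lambda>i. c i j) k a * lookup f a" if "j \<in> {1..k}" for j a
    by (rule lookup_row_times) (rule c[OF _ that])
  have f0: "lookup f a = 0 \<longleftrightarrow> a \<notin> A" for a using f by (auto simp: in_keys_iff)
  have "reduced l c"
    unfolding reduced_def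
  proof (intro ballI conjI impI)
    fix j assume j: "j \<in> {1..k}"
    show "c j j = 1" using ut j by (simp add: upper_unitriangular_def c_def)
    show "c i j = 0" if "i \<in> {1..k}" "j < i" for i
      using ut j that by (simp add: upper_unitriangular_def c_def)
    fix a assume a: "a \<in> A" "min_degree l j < ldeg l a"
    show "comb v (\<lambda>i. c i j) k a = 0"
    proof (rule ccontr)
      assume "comb v (\<lambda>i. c i j) k a \<noteq> 0"
      then have "a \<in> keys (?g j)" using lk[OF j] f0[of a] a(1) by (simp add: in_keys_iff)
      then have "ldeg l a \<le> deg_l l (?g j)" unfolding deg_l_def by (intro Max_ge) auto
      then show False using deg[OF j] a(2) by simp
    qed
  qed
  moreover have "lead_l l (?g j) = top_part l c j \<star> f" if j: "j \<in> {1..k}" for j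
    by (rule poly_mapping_eqI)
      (use f0 in \<open>auto simp: lookup_lead_l lookup_cwprod lookup_top_part lk[OF j] deg[OF j]\<close>)
  ultimately show ?thesis by blast
qed

text \<open>The same translation in the other direction; minimality of the degrees makes them
  attained.\<close>

lemma reduced_engineered:
  assumes f: "keys f = A" and c: "\<And>l. reduced l (c l)"
  shows "engineered_cancellations A v k f (\<lambda>l i j. single 0 (c l i j))"
  unfolding engineered_cancellations_def
proof (intro allI impI conjI ballI)
  fix l :: "int ^ 'n"
  show "upper_unitriangular k (\<lambda>i j. single 0 (c l i j))"
    using c[of l] by (auto simp: upper_unitriangular_def reduced_def)
  show "complex_matrix k (\<lambda>i j. single 0 (c l i j))"
    by (auto simp: complex_matrix_def)
  fix j assume j: "j \<in> {1..k}"
  let ?g = "row_times k (engineered v f) (\<lambda>i j. single 0 (c l i j)) j"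
  have lk: "lookup ?g a = comb v (\<lambda>i. c l i j) k a * lookup f a" for a
    by (rule lookup_row_times) simp
  have keys: "keys ?g = {a \<in> A. comb v (\<lambda>i. c l i j) k a \<noteq> 0}"
    using f by (auto simp: in_keys_iff lk)
  obtain a where a: "a \<in> keys ?g" "ldeg l a = min_degree l j"
    using reduced_attained[OF c j] unfolding keys by blast
  then show "?g \<noteq> 0" by auto
  have "deg_l l ?g = min_degree l j"
    unfolding deg_l_def
  proof (rule Max_eqI)
    fix d assume "d \<in> ldeg l ` keys ?g"
    then show "d \<le> min_degree l j" using c[of l] j unfolding keys reduced_def by force
  next
    show "min_degree l j \<in> ldeg l ` keys ?g" using a by (metis imageI)
  qed simp
  then show "deg_l l ?g = support_seq l A v k j" using support_seq_eq_min_degree[OF j] by simp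
qed

text \<open>For each preorder one \<open>l\<close> and one reduced matrix are fixed, and each prefix
  length contributes a polynomial; the product of these with all coefficients of \<open>f\<close> is
  the required condition. Other \<open>l\<close> and other matrices are reached through equality of
  spans.\<close>

lemma generic_nonsingular:
  "\<exists>p\<in>nonzero_coeff_polys A. \<forall>f\<in>laurent_space A. p f \<noteq> 0 \<longrightarrow> keys f = A \<and>
    (\<forall>l c. reduced l c \<longrightarrow> (\<forall>i\<in>{1..k}. \<forall>x b. \<not> singular_at i (top_part l c) f x b))"
proof -
  define ord where "ord l = {(a, b) \<in> A \<times> A. ldeg l a \<le> ldeg l b}" for l
  define \<R> where "\<R> = range ord"
  have "\<R> \<subseteq> Pow (A \<times> A)" by (auto simp: \<R>_def ord_def)
  then have fin: "finite (\<R> \<times> {1..k})" using A by (simp add: finite_subset)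
  define L where "L R = (SOME l. ord l = R)" for R
  have L: "ord (L (ord l)) = ord l" for l unfolding L_def by (rule someI) (rule refl)
  define cc where "cc R = (SOME c. reduced (L R) c)" for R
  have cc: "reduced (L R) (cc R)" for R unfolding cc_def by (rule someI_ex[OF ex_reduced])
  define good where "good p R i \<longleftrightarrow> p \<in> nonzero_coeff_polys A \<and>
    (\<forall>f\<in>laurent_space A. p f \<noteq> 0 \<longrightarrow> (\<forall>x b. \<not> singular_at i (top_part (L R) (cc R)) f x b))" for p R i
  have "top_part l c j \<in> laurent_space A" for l c j by (simp add: laurent_space_iff lookup_top_part)
  then have "\<exists>p. good p (fst z) (snd z)" for z
    using generic_smoothness[OF A, of "snd z" "top_part (L (fst z)) (cc (fst z))"] unfolding good_def by blast
  then have "\<forall>z. \<exists>p. good p (fst z) (snd z)" by blast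
  then obtain q where q: "\<forall>z. good (q z) (fst z) (snd z)" by (rule choice[THEN exE])
  have q_nz: "(\<lambda>f. \<Prod>z\<in>\<R> \<times> {1..k}. q z f) \<in> nonzero_coeff_polys A"
    by (intro nonzero_coeff_polys_prod[OF fin]) (use q in \<open>unfold good_def, blast\<close>)
  have "(\<lambda>f. lookup f a) \<in> nonzero_coeff_polys A" if "a \<in> A" for a
  proof -
    have "single a 1 \<in> laurent_space A" "lookup (single a (1 :: complex)) a \<noteq> 0"
      using that by (auto simp: laurent_space_iff lookup_single when_def)
    then show ?thesis
      using coeff_polynomials.coord[OF that] unfolding nonzero_coeff_polys_def by blast
  qed
  then have k_nz: "(\<lambda>f. \<Prod>a\<in>A. lookup f a) \<in> nonzero_coeff_polys A"
    by (intro nonzero_coeff_polys_prod[OF A])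
  show ?thesis
  proof (rule bexI[OF _ nonzero_coeff_polys_mult[OF q_nz k_nz]], intro ballI impI conjI allI notI)
    fix f assume f: "f \<in> laurent_space A"
      and nz: "(\<Prod>z\<in>\<R> \<times> {1..k}. q z f) * (\<Prod>a\<in>A. lookup f a) \<noteq> 0"
    show "keys f = A"
      using f nz A by (auto simp: laurent_space_def in_keys_iff)
    fix l c i x b
    assume c: "reduced l c" and i: "i \<in> {1..k}" and sing: "singular_at i (top_part l c) f x b"
    define R where "R = ord l"
    have order: "ldeg l a \<le> ldeg l b \<longleftrightarrow> ldeg (L R) a \<le> ldeg (L R) b" if "a \<in> A" "b \<in> A" for a b
    proof -
      have "(a, b) \<in> ord (L R) \<longleftrightarrow> (a, b) \<in> ord l" by (simp add: L R_def)
      then show ?thesis using that by (simp add: ord_def)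
    qed
    have ik: "i \<le> k" using i by simp
    have "\<exists>b'. singular_at i (top_part (L R) (cc R)) f x b'"
    proof (rule singular_at_span[OF _ _ sing])
      fix j assume j: "j \<in> {1..i}"
      show "\<exists>M. \<forall>a. lookup (top_part l c j) a = (\<Sum>m\<in>{1..i}. M m * lookup (top_part (L R) (cc R) m) a)"
        by (rule top_part_in_span[OF cc c _ ik j]) (simp add: order)
      show "\<exists>M. \<forall>a. lookup (top_part (L R) (cc R) j) a = (\<Sum>m\<in>{1..i}. M m * lookup (top_part l c m) a)"
        by (rule top_part_in_span[OF c cc _ ik j]) (simp add: order)
    qed
    moreover have "q (R, i) f \<noteq> 0"
      using nz fin i by (auto simp: \<R>_def R_def)
    ultimately show False using q[rule_format, of "(R, i)"] f by (simp add: good_def)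
  qed
qed

text \<open>Independence of the leading parts translates a nonzero coefficient vector into the
  nontriviality clause of \<open>singular_at\<close>.\<close>

lemma regular_leading_parts:
  assumes f: "keys f = A" and C: "engineered_cancellations A v k f C" and l: "l \<noteq> 0"
    and i: "i \<in> {1..k}"
    and ns: "\<And>l c i x b. reduced l c \<Longrightarrow> i \<in> {1..k} \<Longrightarrow> \<not> singular_at i (top_part l c) f x b"
  shows "regular_system i (\<lambda>j. lead_l l (row_times k (engineered v f) (C l) j))"
proof -
  obtain c where c: "reduced l c"
    "\<And>j. j \<in> {1..k} \<Longrightarrow> lead_l l (row_times k (engineered v f) (C l) j) = top_part l c j \<star> f"
    using engineered_reduced[OF f C l] by blast
  let ?h = "\<lambda>j. lead_l l (row_times k (engineered v f) (C l) j)"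
  have h: "?h j = top_part l c j \<star> f" if "j \<in> {1..i}" for j using c(2) that i by simp
  show ?thesis
    unfolding regular_system_iff
  proof (intro ballI allI impI, rule ccontr)
    fix x b j
    assume x: "x \<in> torus_zeros i ?h" and j: "j \<in> {1..i}" "b j \<noteq> 0"
      and rel: "\<forall>m. (\<Sum>j\<in>{1..i}. b j * laurent_eval (euler m (?h j)) x) = 0"
    have "x \<in> torus_zeros i (\<lambda>j. top_part l c j \<star> f)"
      using x h by (simp add: torus_zeros_def)
    moreover have "(\<Sum>j\<in>{1..i}. b j * laurent_eval (euler m (top_part l c j \<star> f)) x) = 0" for m
    proof -
      have "(\<Sum>j\<in>{1..i}. b j * laurent_eval (euler m (top_part l c j \<star> f)) x)
          = (\<Sum>j\<in>{1..i}. b j * laurent_eval (euler m (?h j)) x)"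
        by (rule sum.cong[OF refl]) (simp only: h)
      then show ?thesis using rel by simp
    qed
    moreover have "\<exists>a. (\<Sum>j\<in>{1..i}. b j * lookup (top_part l c j) a) \<noteq> 0"
    proof (rule ccontr)
      assume "\<not> ?thesis"
      then have "b j = 0" using top_part_indep[OF c(1) _ _ j(1), of b] i by auto
      then show False using j(2) by simp
    qed
    ultimately have "singular_at i (top_part l c) f x b" unfolding singular_at_def by blast
    then show False using ns[OF c(1) i] by blast
  qed
qed

end

theorem theorem4p8:
  fixes A :: "(int ^ 'n::finite) set" and v :: "nat \<Rightarrow> 'n laurent" and k :: nat
  assumes "finite A" and "\<not> in_hyperplane A"
    and "\<And>i. i \<in> {1..k} \<Longrightarrow> v i \<in> laurent_space A"
    and "lin_indep_restr {1..k} v A"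
  shows "((\<forall>f. Poly_Mapping.keys f = A \<longrightarrow> (\<exists>C. engineered_cancellations A v k f C)) \<and>
          generically A (\<lambda>f. Poly_Mapping.keys f = A \<and>
            (\<forall>C. engineered_cancellations A v k f C \<longrightarrow> cancellable_with k (engineered v f) C)))
       \<and> generically A (\<lambda>f. Poly_Mapping.keys f = A \<and>
            (\<forall>C. engineered_cancellations A v k f C \<longrightarrow> nondegenerate_upon k (engineered v f) C))"
proof -
  note A = assms(1) and indep = assms(4)
  have ex: "\<exists>C. engineered_cancellations A v k f C" if "keys f = A" for f
  proof -
    have "\<forall>l. \<exists>c. reduced A v k l c" using ex_reduced[OF A indep] by blast
    then obtain c where "\<forall>l. reduced A v k l (c l)" by (rule choice[THEN exE])
    then show ?thesis using reduced_engineered[OF A indep that, of c] by blast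
  qed
  \<comment> \<open>One hypersurface is removed for both halves: regularity gives nondegeneracy
    directly, and codimension through \<open>regular_system_codim\<close>.\<close>
  obtain p where p: "p \<in> nonzero_coeff_polys A"
    and keys: "\<And>f. f \<in> laurent_space A \<Longrightarrow> p f \<noteq> 0 \<Longrightarrow> keys f = A"
    and ns: "\<And>f l c i x b. f \<in> laurent_space A \<Longrightarrow> p f \<noteq> 0 \<Longrightarrow> reduced A v k l c \<Longrightarrow> i \<in> {1..k} \<Longrightarrow>
      \<not> singular_at i (top_part A v k l c) f x b"
    using generic_nonsingular[OF A indep] by blast
  have reg: "regular_system i (\<lambda>j. lead_l l (row_times k (engineered v f) (C l) j))"
    if "f \<in> laurent_space A" "p f \<noteq> 0" "engineered_cancellations A v k f C" "l \<noteq> 0" "i \<in> {1..k}" for f C l i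
    by (rule regular_leading_parts[OF A indep keys[OF that(1,2)] that(3,4,5)]) (rule ns[OF that(1,2)])
  have ut: "upper_unitriangular k (C l)" if "engineered_cancellations A v k f C" "l \<noteq> 0" for f C l
    using that by (simp add: engineered_cancellations_def)
  show ?thesis
  proof (intro conjI allI impI)
    show "generically A (\<lambda>f. keys f = A \<and>
        (\<forall>C. engineered_cancellations A v k f C \<longrightarrow> cancellable_with k (engineered v f) C))"
    proof (rule generically_of_nonzero[OF p], intro conjI allI impI)
      fix f C assume f: "f \<in> laurent_space A" "p f \<noteq> 0"
      show "keys f = A" by (rule keys[OF f])
      assume C: "engineered_cancellations A v k f C"
      show "cancellable_with k (engineered v f) C"
        unfolding cancellable_with_def
        by (intro allI impI conjI ballI ut[OF C] regular_system_codim reg[OF f C])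
    qed
    show "generically A (\<lambda>f. keys f = A \<and>
        (\<forall>C. engineered_cancellations A v k f C \<longrightarrow> nondegenerate_upon k (engineered v f) C))"
    proof (rule generically_of_nonzero[OF p], intro conjI allI impI)
      fix f C assume f: "f \<in> laurent_space A" "p f \<noteq> 0"
      show "keys f = A" by (rule keys[OF f])
      assume C: "engineered_cancellations A v k f C"
      show "nondegenerate_upon k (engineered v f) C"
        unfolding nondegenerate_upon_def
        by (intro allI impI conjI ballI ut[OF C] reg[OF f C])
    qed
  qed (rule ex)
qed

end
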